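(* Let $1\leq p,p_1,p_2<\infty$, $1/p=1/p_1+1/p_2$, $-1/p_1<\lambda<0$, $-Q<\alpha<\infty$, and $p_2>(Q+\alpha)/Q$ if $0<\alpha<\infty$ or $p_2\geq1$ if $-Q<\alpha\leq0$. Suppose that $\Phi$ is a nonnegative function and there is a constant $C_0$ independent of $y$ such that $\Vert A^{-1}(y)\Vert\leq C_0\Vert A(y)\Vert^{-1}$ for all $y\in\mathrm{supp}(\Phi)$. If $b\in CMO^{p_2}(\mathbb{H}^n;|\cdot|_h^{\alpha})$ and $$\int_{\mathbb{H}^n}\frac{\Phi(y)}{|y|_h^{Q}}\Vert A(y)\Vert^{(Q+\alpha)\lambda}\,dy<\infty,$$ then we have the following conclusions. (i) $\mathcal{H}^{b,1}_{\Phi,A}$ is bounded from $\dot{L}^{p_1,\lambda}(\mathbb{H}^n;|\cdot|_h^{\alpha})$ to $\dot{L}^{p,\lambda}(\mathbb{H}^n;|\cdot|_h^{\alpha})$ if and only if $$\int_{\Vert A(y)\Vert\leq1}\frac{\Phi(y)}{|y|_h^{Q}}\Vert A(y)\Vert^{(Q+\alpha)\lambda}\,\big|\log_2\Vert A(y)\Vert\big|\,dy<\infty.$$ (ii) $\mathcal{H}^{b,2}_{\Phi,A}$ is bounded from $\dot{L}^{p_1,\lambda}(\mathbb{H}^n;|\cdot|_h^{\alpha})$ to $\dot{L}^{p,\lambda}(\mathbb{H}^n;|\cdot|_h^{\alpha})$ if and only if $$\int_{\Vert A(y)\Vert>1}\frac{\Phi(y)}{|y|_h^{Q}}\Vert A(y)\Vert^{(Q+\alpha)\lambda}\log_2\Vert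 A(y)\Vert\,dy<\infty.$$
   Context: The Heisenberg group $\mathbb{H}^n$ is $\mathbf{R}^{2n}\times\mathbf{R}$ with group law $x\cdot y=\big(x_1+y_1,\dots,x_{2n}+y_{2n},\,x_{2n+1}+y_{2n+1}+2\sum_{j=1}^n(y_jx_{n+j}-x_jy_{n+j})\big)$; the inverse of $x$ is $-x$; Haar measure is Lebesgue measure $dx$, and $|E|$ is the measure of $E$. $Q=2n+2$ is the homogeneous dimension. The norm is $|x|_h=\big[(\sum_{i=1}^{2n}x_i^2)^2+x_{2n+1}^2\big]^{1/4}$, the distance is $d(p,q)=|q^{-1}p|_h$, and $B(x,r)=\{y: d(x,y)<r\}$. For a $(2n+1)\times(2n+1)$ matrix $M$ (acting on $\mathbf{R}^{2n+1}$), $\Vert M\Vert=\sup_{x\in\mathbb{H}^n,\,x\neq0}|Mx|_h/|x|_h$. $A^{-1}(y)$ denotes the inverse matrix of $A(y)$. $\Phi$ is a locally integrable function on $\mathbb{H}^n$, and $A(y)$ is a function on $\mathbb{H}^n$ with values in $(2n+1)\times(2n+1)$ matrices with $\det A(y)\neq0$ almost everywhere in the support of $\Phi$. For a locally integrable function $b$ on $\mathbb{H}^n$, define $$(\mathcal{H}^{b,1}_{\Phi,A}f)(x)=\int_{\Vert A(y)\Vert\leq1}\frac{\Phi(y)}{|y|_h^Q}f(A(y)x)\,[b(x)-b(A(y)x)]\,dy,$$ $$(\mathcal{H}^{b,2}_{\Phi,A}f)(x)=\int_{\Vert A(y)\Vert>1}\frac{\Phi(y)}{|y|_h^Q}f(A(y)x)\,[b(x)-b(A(y)x)]\,dy.$$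 For a weight $w$ (a nonnegative locally integrable function on $\mathbb{H}^n$; here $w(x)=|x|_h^\alpha$), put $w(E)=\int_E w(x)\,dx$. For $1\leq p<\infty$ and $-1/p\leq\lambda<0$, the weighted central Morrey space $\dot{L}^{p,\lambda}(\mathbb{H}^n;w)$ consists of $f\in L^p_{loc}(\mathbb{H}^n;w)$ with $\Vert f\Vert_{\dot{L}^{p,\lambda}(\mathbb{H}^n;w)}=\sup_{r>0}\left(\frac{1}{w(B(0,r))^{1+p\lambda}}\int_{B(0,r)}|f(x)|^pw(x)\,dx\right)^{1/p}<\infty$. An operator $T$ is bounded from $X$ to $Y$ if there is a constant $C$ with $\Vert Tf\Vert_Y\leq C\Vert f\Vert_X$ for all $f\in X$. For $1\leq p<\infty$, the weighted central BMO space $CMO^p(\mathbb{H}^n;w)$ consists of $f\in L^p_{loc}(\mathbb{H}^n;w)$ with $\Vert f\Vert_{CMO^p(\mathbb{H}^n;w)}=\sup_{r>0}\left(\frac1{w(B(0,r))}\int_{B(0,r)}|f(x)-f_{B(0,r)}|^pw(x)\,dx\right)^{1/p}<\infty$, where $f_{B(0,r)}=\frac1{|B(0,r)|}\int_{B(0,r)}f(x)\,dx$.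
   Formalization: For a fixed b the "only if" parts fail (b = 0 gives the zero operator), so (i) and (ii) are stated as: the operator is bounded for every b in CMO^{p_2} if and only if the logarithmic integral is finite; A is assumed measurable. *)

theory Defs
  imports "HOL-Analysis.Analysis"
begin

section \<open>The Heisenberg group\<close>

text \<open>
  With \<open>n = CARD('n)\<close>, the coordinate \<open>x\<^sub>j\<close> is \<open>x $ Some (Inl j)\<close>, the coordinate
  \<open>x\<^sub>n\<^sub>+\<^sub>j\<close> is \<open>x $ Some (Inr j)\<close>, and the central coordinate \<open>x\<^sub>2\<^sub>n\<^sub>+\<^sub>1\<close> is \<open>x $ None\<close>.
  Haar measure is \<open>lebesgue\<close>, and the group inverse is \<open>uminus\<close>.
\<close>

type_synonym 'n heis = "(real, ('n + 'n) option) vec"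

type_synonym 'n heis_matrix = "((real, ('n + 'n) option) vec, ('n + 'n) option) vec"

definition heis_mult :: "'n::finite heis \<Rightarrow> 'n heis \<Rightarrow> 'n heis" where
  "heis_mult x y = (\<chi> k. case k of
      Some i \<Rightarrow> x $ Some i + y $ Some i
    | None \<Rightarrow> x $ None + y $ None
        + 2 * (\<Sum>j\<in>UNIV. y $ Some (Inl j) * x $ Some (Inr j) - x $ Some (Inl j) * y $ Some (Inr j)))"

definition hom_dim :: "'n::finite itself \<Rightarrow> nat" where
  "hom_dim _ = 2 * CARD('n) + 2"

definition hnorm :: "'n::finite heis \<Rightarrow> real" where
  "hnorm x = ((\<Sum>i\<in>UNIV. (x $ Some i)\<^sup>2)\<^sup>2 + (x $ None)\<^sup>2) powr (1/4)"

definition hdist :: "'n::finite heis \<Rightarrow> 'n heis \<Rightarrow> real" where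
  "hdist p q = hnorm (heis_mult (- q) p)"

definition hball :: "'n::finite heis \<Rightarrow> real \<Rightarrow> 'n heis set" where
  "hball x r = {y. hdist x y < r}"

text \<open>
  The supremum is infinite for many matrices (for instance if \<open>M\<close> has a nonzero entry mixing
  the horizontal and the central coordinates), so it is taken in \<open>ennreal\<close>.
\<close>

definition hmat_norm :: "'n::finite heis_matrix \<Rightarrow> ennreal" where
  "hmat_norm M = (SUP x\<in>-{0}. ennreal (hnorm (M *v x) / hnorm x))"

section \<open>Function spaces\<close>

definition supp :: "('a::topological_space \<Rightarrow> 'b::zero) \<Rightarrow> 'a set" where
  "supp f = closure {x. f x \<noteq> 0}"

definition locally_integrable ::
  "('n::finite heis \<Rightarrow> 'k::{banach, second_countable_topology}) \<Rightarrow> bool" where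
  "locally_integrable f \<longleftrightarrow> (\<forall>K. compact K \<longrightarrow> set_integrable lebesgue K f)"

definition Lp_loc ::
  "real \<Rightarrow> ('n::finite heis \<Rightarrow> real)
    \<Rightarrow> ('n heis \<Rightarrow> 'k::{banach, second_countable_topology}) set" where
  "Lp_loc p w = {f. f \<in> borel_measurable lebesgue \<and>
     (\<forall>K. compact K \<longrightarrow> set_integrable lebesgue K (\<lambda>x. norm (f x) powr p * w x))}"

definition wmeasure :: "('n::finite heis \<Rightarrow> real) \<Rightarrow> 'n heis set \<Rightarrow> real" where
  "wmeasure w E = (LINT x:E|lebesgue. w x)"

definition morrey_term ::
  "real \<Rightarrow> real \<Rightarrow> ('n::finite heis \<Rightarrow> real)
    \<Rightarrow> ('n heis \<Rightarrow> 'k::{banach, second_countable_topology}) \<Rightarrow> real \<Rightarrow> real" where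
  "morrey_term p lam w f r =
     (1 / wmeasure w (hball 0 r) powr (1 + p * lam)
       * (LINT x:hball 0 r|lebesgue. norm (f x) powr p * w x)) powr (1 / p)"

definition morrey_norm ::
  "real \<Rightarrow> real \<Rightarrow> ('n::finite heis \<Rightarrow> real)
    \<Rightarrow> ('n heis \<Rightarrow> 'k::{banach, second_countable_topology}) \<Rightarrow> real" where
  "morrey_norm p lam w f = (SUP r\<in>{0<..}. morrey_term p lam w f r)"

definition morrey_space ::
  "real \<Rightarrow> real \<Rightarrow> ('n::finite heis \<Rightarrow> real)
    \<Rightarrow> ('n heis \<Rightarrow> 'k::{banach, second_countable_topology}) set" where
  "morrey_space p lam w = {f \<in> Lp_loc p w. bdd_above (morrey_term p lam w f ` {0<..})}"

definition ball_mean ::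
  "('n::finite heis \<Rightarrow> 'k::{banach, second_countable_topology}) \<Rightarrow> real \<Rightarrow> 'k" where
  "ball_mean f r =
     (1 / measure lebesgue (hball (0::'n heis) r)) *\<^sub>R (LINT x:hball 0 r|lebesgue. f x)"

definition cmo_term ::
  "real \<Rightarrow> ('n::finite heis \<Rightarrow> real)
    \<Rightarrow> ('n heis \<Rightarrow> 'k::{banach, second_countable_topology}) \<Rightarrow> real \<Rightarrow> real" where
  "cmo_term p w f r =
     (1 / wmeasure w (hball 0 r)
       * (LINT x:hball 0 r|lebesgue. norm (f x - ball_mean f r) powr p * w x)) powr (1 / p)"

text \<open>Local integrability is what makes the unweighted means \<open>ball_mean f r\<close> meaningful.\<close>

definition cmo_space ::
  "real \<Rightarrow> ('n::finite heis \<Rightarrow> real)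
    \<Rightarrow> ('n heis \<Rightarrow> 'k::{banach, second_countable_topology}) set" where
  "cmo_space p w =
     {f \<in> Lp_loc p w. locally_integrable f \<and> bdd_above (cmo_term p w f ` {0<..})}"

section \<open>Commutators of Hausdorff operators\<close>

definition comm_integrand ::
  "('n::finite heis \<Rightarrow> real) \<Rightarrow> ('n heis \<Rightarrow> 'n heis_matrix)
    \<Rightarrow> ('n heis \<Rightarrow> 'k::{real_normed_field, banach, second_countable_topology})
    \<Rightarrow> ('n heis \<Rightarrow> 'k) \<Rightarrow> 'n heis \<Rightarrow> 'n heis \<Rightarrow> 'k" where
  "comm_integrand \<Phi> A b f x y =
     (\<Phi> y / hnorm y ^ hom_dim TYPE('n)) *\<^sub>R (f (A y *v x) * (b x - b (A y *v x)))"

definition hausdorff_comm ::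
  "'n heis set \<Rightarrow> ('n::finite heis \<Rightarrow> real) \<Rightarrow> ('n heis \<Rightarrow> 'n heis_matrix)
    \<Rightarrow> ('n heis \<Rightarrow> 'k::{real_normed_field, banach, second_countable_topology})
    \<Rightarrow> ('n heis \<Rightarrow> 'k) \<Rightarrow> 'n heis \<Rightarrow> 'k" where
  "hausdorff_comm S \<Phi> A b f x = (LINT y:S|lebesgue. comm_integrand \<Phi> A b f x y)"

definition contracting_set :: "('n::finite heis \<Rightarrow> 'n heis_matrix) \<Rightarrow> 'n heis set" where
  "contracting_set A = {y. hmat_norm (A y) \<le> 1}"

definition expanding_set :: "('n::finite heis \<Rightarrow> 'n heis_matrix) \<Rightarrow> 'n heis set" where
  "expanding_set A = {y. hmat_norm (A y) > 1}"

text \<open>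
  The operators \<open>\<H>\<^sup>b\<^sup>,\<^sup>1\<close> and \<open>\<H>\<^sup>b\<^sup>,\<^sup>2\<close> are \<open>hausdorff_comm\<close> over the contracting and over the
  expanding set. The Bochner integral of a non-integrable function is \<open>0\<close> by convention, so
  boundedness has to demand explicitly that the integral defining the image of each \<open>f\<close> in the
  source space converges absolutely at almost every point.
\<close>

definition hausdorff_comm_defined ::
  "'n heis set \<Rightarrow> ('n::finite heis \<Rightarrow> real) \<Rightarrow> ('n heis \<Rightarrow> 'n heis_matrix)
    \<Rightarrow> ('n heis \<Rightarrow> 'k::{real_normed_field, banach, second_countable_topology})
    \<Rightarrow> ('n heis \<Rightarrow> 'k) \<Rightarrow> bool" where
  "hausdorff_comm_defined S \<Phi> A b f \<longleftrightarrow>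
     (AE x in lebesgue. set_integrable lebesgue S (comm_integrand \<Phi> A b f x))"

definition hausdorff_comm_bounded ::
  "real \<Rightarrow> real \<Rightarrow> real \<Rightarrow> ('n::finite heis \<Rightarrow> real)
    \<Rightarrow> 'n heis set \<Rightarrow> ('n heis \<Rightarrow> real) \<Rightarrow> ('n heis \<Rightarrow> 'n heis_matrix)
    \<Rightarrow> ('n heis \<Rightarrow> 'k::{real_normed_field, banach, second_countable_topology}) \<Rightarrow> bool" where
  "hausdorff_comm_bounded p1 p lam w S \<Phi> A b \<longleftrightarrow>
     (\<exists>C::real. \<forall>f\<in>morrey_space p1 lam w.
        hausdorff_comm_defined S \<Phi> A b f \<and>
        hausdorff_comm S \<Phi> A b f \<in> morrey_space p lam w \<and>
        morrey_norm p lam w (hausdorff_comm S \<Phi> A b f) \<le> C * morrey_norm p1 lam w f)"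

text \<open>
  The power is formed in the reals. At points where \<open>hmat_norm (A y)\<close> is infinite this
  yields \<open>0\<close>, in accordance with the exponent being negative in all uses below.
\<close>

definition size_density ::
  "real \<Rightarrow> ('n::finite heis \<Rightarrow> real) \<Rightarrow> ('n heis \<Rightarrow> 'n heis_matrix) \<Rightarrow> 'n heis \<Rightarrow> real" where
  "size_density s \<Phi> A y =
     \<Phi> y / hnorm y ^ hom_dim TYPE('n) * enn2real (hmat_norm (A y)) powr s"

end

theory Submission
  imports Defs
begin

text \<open>
  Write \<open>B\<^sub>r\<close> for the ball of radius \<open>r\<close> about the origin, \<open>a = \<parallel>A(y)\<parallel>\<close>, and \<open>C = max C0 1\<close>. The bound on
  the norm of the inverse matrix says that \<open>(a/C) |x| \<le> |A(y) x| \<le> a |x|\<close> for all \<open>x\<close>: up to the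
  fixed constant \<open>C\<close>, the matrix \<open>A(y)\<close> acts on balls about the origin like the dilation by \<open>a\<close>
  (\<open>quasi_dilation\<close>). Both directions of the theorem rest on this, and neither distinguishes small
  from large \<open>a\<close>; the two parts are therefore one statement about an arbitrary measurable set \<open>S\<close>
  of parameters \<open>y\<close> (\<open>hausdorff_comm_bounded_iff\<close>), used for \<open>{a \<le> 1}\<close> and for \<open>{a > 1}\<close>.

  Sufficiency. Fix \<open>y\<close> and a ball \<open>B\<^sub>r\<close>. By Hoelder's inequality the \<open>L\<^sup>p\<close>-norm of
  \<open>f(A(y)x) (b(x) - b(A(y)x))\<close> on \<open>B\<^sub>r\<close> is at most the product of an \<open>L\<^sup>p\<^sup>1\<close>-norm and an \<open>L\<^sup>p\<^sup>2\<close>-norm. The change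
  of variables \<open>z = A(y)x\<close> sends \<open>B\<^sub>r\<close> into \<open>B\<^sub>a\<^sub>r\<close>, and \<open>w(B\<^sub>a\<^sub>r) = a\<^sup>Q\<^sup>+\<^sup>\<alpha> w(B\<^sub>r)\<close>, so the factor with \<open>f\<close> has size
  \<open>a powr ((Q + \<alpha>) \<lambda>)\<close> times the Morrey norm. In the factor with \<open>b\<close> one subtracts the means of \<open>b\<close>
  over \<open>B\<^sub>r\<close> and over \<open>B\<^sub>a\<^sub>r\<close>; both oscillations are bounded, and the two means differ by at most a
  multiple of \<open>1 + |log a|\<close>, by telescoping through balls whose radii double
  (\<open>dyadic_telescoping\<close>). Passing from the weighted oscillation to the unweighted means is where the
  condition relating \<open>p2\<close> and \<open>\<alpha>\<close> enters (\<open>nn_integral_hball_mean_bound\<close>). Integration in \<open>y\<close>, by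
  Minkowski's inequality, produces the integral of the size density against \<open>1 + |log a|\<close>.

  Only boundedness is at stake, never the value of a constant. This allows Hoelder's, Jensen's and
  Minkowski's inequalities to be replaced by consequences, with a factor \<open>2\<close>, of elementary pointwise
  inequalities such as \<open>g \<le> X v + X powr (1 - p) (g powr p) (v powr (1 - p))\<close>, integrated and with
  \<open>X\<close> chosen well. In particular Minkowski's inequality becomes Jensen's inequality for the measure
  with density \<open>v(y) = \<Phi>(y) |y| powr (- Q) a powr ((Q + \<alpha>) \<lambda>) (1 + |log a|)\<close>, followed by Tonelli's theorem.

  Necessity. Test with \<open>b(x) = log |x|\<close> and \<open>f(x) = |x| powr ((Q + \<alpha>) \<lambda>)\<close>. At any point \<open>x \<noteq> 0\<close> the
  difference \<open>b(x) - b(A(y)x)\<close> equals \<open>- log a\<close> up to \<open>log C\<close>, and \<open>f(A(y)x) \<ge> a powr ((Q + \<alpha>) \<lambda>) f(x)\<close> since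
  the exponent is negative. Hence the absolute convergence of the integral defining the operator at
  a single point \<open>x \<noteq> 0\<close> already forces the logarithmic integral to be finite
  (\<open>log_size_integral_finite\<close>).
\<close>

section \<open>The homogeneous norm and its dilations\<close>

abbreviation homdim :: "'n::finite itself \<Rightarrow> real" where
  "homdim N \<equiv> real (hom_dim N)"

lemma hnorm_nonneg: "0 \<le> hnorm x"
  by (simp add: hnorm_def)

text \<open>
  The fourth power of the norm is a polynomial, so identities for the norm are checked on fourth powers.
\<close>

lemma hnorm_power4: "hnorm x ^ 4 = (\<Sum>i\<in>UNIV. (x $ Some i)\<^sup>2)\<^sup>2 + (x $ None)\<^sup>2"
proof -
  define N where "N = (\<Sum>i\<in>UNIV. (x $ Some i)\<^sup>2)\<^sup>2 + (x $ None)\<^sup>2"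
  have "N \<ge> 0" unfolding N_def by simp
  then have "(N powr (1/4)) ^ 4 = N"
    by (cases "N = 0") (simp_all add: powr_power)
  then show ?thesis by (simp add: hnorm_def N_def)
qed

lemma hnorm_eq_iff_power4: "0 \<le> c \<Longrightarrow> hnorm x = c \<longleftrightarrow> hnorm x ^ 4 = c ^ 4"
  using hnorm_nonneg[of x] power_eq_iff_eq_base[of 4 "hnorm x" c] by auto

lemma hnorm_zero [simp]: "hnorm 0 = 0"
  by (simp add: hnorm_def)

lemma hnorm_eq_0_iff [simp]: "hnorm x = 0 \<longleftrightarrow> x = 0"
proof
  assume "hnorm x = 0"
  then have "(\<Sum>i\<in>UNIV. (x $ Some i)\<^sup>2)\<^sup>2 + (x $ None)\<^sup>2 = 0"
    using hnorm_power4[of x] by simp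
  then have "(\<Sum>i\<in>UNIV. (x $ Some i)\<^sup>2) = 0" "x $ None = 0"
    by (simp_all add: sum_power2_eq_zero_iff)
  then have "x $ k = 0" for k
    by (cases k) (auto simp: sum_nonneg_eq_0_iff)
  then show "x = 0" by (simp add: vec_eq_iff)
qed simp

lemma hnorm_pos_iff: "0 < hnorm x \<longleftrightarrow> x \<noteq> 0"
  using hnorm_nonneg[of x] hnorm_eq_0_iff[of x] by linarith

lemma hnorm_minus: "hnorm (- x) = hnorm x"
  by (simp add: hnorm_def)

lemma continuous_on_hnorm [continuous_intros]: "continuous_on S hnorm"
  unfolding hnorm_def by (intro continuous_intros continuous_on_powr') auto

lemma hnorm_borel [measurable]: "hnorm \<in> borel_measurable borel"
  by (intro borel_measurable_continuous_onI continuous_intros)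

lemma hball_zero: "hball (0 :: 'n::finite heis) r = {x. hnorm x < r}"
proof -
  have "heis_mult (- y) 0 = - y" for y :: "'n heis"
    by (simp add: heis_mult_def vec_eq_iff split: option.split)
  then show ?thesis by (auto simp: hball_def hdist_def hnorm_minus)
qed

lemma hball_borel [measurable]: "hball 0 r \<in> sets borel"
proof -
  have "hball 0 r = hnorm -` {..<r} \<inter> space borel" by (auto simp: hball_zero)
  then show ?thesis by (metis hnorm_borel measurable_sets lessThan_borel)
qed

lemma open_hball: "open (hball 0 r)"
  unfolding hball_zero by (intro open_Collect_less continuous_intros)

lemma component_le_hnorm:
  "\<bar>x $ Some i\<bar> \<le> hnorm x" "\<bar>x $ None\<bar> \<le> (hnorm x)\<^sup>2"
proof -
  have "(x $ None)\<^sup>2 \<le> ((hnorm x)\<^sup>2)\<^sup>2"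
    using hnorm_power4[of x] by simp
  then show "\<bar>x $ None\<bar> \<le> (hnorm x)\<^sup>2"
    by (metis abs_le_square_iff abs_power2)
  have "(x $ Some i)\<^sup>2 \<le> (\<Sum>i\<in>UNIV. (x $ Some i)\<^sup>2)"
    by (rule member_le_sum) auto
  then have "((x $ Some i)\<^sup>2)\<^sup>2 \<le> (\<Sum>i\<in>UNIV. (x $ Some i)\<^sup>2)\<^sup>2"
    by (intro power_mono) auto
  also have "\<dots> \<le> ((hnorm x)\<^sup>2)\<^sup>2"
    using hnorm_power4[of x] by simp
  finally have "(x $ Some i)\<^sup>2 \<le> (hnorm x)\<^sup>2"
    using power2_le_imp_le[of "(x $ Some i)\<^sup>2" "(hnorm x)\<^sup>2"] by (simp del: power2_le_iff_abs_le power_mult)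
  then show "\<bar>x $ Some i\<bar> \<le> hnorm x"
    using hnorm_nonneg[of x] abs_le_square_iff[of "x $ Some i" "hnorm x"] by simp
qed

lemma bounded_hball: "bounded (hball 0 r)"
proof (rule boundedI)
  fix x :: "'n::finite heis" assume "x \<in> hball 0 r"
  then have x: "hnorm x \<le> \<bar>r\<bar>" by (simp add: hball_zero)
  have "\<bar>x $ k\<bar> \<le> \<bar>r\<bar> + r\<^sup>2" for k
  proof (cases k)
    case None
    have "(hnorm x)\<^sup>2 \<le> \<bar>r\<bar>\<^sup>2" using x hnorm_nonneg[of x] by (intro power_mono) auto
    then show ?thesis using component_le_hnorm(2)[of x] None by simp
  next
    case (Some i)
    have "0 \<le> r\<^sup>2" by simp
    with order_trans[OF component_le_hnorm(1)[of x i] x] show ?thesis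
      unfolding Some by linarith
  qed
  then have "(\<Sum>k\<in>UNIV. \<bar>x $ k\<bar>) \<le> (\<Sum>k\<in>(UNIV::('n+'n) option set). \<bar>r\<bar> + r\<^sup>2)"
    by (intro sum_mono)
  with norm_le_l1_cart[of x]
  show "norm x \<le> (\<Sum>k\<in>(UNIV::('n+'n) option set). \<bar>r\<bar> + r\<^sup>2)" by linarith
qed

text \<open>
  The function spaces are defined through compact sets, the estimates through homogeneous balls; this
  and \<open>bounded_hball\<close> translate between the two.
\<close>

lemma compact_subset_hball:
  assumes "compact K"
  obtains r where "0 < r" "K \<subseteq> hball 0 r"
proof -
  have "compact (hnorm ` K)"
    using assms by (intro compact_continuous_image continuous_intros)
  then obtain B where B: "\<And>x. x \<in> K \<Longrightarrow> norm (hnorm x) \<le> B"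
    by (meson bounded_iff compact_imp_bounded image_eqI)
  show ?thesis
  proof
    show "0 < \<bar>B\<bar> + 1" by simp
    show "K \<subseteq> hball 0 (\<bar>B\<bar> + 1)" using B by (fastforce simp: hball_zero)
  qed
qed

definition dil :: "real \<Rightarrow> 'n::finite heis \<Rightarrow> 'n heis" where
  "dil t x = (\<chi> k. case k of None \<Rightarrow> t\<^sup>2 * x $ None | Some i \<Rightarrow> t * x $ Some i)"

lemma hnorm_dil: "0 \<le> t \<Longrightarrow> hnorm (dil t x) = t * hnorm x"
proof -
  assume t: "0 \<le> t"
  have "(\<Sum>i\<in>UNIV. (dil t x $ Some i)\<^sup>2) = t\<^sup>2 * (\<Sum>i\<in>UNIV. (x $ Some i)\<^sup>2)"
    by (simp add: dil_def power_mult_distrib sum_distrib_left)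
  then have "hnorm (dil t x) ^ 4 = (t * hnorm x) ^ 4"
    by (simp add: hnorm_power4 power_mult_distrib) (simp add: dil_def algebra_simps power_mult_distrib)
  then show ?thesis using t by (simp add: hnorm_eq_iff_power4 hnorm_nonneg)
qed

lemma dil_borel [measurable]: "dil t \<in> borel_measurable borel"
proof -
  have "continuous_on UNIV (dil t :: 'n::finite heis \<Rightarrow> _)"
    unfolding dil_def
  proof (rule continuous_on_vec_lambda)
    show "continuous_on UNIV (\<lambda>x::'n heis. case k of None \<Rightarrow> t\<^sup>2 * x $ None | Some i \<Rightarrow> t * x $ Some i)" for k
      by (cases k) (auto intro!: continuous_intros)
  qed
  then show ?thesis by (rule borel_measurable_continuous_onI)
qed

text \<open>
  The dilation is a diagonal linear map: one central coordinate is scaled by \<open>t\<^sup>2\<close> and the \<open>2n\<close> others by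
  \<open>t\<close>, so its determinant is \<open>t\<close> to the homogeneous dimension.
\<close>

lemma nn_integral_dil:
  fixes g :: "'n::finite heis \<Rightarrow> ennreal"
  assumes t: "0 < t" and g[measurable]: "g \<in> borel_measurable borel"
  shows "(\<integral>\<^sup>+x. g x \<partial>lborel) = ennreal (t ^ hom_dim TYPE('n)) * (\<integral>\<^sup>+x. g (dil t x) \<partial>lborel)"
proof -
  define e where "e = (axis None 1 :: 'n heis)"
  define c where "c = (\<lambda>j::'n heis. if j = e then t\<^sup>2 else t)"
  have e: "e \<in> Basis" by (simp add: e_def axis_in_Basis_iff)
  have T: "0 + (\<Sum>j\<in>Basis. (c j * (x \<bullet> j)) *\<^sub>R j) = dil t x" for x :: "'n heis"
  proof (rule euclidean_eqI)
    fix b :: "'n heis" assume b: "b \<in> Basis"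
    then obtain k where k: "b = axis k 1" by (auto simp: Basis_vec_def)
    have "dil t x \<bullet> b = c b * (x \<bullet> b)"
      by (cases k) (simp_all add: k inner_axis dil_def c_def e_def axis_eq_axis)
    then show "(0 + (\<Sum>j\<in>Basis. (c j * (x \<bullet> j)) *\<^sub>R j)) \<bullet> b = dil t x \<bullet> b"
      using b by simp
  qed
  have "(\<Prod>j\<in>Basis. \<bar>c j\<bar>) = \<bar>c e\<bar> * (\<Prod>j\<in>Basis - {e}. \<bar>c j\<bar>)"
    using e by (intro prod.remove) auto
  also have "(\<Prod>j\<in>Basis - {e}. \<bar>c j\<bar>) = (\<Prod>j\<in>Basis - {e}. t)"
    using t by (intro prod.cong) (auto simp: c_def)
  also have "\<dots> = t ^ (2 * CARD('n))"
    using e by (simp add: card_Diff_singleton mult_2)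
  finally have prod: "(\<Prod>j\<in>Basis. \<bar>c j\<bar>) = t ^ hom_dim TYPE('n)"
    by (simp add: c_def hom_dim_def power_add power2_eq_square mult.commute)
  have "lborel = density (distr lborel borel (dil t :: 'n heis \<Rightarrow> _)) (\<lambda>_. (\<Prod>j\<in>Basis. \<bar>c j\<bar>))"
    using lborel_affine_euclidean[of c 0] t T by (simp add: c_def)
  then have "(\<integral>\<^sup>+x. g x \<partial>lborel) =
      (\<integral>\<^sup>+x. g x \<partial>density (distr lborel borel (dil t)) (\<lambda>_. ennreal (t ^ hom_dim TYPE('n))))"
    unfolding prod by simp
  also have "\<dots> = ennreal (t ^ hom_dim TYPE('n)) * (\<integral>\<^sup>+x. g (dil t x) \<partial>lborel)"
    by (simp add: nn_integral_density nn_integral_distr nn_integral_cmult)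
  finally show ?thesis .
qed

lemma emeasure_hball:
  assumes "0 < r"
  shows "emeasure lborel (hball (0 :: 'n::finite heis) r)
    = ennreal (r ^ hom_dim TYPE('n)) * emeasure lborel (hball (0 :: 'n heis) 1)"
proof -
  have "emeasure lborel (hball (0 :: 'n heis) r) = (\<integral>\<^sup>+x. indicator (hball (0 :: 'n heis) r) x \<partial>lborel)"
    by simp
  also have "\<dots> = ennreal (r ^ hom_dim TYPE('n)) *
      (\<integral>\<^sup>+x. indicator (hball (0 :: 'n heis) r) (dil r x) \<partial>lborel)"
    by (rule nn_integral_dil[OF assms]) measurable
  also have "(\<lambda>x. indicator (hball (0 :: 'n heis) r) (dil r x) :: ennreal) = indicator (hball 0 1)"
    using assms by (auto simp: hball_zero hnorm_dil fun_eq_iff indicator_def)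
  finally show ?thesis by simp
qed

lemma emeasure_hball_finite: "emeasure lborel (hball (0 :: 'n::finite heis) r) < \<infinity>"
  using bounded_hball emeasure_bounded_finite by blast

lemma emeasure_hball_pos: "0 < r \<Longrightarrow> 0 < emeasure lborel (hball (0 :: 'n::finite heis) r)"
proof -
  assume r: "0 < r"
  have "\<not> negligible (hball (0 :: 'n heis) r)"
    using r by (intro open_not_negligible open_hball) (auto simp: hball_zero intro!: exI[of _ 0])
  then have "hball (0 :: 'n heis) r \<notin> null_sets lebesgue"
    by (simp add: negligible_iff_null_sets)
  then have "emeasure lborel (hball (0 :: 'n heis) r) \<noteq> 0"
    by (auto simp: null_sets_def)
  then show ?thesis by (simp add: zero_less_iff_neq_zero)
qed

section \<open>Linear changes of variables\<close>

lemma nn_integral_lborel_shift: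
  fixes g :: "'a::euclidean_space \<Rightarrow> ennreal"
  assumes [measurable]: "g \<in> borel_measurable borel"
  shows "(\<integral>\<^sup>+x. g (x + a) \<partial>lborel) = (\<integral>\<^sup>+x. g x \<partial>lborel)"
proof -
  have "(\<integral>\<^sup>+x. g x \<partial>lborel) = (\<integral>\<^sup>+x. g x \<partial>distr lborel borel ((+) a))"
    by (simp add: lborel_distr_plus)
  then show ?thesis by (simp add: nn_integral_distr add.commute)
qed

lemma nn_integral_lborel_reflect:
  fixes g :: "'a::euclidean_space \<Rightarrow> ennreal"
  assumes [measurable]: "g \<in> borel_measurable borel"
  shows "(\<integral>\<^sup>+x. g (a - x) \<partial>lborel) = (\<integral>\<^sup>+x. g x \<partial>lborel)"
proof -
  have "(\<integral>\<^sup>+x. g x \<partial>lborel) = (\<integral>\<^sup>+x. g x \<partial>density (distr lborel borel (\<lambda>x. a + (-1) *\<^sub>R x)) (\<lambda>_. 1))"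
    using lborel_affine[of "-1::real" a] by simp
  then show ?thesis by (simp add: nn_integral_density nn_integral_distr)
qed

text \<open>
  Uniqueness of translation-invariant measures, in the case of the image of Lebesgue measure under a
  linear bijection \<open>T\<close>. Both sides are the double integral of \<open>e(T x) c(y)\<close>: the shift
  \<open>y \<mapsto> y + T x\<close>, an exchange of the integrals and a shift of \<open>x\<close> move the variable \<open>T x\<close> from \<open>e\<close> to \<open>c\<close>.
  The Jacobian factor thus appears as a ratio of measures, to be read off from the preimage of a ball.
\<close>

lemma nn_integral_linear_image_ratio:
  fixes T :: "'a::euclidean_space \<Rightarrow> 'a" and e c :: "'a \<Rightarrow> ennreal"
  assumes T: "linear T" "surj T"
    and e[measurable]: "e \<in> borel_measurable borel" and c[measurable]: "c \<in> borel_measurable borel"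
  shows "(\<integral>\<^sup>+x. e (T x) \<partial>lborel) * (\<integral>\<^sup>+y. c y \<partial>lborel)
    = (\<integral>\<^sup>+x. c (T x) \<partial>lborel) * (\<integral>\<^sup>+y. e y \<partial>lborel)"
proof -
  interpret lin: linear T by fact
  have [measurable]: "T \<in> borel_measurable borel"
    by (intro borel_measurable_continuous_onI linear_continuous_on linear_conv_bounded_linear[THEN iffD1] T)
  have "(\<integral>\<^sup>+x. e (T x) \<partial>lborel) * (\<integral>\<^sup>+y. c y \<partial>lborel)
      = (\<integral>\<^sup>+x. e (T x) * (\<integral>\<^sup>+y. c y \<partial>lborel) \<partial>lborel)"
    by (simp add: nn_integral_multc)
  also have "\<dots> = (\<integral>\<^sup>+x. (\<integral>\<^sup>+y. e (T x) * c (y + T x) \<partial>lborel) \<partial>lborel)"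
    by (intro nn_integral_cong) (simp add: nn_integral_cmult nn_integral_lborel_shift)
  also have "\<dots> = (\<integral>\<^sup>+y. (\<integral>\<^sup>+x. e (T x) * c (y + T x) \<partial>lborel) \<partial>lborel)"
    by (rule lborel_pair.Fubini') measurable
  also have "\<dots> = (\<integral>\<^sup>+y. (\<integral>\<^sup>+x. e (T x - y) * c (T x) \<partial>lborel) \<partial>lborel)"
  proof (rule nn_integral_cong)
    fix y
    obtain z where z: "y = T z" using T(2) by (metis surjD)
    show "(\<integral>\<^sup>+x. e (T x) * c (y + T x) \<partial>lborel) = (\<integral>\<^sup>+x. e (T x - y) * c (T x) \<partial>lborel)"
      using nn_integral_lborel_shift[of "\<lambda>x. e (T x - y) * c (T x)" z]
      by (simp add: z lin.add add.commute)
  qed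
  also have "\<dots> = (\<integral>\<^sup>+x. (\<integral>\<^sup>+y. e (T x - y) * c (T x) \<partial>lborel) \<partial>lborel)"
    by (rule lborel_pair.Fubini'[symmetric]) measurable
  also have "\<dots> = (\<integral>\<^sup>+x. c (T x) * (\<integral>\<^sup>+y. e y \<partial>lborel) \<partial>lborel)"
    by (intro nn_integral_cong)
      (simp add: nn_integral_multc nn_integral_lborel_reflect mult.commute[of "integral\<^sup>N lborel e"])
  also have "\<dots> = (\<integral>\<^sup>+x. c (T x) \<partial>lborel) * (\<integral>\<^sup>+y. e y \<partial>lborel)"
    by (simp add: nn_integral_multc)
  finally show ?thesis .
qed

text \<open>
  A linear map that agrees with the dilation by \<open>a\<close>, up to the factor \<open>C\<close>, in its effect on the
  homogeneous norm.
\<close>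

definition quasi_dilation :: "real \<Rightarrow> real \<Rightarrow> 'n::finite heis_matrix \<Rightarrow> bool" where
  "quasi_dilation C a M \<longleftrightarrow> 0 < a \<and> 1 \<le> C \<and>
     (\<forall>x. hnorm (M *v x) \<le> a * hnorm x \<and> a * hnorm x \<le> C * hnorm (M *v x))"

lemma matrix_vector_borel [measurable]: "(*v) (M :: real^'m^'k) \<in> borel_measurable borel"
  by (intro borel_measurable_continuous_onI matrix_vector_mult_linear_continuous_on)

lemma quasi_dilation_surj:
  assumes "quasi_dilation C a (M :: 'n::finite heis_matrix)"
  shows "surj ((*v) M)"
proof -
  have "x = 0" if "M *v x = 0" for x
  proof -
    have "a * hnorm x \<le> 0"
      using assms that unfolding quasi_dilation_def by (metis hnorm_zero mult_zero_right)
    then have "hnorm x \<le> 0" using assms by (auto simp: quasi_dilation_def mult_le_0_iff)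
    then show ?thesis using hnorm_nonneg[of x] by simp
  qed
  then have "inj ((*v) M)"
    using linear_injective_0[OF matrix_vector_mul_linear[of M]] by auto
  then show ?thesis
    by (rule linear_injective_imp_surjective[OF matrix_vector_mul_linear]) simp_all
qed

text \<open>
  By \<open>nn_integral_linear_image_ratio\<close> the Jacobian factor is the ratio of the volume of the preimage of
  the unit ball to that of the unit ball, and this preimage lies in the ball of radius \<open>C / a\<close>.
\<close>

lemma nn_integral_quasi_dilation:
  fixes M :: "'n::finite heis_matrix" and g :: "'n heis \<Rightarrow> ennreal"
  assumes M: "quasi_dilation C a M" and g[measurable]: "g \<in> borel_measurable borel"
  shows "(\<integral>\<^sup>+x. g (M *v x) \<partial>lborel) \<le> ennreal ((C / a) ^ hom_dim TYPE('n)) * (\<integral>\<^sup>+x. g x \<partial>lborel)"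
proof -
  let ?B = "hball (0 :: 'n heis) 1"
  have a: "0 < a" "1 \<le> C" using M by (auto simp: quasi_dilation_def)
  have "(\<integral>\<^sup>+x. indicator ?B (M *v x) \<partial>lborel) \<le> (\<integral>\<^sup>+x. indicator (hball (0 :: 'n heis) (C / a)) x \<partial>lborel)"
  proof (intro nn_integral_mono)
    fix x :: "'n heis"
    have "hnorm x < C / a" if "hnorm (M *v x) < 1"
    proof -
      have "a * hnorm x \<le> C * hnorm (M *v x)" using M by (auto simp: quasi_dilation_def)
      also have "\<dots> < C * 1" using that a by (intro mult_strict_left_mono) auto
      finally show ?thesis using a by (simp add: field_simps)
    qed
    then show "indicator ?B (M *v x) \<le> (indicator (hball (0 :: 'n heis) (C / a)) x :: ennreal)"
      by (auto simp: hball_zero indicator_def)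
  qed
  also have "\<dots> = ennreal ((C / a) ^ hom_dim TYPE('n)) * emeasure lborel ?B"
    using emeasure_hball[of "C / a", where 'n='n] a by simp
  finally have le: "(\<integral>\<^sup>+x. indicator ?B (M *v x) \<partial>lborel)
      \<le> ennreal ((C / a) ^ hom_dim TYPE('n)) * emeasure lborel ?B" .
  have "(\<integral>\<^sup>+x. g (M *v x) \<partial>lborel) * emeasure lborel ?B
      = (\<integral>\<^sup>+x. indicator ?B (M *v x) \<partial>lborel) * (\<integral>\<^sup>+x. g x \<partial>lborel)"
    using nn_integral_linear_image_ratio[OF matrix_vector_mul_linear quasi_dilation_surj[OF M] g,
        of "indicator ?B"] by simp
  also have "\<dots> \<le> (ennreal ((C / a) ^ hom_dim TYPE('n)) * emeasure lborel ?B) * (\<integral>\<^sup>+x. g x \<partial>lborel)"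
    by (intro mult_right_mono le) auto
  finally have *: "emeasure lborel ?B * (\<integral>\<^sup>+x. g (M *v x) \<partial>lborel)
      \<le> emeasure lborel ?B * (ennreal ((C / a) ^ hom_dim TYPE('n)) * (\<integral>\<^sup>+x. g x \<partial>lborel))"
    by (simp add: ac_simps)
  have B: "emeasure lborel ?B \<noteq> 0" "emeasure lborel ?B \<noteq> \<infinity>"
    using emeasure_hball_pos[of 1, where 'n='n] emeasure_hball_finite[of 1, where 'n='n] by auto
  show ?thesis
    using * B by (subst (asm) ennreal_mult_le_mult_iff) (auto simp: top.not_eq_extremum)
qed

text \<open>
  Preimages of null sets are null, because the Jacobian factor is finite.
\<close>

lemma AE_quasi_dilation:
  fixes M :: "'n::finite heis_matrix"
  assumes M: "quasi_dilation C a M" and P: "AE x in lborel. P x"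
  shows "AE x in lborel. P (M *v x)"
proof -
  obtain N where N: "N \<in> null_sets lborel" "{x. \<not> P x} \<subseteq> N"
    using P by (auto simp: eventually_ae_filter)
  then have [measurable]: "N \<in> sets borel" by (auto simp: null_sets_def)
  have "(\<integral>\<^sup>+x. indicator N (M *v x) \<partial>lborel) \<le> ennreal ((C / a) ^ hom_dim TYPE('n)) * (\<integral>\<^sup>+x. indicator N x \<partial>lborel)"
    by (intro nn_integral_quasi_dilation[OF M]) measurable
  also have "\<dots> = 0" using N by (simp add: null_sets_def)
  finally have "(\<integral>\<^sup>+x. indicator N (M *v x) \<partial>lborel) = 0" by simp
  then have "AE x in lborel. indicator N (M *v x) = (0::ennreal)"
    by (subst (asm) nn_integral_0_iff_AE) auto
  then show ?thesis
    using N(2) by (auto elim!: eventually_mono simp: indicator_def split: if_splits)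
qed

section \<open>Powers of the norm as weights\<close>

lemma nn_integral_hnorm_powr_scale:
  fixes S :: "'n::finite heis set"
  assumes t: "0 < t" and S[measurable]: "S \<in> sets borel"
  shows "(\<integral>\<^sup>+x. ennreal (hnorm x powr \<beta>) * indicator {x. dil (1 / t) x \<in> S} x \<partial>lborel)
    = ennreal (t powr (homdim TYPE('n) + \<beta>)) * (\<integral>\<^sup>+x. ennreal (hnorm x powr \<beta>) * indicator S x \<partial>lborel)"
proof -
  have dd: "dil (1 / t) (dil t x) = x" for x :: "'n heis"
    using t by (simp add: dil_def vec_eq_iff power_divide split: option.split)
  have [measurable]: "{x. dil (1 / t) x \<in> S} \<in> sets borel"
    using measurable_sets[OF dil_borel S] by (simp add: vimage_def)
  have "(\<integral>\<^sup>+x. ennreal (hnorm x powr \<beta>) * indicator {x. dil (1 / t) x \<in> S} x \<partial>lborel)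
    = ennreal (t ^ hom_dim TYPE('n)) *
      (\<integral>\<^sup>+x. ennreal (hnorm (dil t x) powr \<beta>) * indicator {x. dil (1 / t) x \<in> S} (dil t x) \<partial>lborel)"
    by (rule nn_integral_dil[OF t]) measurable
  also have "(\<lambda>x. ennreal (hnorm (dil t x) powr \<beta>) * indicator {x. dil (1 / t) x \<in> S} (dil t x))
    = (\<lambda>x. ennreal (t powr \<beta>) * (ennreal (hnorm x powr \<beta>) * indicator S x))"
    using t by (auto simp: fun_eq_iff hnorm_dil dd powr_mult hnorm_nonneg ennreal_mult mult.assoc indicator_def)
  also have "(\<integral>\<^sup>+x. ennreal (t powr \<beta>) * (ennreal (hnorm x powr \<beta>) * indicator S x) \<partial>lborel)
    = ennreal (t powr \<beta>) * (\<integral>\<^sup>+x. ennreal (hnorm x powr \<beta>) * indicator S x \<partial>lborel)"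
    by (rule nn_integral_cmult) measurable
  also have "ennreal (t ^ hom_dim TYPE('n)) * (ennreal (t powr \<beta>) * (\<integral>\<^sup>+x. ennreal (hnorm x powr \<beta>) * indicator S x \<partial>lborel))
    = ennreal (t powr (homdim TYPE('n) + \<beta>)) * (\<integral>\<^sup>+x. ennreal (hnorm x powr \<beta>) * indicator S x \<partial>lborel)"
    using t by (simp add: powr_add powr_realpow ennreal_mult mult.assoc)
  finally show ?thesis .
qed

lemma nn_integral_hnorm_powr_hball:
  assumes t: "0 < t"
  shows "(\<integral>\<^sup>+x. ennreal (hnorm x powr \<beta>) * indicator (hball (0 :: 'n::finite heis) t) x \<partial>lborel)
    = ennreal (t powr (homdim TYPE('n) + \<beta>)) *
      (\<integral>\<^sup>+x. ennreal (hnorm x powr \<beta>) * indicator (hball (0 :: 'n heis) 1) x \<partial>lborel)"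
proof -
  have "{x. dil (1 / t) x \<in> hball (0 :: 'n heis) 1} = hball 0 t"
    using t by (auto simp: hball_zero hnorm_dil field_simps)
  then show ?thesis
    using nn_integral_hnorm_powr_scale[OF t, of "hball (0 :: 'n heis) 1" \<beta>] by simp
qed

text \<open>
  The unit ball is, up to the origin, the union of the dyadic annuli \<open>2 ^ (-k) / 2 \<le> |x| < 2 ^ (-k)\<close>. By
  scaling, their contributions form a geometric series of ratio \<open>2 powr (- (Q + \<beta>)) < 1\<close>.
\<close>

lemma nn_integral_hnorm_powr_finite_unit:
  assumes \<beta>: "- homdim TYPE('n) < \<beta>"
  shows "(\<integral>\<^sup>+x. ennreal (hnorm x powr \<beta>) * indicator (hball (0 :: 'n::finite heis) 1) x \<partial>lborel) < \<infinity>"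
proof -
  define q where "q = (1/2) powr (homdim TYPE('n) + \<beta>)"
  have q: "0 < q" "q < 1" using \<beta> powr_less_mono2[of "homdim TYPE('n) + \<beta>" "1/2" 1] by (auto simp: q_def)
  define ann where "ann = {x :: 'n heis. 1/2 \<le> hnorm x \<and> hnorm x < 1}"
  have [measurable]: "ann \<in> sets borel" unfolding ann_def
    using measurable_sets[OF hnorm_borel, of "{1/2..<1}"] by (simp add: vimage_def conj_commute)
  define g where "g = (\<lambda>x :: 'n heis. ennreal (hnorm x powr \<beta>))"
  have [measurable]: "g \<in> borel_measurable borel" unfolding g_def by measurable
  define E where "E k = {x :: 'n heis. dil (1 / (1/2) ^ k) x \<in> ann}" for k :: nat
  have [measurable]: "E k \<in> sets borel" for k
    using measurable_sets[OF dil_borel \<open>ann \<in> sets borel\<close>] by (simp add: E_def vimage_def)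
  define c where "c = 1 + (1/2::real) powr \<beta>"
  define J where "J = (\<integral>\<^sup>+x. g x * indicator ann x \<partial>lborel)"
  have "J \<le> (\<integral>\<^sup>+x. ennreal c * indicator (hball (0 :: 'n heis) 1) x \<partial>lborel)"
    unfolding J_def
  proof (intro nn_integral_mono)
    fix x :: "'n heis"
    have "hnorm x powr \<beta> \<le> c" if "x \<in> ann"
    proof (cases "0 \<le> \<beta>")
      case True
      then have "hnorm x powr \<beta> \<le> 1 powr \<beta>" using that by (intro powr_mono2) (auto simp: ann_def)
      then show ?thesis by (simp add: c_def add_increasing2)
    next
      case False
      then have "hnorm x powr \<beta> \<le> (1/2) powr \<beta>" using that by (intro powr_mono2') (auto simp: ann_def)
      then show ?thesis by (simp add: c_def)
    qed
    then show "g x * indicator ann x \<le> ennreal c * indicator (hball (0 :: 'n heis) 1) x"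
      by (auto simp: g_def indicator_def ann_def hball_zero intro!: ennreal_leI)
  qed
  also have "\<dots> < \<infinity>"
    using emeasure_hball_finite[of 1, where 'n='n]
    by (simp add: nn_integral_cmult ennreal_mult_less_top)
  finally have J: "J < \<infinity>" .
  have step: "(\<integral>\<^sup>+x. g x * indicator (E k) x \<partial>lborel) = ennreal (q ^ k) * J" for k
  proof -
    have "((1/2) ^ k) powr (homdim TYPE('n) + \<beta>) = q ^ k"
      by (simp add: q_def powr_realpow[symmetric] powr_powr mult.commute)
    then show ?thesis
      using nn_integral_hnorm_powr_scale[of "(1/2) ^ k" ann \<beta>]
      by (simp add: g_def E_def J_def)
  qed
  have "(\<integral>\<^sup>+x. g x * indicator (hball (0 :: 'n heis) 1) x \<partial>lborel)
      \<le> (\<integral>\<^sup>+x. (\<Sum>k. g x * indicator (E k) x) \<partial>lborel)"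
  proof (intro nn_integral_mono)
    fix x :: "'n heis"
    show "g x * indicator (hball (0 :: 'n heis) 1) x \<le> (\<Sum>k. g x * indicator (E k) x)"
    proof (cases "x \<in> hball 0 1 \<and> x \<noteq> 0")
      case True
      then have h: "0 < hnorm x" "hnorm x < 1" by (auto simp: hball_zero hnorm_pos_iff)
      \<comment> \<open>The least power of \<open>1/2\<close> not exceeding \<open>|x|\<close> locates \<open>x\<close> in the annulus just before it.\<close>
      define m where "m = (LEAST k. (1/2::real) ^ k \<le> hnorm x)"
      have ex: "\<exists>k. (1/2::real) ^ k \<le> hnorm x"
        using real_arch_pow_inv[OF h(1), of "1/2"] by (auto intro: less_imp_le)
      have m: "(1/2) ^ m \<le> hnorm x" unfolding m_def by (rule LeastI_ex[OF ex])
      then have "m \<noteq> 0" using h by (intro notI) simp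
      then obtain k where k: "m = Suc k" by (cases m) auto
      have "\<not> (1/2) ^ k \<le> hnorm x" using k not_less_Least[of k "\<lambda>k. (1/2::real) ^ k \<le> hnorm x"]
        by (simp add: m_def)
      then have "x \<in> E k" using m k
        by (simp add: E_def ann_def hnorm_dil field_simps)
      then have "g x * indicator (hball (0 :: 'n heis) 1) x \<le> (\<Sum>k\<in>{k}. g x * indicator (E k) x)"
        by (simp add: indicator_def)
      also have "\<dots> \<le> (\<Sum>k. g x * indicator (E k) x)"
        by (rule sum_le_suminf) auto
      finally show ?thesis .
    qed (auto simp: g_def)
  qed
  also have "\<dots> = (\<Sum>k. ennreal (q ^ k) * J)"
    by (subst nn_integral_suminf) (auto simp: step)
  also have "\<dots> = ennreal (1 / (1 - q)) * J"
    using q by (simp add: suminf_ennreal_eq[OF _ geometric_sums] suminf_geometric)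
  also have "\<dots> < \<infinity>" using J by (simp add: ennreal_mult_less_top)
  finally show ?thesis by (simp add: g_def)
qed

lemma nn_integral_hnorm_powr_finite:
  assumes \<beta>: "- homdim TYPE('n) < \<beta>"
  shows "(\<integral>\<^sup>+x. ennreal (hnorm x powr \<beta>) * indicator (hball (0 :: 'n::finite heis) r) x \<partial>lborel) < \<infinity>"
proof (cases "0 < r")
  case True
  then show ?thesis
    using nn_integral_hnorm_powr_finite_unit[OF \<beta>]
    unfolding nn_integral_hnorm_powr_hball[OF True] by (simp add: ennreal_mult_less_top)
next
  case False
  then have "hball (0 :: 'n heis) r = {}"
    by (auto simp: hball_zero not_less intro: order_trans[OF _ hnorm_nonneg])
  then show ?thesis by simp
qed

lemma set_integrable_iff_nn_integral_finite:
  fixes f :: "'a::euclidean_space \<Rightarrow> 'b::{banach, second_countable_topology}"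
  assumes "f \<in> borel_measurable lebesgue" "B \<in> sets lebesgue"
  shows "set_integrable lebesgue B f \<longleftrightarrow> (\<integral>\<^sup>+x. ennreal (norm (f x)) * indicator B x \<partial>lborel) < \<infinity>"
proof -
  have "(\<integral>\<^sup>+x. ennreal (norm (indicator B x *\<^sub>R f x)) \<partial>lebesgue)
      = (\<integral>\<^sup>+x. ennreal (norm (f x)) * indicator B x \<partial>lebesgue)"
    by (intro nn_integral_cong) (simp add: indicator_def)
  then show ?thesis
    using assms by (simp add: set_integrable_def integrable_iff_bounded nn_integral_completion)
qed

lemma ennreal_set_lebesgue_integral:
  fixes f :: "'a::euclidean_space \<Rightarrow> real"
  assumes "set_integrable lebesgue B f" "\<And>x. 0 \<le> f x"
  shows "ennreal (LINT x:B|lebesgue. f x) = (\<integral>\<^sup>+x. ennreal (f x) * indicator B x \<partial>lborel)"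
proof -
  have "(\<integral>\<^sup>+x. ennreal (f x) * indicator B x \<partial>lebesgue) = (\<integral>\<^sup>+x. ennreal (indicator B x *\<^sub>R f x) \<partial>lebesgue)"
    by (intro nn_integral_cong) (simp add: indicator_def)
  also have "\<dots> = ennreal (LINT x|lebesgue. indicator B x *\<^sub>R f x)"
    using assms by (intro nn_integral_eq_integral) (auto simp: set_integrable_def)
  finally show ?thesis by (simp add: set_lebesgue_integral_def nn_integral_completion)
qed

lemma lebesgue_borel_hnorm_powr [measurable]: "(\<lambda>x. hnorm x powr \<beta>) \<in> borel_measurable lebesgue"
  by (intro measurable_completion) measurable

lemma hball_lebesgue [measurable]: "hball 0 r \<in> sets lebesgue"
  by (intro sets_completionI_sets) measurable

lemma set_integrable_hnorm_powr:
  assumes "- homdim TYPE('n) < \<beta>"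
  shows "set_integrable lebesgue (hball (0 :: 'n::finite heis) r) (\<lambda>x. hnorm x powr \<beta>)"
  using nn_integral_hnorm_powr_finite[OF assms]
  by (subst set_integrable_iff_nn_integral_finite) auto

lemma ennreal_wmeasure_hball:
  assumes "- homdim TYPE('n) < \<beta>"
  shows "ennreal (wmeasure (\<lambda>x. hnorm x powr \<beta>) (hball (0 :: 'n::finite heis) r))
    = (\<integral>\<^sup>+x. ennreal (hnorm x powr \<beta>) * indicator (hball (0 :: 'n heis) r) x \<partial>lborel)"
  unfolding wmeasure_def by (intro ennreal_set_lebesgue_integral set_integrable_hnorm_powr assms) simp

lemma wmeasure_nonneg: "(\<And>x. 0 \<le> w x) \<Longrightarrow> 0 \<le> wmeasure w E"
  unfolding wmeasure_def set_lebesgue_integral_def by (intro integral_nonneg_AE) simp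

lemma wmeasure_hball_scale:
  assumes "- homdim TYPE('n) < \<beta>" "0 < r"
  shows "wmeasure (\<lambda>x. hnorm x powr \<beta>) (hball (0 :: 'n::finite heis) r)
    = r powr (homdim TYPE('n) + \<beta>) * wmeasure (\<lambda>x. hnorm x powr \<beta>) (hball (0 :: 'n heis) 1)"
proof -
  have "ennreal (wmeasure (\<lambda>x. hnorm x powr \<beta>) (hball (0 :: 'n heis) r))
      = ennreal (r powr (homdim TYPE('n) + \<beta>)) * ennreal (wmeasure (\<lambda>x. hnorm x powr \<beta>) (hball (0 :: 'n heis) 1))"
    using assms by (simp add: ennreal_wmeasure_hball nn_integral_hnorm_powr_hball[of r])
  also have "\<dots> = ennreal (r powr (homdim TYPE('n) + \<beta>) * wmeasure (\<lambda>x. hnorm x powr \<beta>) (hball (0 :: 'n heis) 1))"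
    by (intro ennreal_mult[symmetric] wmeasure_nonneg) auto
  finally show ?thesis
    by (subst (asm) ennreal_inj) (auto intro!: wmeasure_nonneg mult_nonneg_nonneg)
qed

lemma AE_lborel_nonzero: "AE x in lborel. (x :: 'a::euclidean_space) \<noteq> 0"
  by (rule AE_lborel_singleton)

lemma wmeasure_hball_pos:
  assumes "- homdim TYPE('n) < \<beta>" "0 < r"
  shows "0 < wmeasure (\<lambda>x. hnorm x powr \<beta>) (hball (0 :: 'n::finite heis) r)"
proof -
  have "wmeasure (\<lambda>x. hnorm x powr \<beta>) (hball (0 :: 'n::finite heis) r) \<noteq> 0"
  proof
    assume "wmeasure (\<lambda>x. hnorm x powr \<beta>) (hball (0 :: 'n::finite heis) r) = 0"
    then have "(\<integral>\<^sup>+x. ennreal (hnorm x powr \<beta>) * indicator (hball (0 :: 'n heis) r) x \<partial>lborel) = 0"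
      using ennreal_wmeasure_hball[OF assms(1), of r] by simp
    then have "AE x in lborel. ennreal (hnorm x powr \<beta>) * indicator (hball (0 :: 'n heis) r) x = 0"
      by (subst (asm) nn_integral_0_iff_AE) auto
    then have "AE x in lborel. indicator (hball (0 :: 'n heis) r) x = (0::ennreal)"
      using AE_lborel_nonzero by eventually_elim auto
    then have "(\<integral>\<^sup>+x. indicator (hball (0 :: 'n heis) r) x \<partial>lborel) = 0"
      by (subst nn_integral_0_iff_AE) auto
    then show False using emeasure_hball_pos[OF assms(2), where 'n='n] by simp
  qed
  then show ?thesis using wmeasure_nonneg[of "\<lambda>x :: 'n heis. hnorm x powr \<beta>" "hball 0 r"] by simp
qed

section \<open>Integral inequalities up to constants\<close>

text \<open>
  Where \<open>g\<close> exceeds \<open>X v\<close>, replacing the factor \<open>g powr (1 - p)\<close> by \<open>(X v) powr (1 - p)\<close> only increases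
  \<open>g = g powr p * g powr (1 - p)\<close>; elsewhere the first summand suffices.
\<close>

lemma powr_mean_pointwise:
  fixes g v X p :: real
  assumes "0 \<le> g" "0 \<le> v" "v = 0 \<Longrightarrow> g = 0" "0 < X" "1 \<le> p"
  shows "g \<le> X * v + X powr (1 - p) * (g powr p * v powr (1 - p))"
proof (cases "g \<le> X * v")
  case True
  then show ?thesis by (simp add: add_increasing2)
next
  case False
  then have g: "X * v < g" by simp
  then have v: "0 < v" using assms by (cases "v = 0") auto
  then have t: "0 < X * v" using assms by simp
  have "g = g powr p * g powr (1 - p)"
    using g t by (simp add: powr_add[symmetric])
  also have "\<dots> \<le> g powr p * (X * v) powr (1 - p)"
    using g t assms by (intro mult_left_mono powr_mono2') auto
  also have "\<dots> = X powr (1 - p) * (g powr p * v powr (1 - p))"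
    using assms v by (simp add: powr_mult)
  finally show ?thesis using t by simp
qed

text \<open>
  Hoelder's inequality with a lost factor \<open>2\<close>, in the form in which \<open>v\<close> is a reference density of mass
  \<open>V\<close> and \<open>X\<close> bounds the \<open>p\<close>-th mean of \<open>g / v\<close>.
\<close>

lemma nn_integral_mean_bound:
  fixes g v :: "'a \<Rightarrow> real"
  assumes [measurable]: "g \<in> borel_measurable M" "v \<in> borel_measurable M"
    and nn: "\<And>x. x \<in> space M \<Longrightarrow> 0 \<le> g x" "\<And>x. x \<in> space M \<Longrightarrow> 0 \<le> v x"
      "\<And>x. x \<in> space M \<Longrightarrow> v x = 0 \<Longrightarrow> g x = 0"
    and X: "0 < X" "1 \<le> p" "0 \<le> V"
    and v: "(\<integral>\<^sup>+x. ennreal (v x) \<partial>M) \<le> ennreal V"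
    and g: "(\<integral>\<^sup>+x. ennreal (g x powr p * v x powr (1 - p)) \<partial>M) \<le> ennreal (X powr p * V)"
  shows "(\<integral>\<^sup>+x. ennreal (g x) \<partial>M) \<le> ennreal (2 * X * V)"
proof -
  have "(\<integral>\<^sup>+x. ennreal (g x) \<partial>M)
      \<le> (\<integral>\<^sup>+x. ennreal X * ennreal (v x) + ennreal (X powr (1 - p)) * ennreal (g x powr p * v x powr (1 - p)) \<partial>M)"
  proof (intro nn_integral_mono)
    fix x assume x: "x \<in> space M"
    have "ennreal (g x) \<le> ennreal (X * v x + X powr (1 - p) * (g x powr p * v x powr (1 - p)))"
      using nn x X by (intro ennreal_leI powr_mean_pointwise) auto
    then show "ennreal (g x) \<le> ennreal X * ennreal (v x) + ennreal (X powr (1 - p)) * ennreal (g x powr p * v x powr (1 - p))"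
      using nn x X by (simp add: ennreal_mult)
  qed
  also have "\<dots> = ennreal X * (\<integral>\<^sup>+x. ennreal (v x) \<partial>M)
      + ennreal (X powr (1 - p)) * (\<integral>\<^sup>+x. ennreal (g x powr p * v x powr (1 - p)) \<partial>M)"
    by (simp add: nn_integral_add nn_integral_cmult)
  also have "\<dots> \<le> ennreal X * ennreal V + ennreal (X powr (1 - p)) * ennreal (X powr p * V)"
    by (intro add_mono mult_left_mono v g) auto
  also have "\<dots> = ennreal (X * V + X powr (1 - p) * (X powr p * V))"
    using X by (simp add: ennreal_mult)
  also have "X powr (1 - p) * (X powr p * V) = X * V"
    using X by (simp add: mult.assoc[symmetric] powr_add[symmetric])
  finally show ?thesis by (simp add: ac_simps)
qed

text \<open>
  Jensen's inequality for the finite measure with density \<open>v\<close>, applied to \<open>k / v\<close>, with a lost factor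
  \<open>2 powr p\<close>. The preceding bound is used with \<open>X\<close> equal to the \<open>p\<close>-th mean \<open>(I / V) powr (1 / p)\<close>;
  that value may be \<open>0\<close>, so it is increased by an arbitrary \<open>e > 0\<close>.
\<close>

lemma norm_integral_powr_le:
  fixes k :: "'a \<Rightarrow> 'b::{banach, second_countable_topology}" and v :: "'a \<Rightarrow> real"
  assumes [measurable]: "k \<in> borel_measurable M" "v \<in> borel_measurable M"
    and nn: "\<And>x. x \<in> space M \<Longrightarrow> 0 \<le> v x" "\<And>x. x \<in> space M \<Longrightarrow> v x = 0 \<Longrightarrow> k x = 0"
    and p: "1 \<le> p" and V: "0 < V" "(\<integral>\<^sup>+x. ennreal (v x) \<partial>M) \<le> ennreal V"
    and I: "(\<integral>\<^sup>+x. ennreal (norm (k x) powr p * v x powr (1 - p)) \<partial>M) = ennreal I" "0 \<le> I"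
  shows "integrable M k" "norm (LINT x|M. k x) powr p \<le> 2 powr p * V powr (p - 1) * I"
proof -
  have bound: "(\<integral>\<^sup>+x. ennreal (norm (k x)) \<partial>M) \<le> ennreal (2 * X * V)"
    if "0 < X" "I \<le> X powr p * V" for X
    using nn p V that I
    by (intro nn_integral_mean_bound[where v=v and p=p]) (auto intro!: ennreal_leI)
  define t where "t = (I / V) powr (1 / p)"
  have t: "0 \<le> t" "t powr p = I / V"
    using I p V by (auto simp: t_def powr_powr)
  have int: "(\<integral>\<^sup>+x. ennreal (norm (k x)) \<partial>M) \<le> ennreal (2 * (t + e) * V)" if "0 < e" for e
  proof (rule bound)
    have "I / V \<le> (t + e) powr p"
      unfolding t(2)[symmetric] using t that p by (intro powr_mono2) auto
    then show "I \<le> (t + e) powr p * V" using V by (simp add: field_simps)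
  qed (use t that in auto)
  show k: "integrable M k"
    using int[of 1] by (auto simp: integrable_iff_bounded intro: le_less_trans)
  have "norm (LINT x|M. k x) \<le> 2 * V * t + e" if e: "0 < e" for e
  proof -
    have "ennreal (norm (LINT x|M. k x)) \<le> (\<integral>\<^sup>+x. ennreal (norm (k x)) \<partial>M)"
      by (rule integral_norm_bound_ennreal[OF k])
    also have "\<dots> \<le> ennreal (2 * (t + e / (2 * V)) * V)"
      using e V by (intro int) auto
    finally have "norm (LINT x|M. k x) \<le> 2 * (t + e / (2 * V)) * V"
      using e V t by (subst (asm) ennreal_le_iff) auto
    moreover have "2 * (t + e / (2 * V)) * V = 2 * V * t + e"
      using V by (simp add: field_simps)
    ultimately show ?thesis by simp
  qed
  then have "norm (LINT x|M. k x) \<le> 2 * V * t"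
    by (rule field_le_epsilon)
  then have "norm (LINT x|M. k x) powr p \<le> (2 * V * t) powr p"
    using p by (intro powr_mono2) auto
  also have "\<dots> = 2 powr p * V powr (p - 1) * I"
    using V t by (simp add: powr_mult powr_diff)
  finally show "norm (LINT x|M. k x) powr p \<le> 2 powr p * V powr (p - 1) * I" .
qed

text \<open>
  A form of Young's inequality: the smaller of \<open>u powr p1\<close> and \<open>v powr p2\<close> is replaced by the larger.
\<close>

lemma powr_product_le:
  fixes u v p p1 p2 :: real
  assumes "0 \<le> u" "0 \<le> v" "1 \<le> p" "1 \<le> p1" "1 \<le> p2" "1 / p = 1 / p1 + 1 / p2"
  shows "(u * v) powr p \<le> u powr p1 + v powr p2"
proof -
  have *: "(u * v) powr p \<le> u powr a"
    if "0 \<le> u" "0 \<le> v" "1 \<le> a" "1 \<le> b" "1 / p = 1 / a + 1 / b" "v powr b \<le> u powr a" for u v a b :: real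
  proof -
    have "v = (v powr b) powr (1 / b)" using that by (simp add: powr_powr)
    also have "\<dots> \<le> (u powr a) powr (1 / b)" using that by (intro powr_mono2) auto
    finally have "v \<le> u powr (a / b)" by (simp add: powr_powr)
    then have "(u * v) powr p \<le> (u powr (a * (1 / a)) * u powr (a / b)) powr p"
      using that assms by (intro powr_mono2 mult_mono) auto
    also have "\<dots> = u powr (a * (1 / a + 1 / b) * p)"
      by (simp add: powr_add[symmetric] powr_powr distrib_left)
    also have "a * (1 / a + 1 / b) * p = a"
      unfolding that(5)[symmetric] using assms(3) by simp
    finally show ?thesis .
  qed
  show ?thesis
  proof (cases "v powr p2 \<le> u powr p1")
    case True
    then show ?thesis using *[of u v p1 p2] assms by (simp add: add_increasing2)
  next
    case False
    then show ?thesis using *[of v u p2 p1] assms by (simp add: add_increasing mult.commute add.commute)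
  qed
qed

text \<open>
  The product inequality is applied pointwise to the normalised functions \<open>f / X\<close> and \<open>g / Y\<close>.
\<close>

lemma nn_integral_Hoelder:
  fixes f g w :: "'a \<Rightarrow> real"
  assumes [measurable]: "f \<in> borel_measurable M" "g \<in> borel_measurable M" "w \<in> borel_measurable M"
    and nn: "\<And>x. 0 \<le> f x" "\<And>x. 0 \<le> g x" "\<And>x. 0 \<le> w x"
    and p: "1 \<le> p" "1 \<le> p1" "1 \<le> p2" "1 / p = 1 / p1 + 1 / p2"
    and XY: "0 < X" "0 < Y" "0 \<le> W"
    and f: "(\<integral>\<^sup>+x. ennreal (f x powr p1 * w x) \<partial>M) \<le> ennreal (X powr p1 * W)"
    and g: "(\<integral>\<^sup>+x. ennreal (g x powr p2 * w x) \<partial>M) \<le> ennreal (Y powr p2 * W)"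
  shows "(\<integral>\<^sup>+x. ennreal ((f x * g x) powr p * w x) \<partial>M) \<le> ennreal (2 * (X * Y) powr p * W)"
proof -
  define c where "c = (X * Y) powr p"
  have c: "0 < c" using XY by (simp add: c_def)
  define d e where "d = c / X powr p1" and "e = c / Y powr p2"
  have de: "0 \<le> d" "0 \<le> e" using c by (auto simp: d_def e_def)
  have "(\<integral>\<^sup>+x. ennreal ((f x * g x) powr p * w x) \<partial>M)
      \<le> (\<integral>\<^sup>+x. ennreal (d) * ennreal (f x powr p1 * w x) + ennreal (e) * ennreal (g x powr p2 * w x) \<partial>M)"
  proof (intro nn_integral_mono)
    fix x
    have "(f x / X * (g x / Y)) powr p \<le> (f x / X) powr p1 + (g x / Y) powr p2"
      using nn XY p by (intro powr_product_le) auto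
    also have "(f x / X * (g x / Y)) powr p = (f x * g x) powr p / c"
      using nn XY by (simp add: c_def powr_mult powr_divide)
    finally have "(f x * g x) powr p \<le> d * f x powr p1 + e * g x powr p2"
      using nn XY c by (simp add: d_def e_def powr_divide field_simps)
    then have "(f x * g x) powr p * w x \<le> (d * f x powr p1 + e * g x powr p2) * w x"
      using nn by (intro mult_right_mono)
    then have "ennreal ((f x * g x) powr p * w x) \<le> ennreal (d * (f x powr p1 * w x) + e * (g x powr p2 * w x))"
      by (intro ennreal_leI) (simp add: algebra_simps)
    also have "\<dots> = ennreal (d) * ennreal (f x powr p1 * w x) + ennreal (e) * ennreal (g x powr p2 * w x)"
      using nn de by (simp add: ennreal_mult)
    finally show "ennreal ((f x * g x) powr p * w x) \<le> \<dots>" .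
  qed
  also have "\<dots> = ennreal (d) * (\<integral>\<^sup>+x. ennreal (f x powr p1 * w x) \<partial>M)
      + ennreal (e) * (\<integral>\<^sup>+x. ennreal (g x powr p2 * w x) \<partial>M)"
    by (simp add: nn_integral_add nn_integral_cmult)
  also have "\<dots> \<le> ennreal (d) * ennreal (X powr p1 * W) + ennreal (e) * ennreal (Y powr p2 * W)"
    by (intro add_mono mult_left_mono f g) auto
  also have "\<dots> = ennreal (d * (X powr p1 * W) + e * (Y powr p2 * W))"
    using XY de by (simp add: ennreal_mult)
  also have "d * (X powr p1 * W) + e * (Y powr p2 * W) = 2 * c * W"
    using XY by (simp add: d_def e_def)
  finally show ?thesis by (simp add: c_def)
qed

lemma powr_sum3_le:
  fixes u v w p :: real
  assumes "0 \<le> u" "0 \<le> v" "0 \<le> w" "0 \<le> p"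
  shows "(u + v + w) powr p \<le> 3 powr p * (u powr p + v powr p + w powr p)"
proof -
  define m where "m = max u (max v w)"
  have m: "0 \<le> m" "u + v + w \<le> 3 * m" using assms by (auto simp: m_def)
  have "(u + v + w) powr p \<le> (3 * m) powr p" using assms m by (intro powr_mono2) auto
  also have "\<dots> = 3 powr p * m powr p" using m by (simp add: powr_mult)
  also have "m powr p \<le> u powr p + v powr p + w powr p"
    unfolding m_def max_def by auto
  finally show ?thesis by simp
qed

section \<open>Ball-wise bounds for Morrey and mean oscillation spaces\<close>

text \<open>
  The real quantities in the definitions of the Morrey and oscillation norms all have the form of the
  left-hand side; the right-hand side is what is estimated.
\<close>

lemma average_powr_le_iff:
  fixes c I N p :: real
  assumes "0 < c" "0 \<le> I" "0 \<le> N" "1 \<le> p"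
  shows "(1 / c * I) powr (1 / p) \<le> N \<longleftrightarrow> I \<le> N powr p * c"
proof -
  define a where "a = 1 / c * I"
  have a: "0 \<le> a" using assms by (simp add: a_def)
  have N: "(N powr p) powr (1 / p) = N" "(a powr (1 / p)) powr p = a"
    using assms a by (auto simp: powr_powr)
  have "a powr (1 / p) \<le> N \<Longrightarrow> a \<le> N powr p"
    using powr_mono2[of p "a powr (1 / p)" N] N assms by simp
  moreover have "a \<le> N powr p \<Longrightarrow> a powr (1 / p) \<le> N"
    using powr_mono2[of "1 / p" a "N powr p"] N assms a by simp
  ultimately have "(1 / c * I) powr (1 / p) \<le> N \<longleftrightarrow> 1 / c * I \<le> N powr p"
    unfolding a_def by blast
  then show ?thesis using assms by (simp add: field_simps)
qed

lemma Lp_loc_set_integrable_hball: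
  fixes f :: "'n::finite heis \<Rightarrow> 'k::{banach, second_countable_topology}"
  assumes "f \<in> Lp_loc p w"
  shows "set_integrable lebesgue (hball 0 r) (\<lambda>x. norm (f x) powr p * w x)"
proof -
  have "compact (closure (hball (0 :: 'n heis) r))" using bounded_hball compact_closure by blast
  moreover have "\<forall>K. compact K \<longrightarrow> set_integrable lebesgue K (\<lambda>x. norm (f x) powr p * w x)"
    using assms unfolding Lp_loc_def mem_Collect_eq by (rule conjunct2)
  ultimately have "set_integrable lebesgue (closure (hball 0 r)) (\<lambda>x. norm (f x) powr p * w x)"
    by blast
  then show ?thesis
    by (rule set_integrable_subset) (simp_all add: closure_subset)
qed

lemma Lp_locI:
  fixes f :: "'n::finite heis \<Rightarrow> 'k::{banach, second_countable_topology}"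
  assumes f: "f \<in> borel_measurable lebesgue" and w: "w \<in> borel_measurable lebesgue" "\<And>x. 0 \<le> w x"
    and fin: "\<And>r. 0 < r \<Longrightarrow> (\<integral>\<^sup>+x. ennreal (norm (f x) powr p * w x) * indicator (hball 0 r) x \<partial>lborel) < \<infinity>"
  shows "f \<in> Lp_loc p w"
  unfolding Lp_loc_def
proof (intro CollectI conjI allI impI f)
  fix K :: "'n heis set" assume K: "compact K"
  then obtain r where r: "0 < r" "K \<subseteq> hball 0 r" by (rule compact_subset_hball)
  have "set_integrable lebesgue (hball 0 r) (\<lambda>x. norm (f x) powr p * w x)"
    using f w fin[OF r(1)] by (subst set_integrable_iff_nn_integral_finite) auto
  then show "set_integrable lebesgue K (\<lambda>x. norm (f x) powr p * w x)"
    using r sets_completionI_sets[of K lborel] borel_compact[OF K] by (elim set_integrable_subset) auto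
qed

lemma morrey_norm_nonneg:
  assumes "f \<in> morrey_space p lam w"
  shows "0 \<le> morrey_norm p lam w f"
proof -
  have "morrey_term p lam w f 1 \<le> morrey_norm p lam w f"
    using assms unfolding morrey_norm_def morrey_space_def by (intro cSUP_upper) auto
  moreover have "0 \<le> morrey_term p lam w f 1" by (simp add: morrey_term_def)
  ultimately show ?thesis by linarith
qed

lemma morrey_space_ball_bound:
  assumes f: "f \<in> morrey_space p lam w" and p: "1 \<le> p" and w: "\<And>x. 0 \<le> w x"
    and r: "0 < r" "0 < wmeasure w (hball 0 r)"
  shows "(\<integral>\<^sup>+x. ennreal (norm (f x) powr p * w x) * indicator (hball 0 r) x \<partial>lborel)
    \<le> ennreal (morrey_norm p lam w f powr p * wmeasure w (hball 0 r) powr (1 + p * lam))"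
proof -
  define I where "I = (LINT x:hball 0 r|lebesgue. norm (f x) powr p * w x)"
  have I: "0 \<le> I" unfolding I_def set_lebesgue_integral_def using w by (intro integral_nonneg_AE) simp
  have "morrey_term p lam w f r \<le> morrey_norm p lam w f"
    using f r unfolding morrey_norm_def morrey_space_def by (intro cSUP_upper) auto
  then have "I \<le> morrey_norm p lam w f powr p * wmeasure w (hball 0 r) powr (1 + p * lam)"
    using I p r morrey_norm_nonneg[OF f] unfolding morrey_term_def I_def[symmetric]
    by (subst average_powr_le_iff[symmetric]) auto
  then show ?thesis
    using f w unfolding I_def
    by (subst ennreal_set_lebesgue_integral[symmetric])
      (auto simp: morrey_space_def intro!: Lp_loc_set_integrable_hball ennreal_leI)
qed

lemma morrey_spaceI:
  fixes f :: "'n::finite heis \<Rightarrow> 'k::{banach, second_countable_topology}"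
  assumes f: "f \<in> borel_measurable lebesgue" and w: "w \<in> borel_measurable lebesgue" "\<And>x. 0 \<le> w x"
    and p: "1 \<le> p" and N: "0 \<le> N" and pos: "\<And>r. 0 < r \<Longrightarrow> 0 < wmeasure w (hball 0 r)"
    and bound: "\<And>r. 0 < r \<Longrightarrow> (\<integral>\<^sup>+x. ennreal (norm (f x) powr p * w x) * indicator (hball 0 r) x \<partial>lborel)
      \<le> ennreal (N powr p * wmeasure w (hball 0 r) powr (1 + p * lam))"
  shows "f \<in> morrey_space p lam w" "morrey_norm p lam w f \<le> N"
proof -
  have L: "f \<in> Lp_loc p w"
    using f w le_less_trans[OF bound ennreal_less_top] by (intro Lp_locI) auto
  have le: "morrey_term p lam w f r \<le> N" if r: "0 < r" for r
  proof -
    define I where "I = (LINT x:hball 0 r|lebesgue. norm (f x) powr p * w x)"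
    have I: "0 \<le> I" unfolding I_def set_lebesgue_integral_def using w by (intro integral_nonneg_AE) simp
    have "ennreal I \<le> ennreal (N powr p * wmeasure w (hball 0 r) powr (1 + p * lam))"
      using bound[OF r] unfolding I_def
      by (subst ennreal_set_lebesgue_integral) (auto intro!: Lp_loc_set_integrable_hball L mult_nonneg_nonneg w)
    then have "I \<le> N powr p * wmeasure w (hball 0 r) powr (1 + p * lam)"
      by (subst (asm) ennreal_le_iff) auto
    then show ?thesis
      using I p N pos[OF r] unfolding morrey_term_def I_def[symmetric]
      by (subst average_powr_le_iff) auto
  qed
  then show "f \<in> morrey_space p lam w"
    using L by (auto simp: morrey_space_def intro!: bdd_aboveI2)
  show "morrey_norm p lam w f \<le> N"
    unfolding morrey_norm_def using le by (intro cSUP_least) auto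
qed

lemma powr_norm_diff_le:
  fixes a b :: "'a::real_normed_vector"
  assumes "0 \<le> p"
  shows "norm (a - b) powr p \<le> 3 powr p * (norm a powr p + norm b powr p)"
proof -
  have "norm (a - b) powr p \<le> (norm a + norm b + 0) powr p"
    using assms norm_triangle_ineq4[of a b] by (intro powr_mono2) auto
  also have "\<dots> \<le> 3 powr p * (norm a powr p + norm b powr p + 0 powr p)"
    using assms by (intro powr_sum3_le) auto
  finally show ?thesis by simp
qed

text \<open>
  Needed because the Bochner integral of a function that is not integrable is \<open>0\<close>: a bound on the
  oscillation is only meaningful once \<open>f - c\<close> is known to be locally integrable to the power \<open>p\<close>.
\<close>

lemma Lp_loc_diff_const:
  fixes f :: "'n::finite heis \<Rightarrow> 'k::{banach, second_countable_topology}"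
  assumes f: "f \<in> Lp_loc p w" and w: "w \<in> borel_measurable lebesgue" "\<And>x. 0 \<le> w x"
    and wi: "\<And>r. set_integrable lebesgue (hball 0 r) w" and p: "0 \<le> p"
  shows "(\<lambda>x. f x - c) \<in> Lp_loc p w"
proof (rule Lp_locI)
  have fm: "f \<in> borel_measurable lebesgue" using f by (simp add: Lp_loc_def)
  then show "(\<lambda>x. f x - c) \<in> borel_measurable lebesgue" by measurable
  show "w \<in> borel_measurable lebesgue" "\<And>x. 0 \<le> w x" by fact+
  fix r :: real
  let ?g = "\<lambda>x. 3 powr p * (norm (f x) powr p * w x) + 3 powr p * norm c powr p * w x"
  have i: "set_integrable lebesgue (hball 0 r) ?g"
    using Lp_loc_set_integrable_hball[OF f, of r] wi[of r]
    by (intro set_integral_add set_integrable_mult_right) auto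
  have gm: "?g \<in> borel_measurable lebesgue" using fm w(1) by measurable
  have "(\<integral>\<^sup>+x. ennreal (norm (f x - c) powr p * w x) * indicator (hball 0 r) x \<partial>lborel)
      \<le> (\<integral>\<^sup>+x. ennreal (norm (?g x)) * indicator (hball 0 r) x \<partial>lborel)"
  proof (intro nn_integral_mono mult_right_mono ennreal_leI)
    fix x
    have "norm (f x - c) powr p * w x \<le> 3 powr p * (norm (f x) powr p + norm c powr p) * w x"
      using powr_norm_diff_le[OF p, of "f x" c] w(2) by (intro mult_right_mono)
    also have "\<dots> = ?g x" by (simp add: algebra_simps)
    also have "\<dots> \<le> norm (?g x)" by simp
    finally show "norm (f x - c) powr p * w x \<le> norm (?g x)" .
  qed auto
  also have "\<dots> < \<infinity>"
    using i unfolding set_integrable_iff_nn_integral_finite[OF gm hball_lebesgue] .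
  finally show "(\<integral>\<^sup>+x. ennreal (norm (f x - c) powr p * w x) * indicator (hball 0 r) x \<partial>lborel) < \<infinity>" .
qed

lemma cmo_space_ball_bound:
  fixes f :: "'n::finite heis \<Rightarrow> 'k::{banach, second_countable_topology}"
  assumes f: "f \<in> cmo_space p w" and w: "w \<in> borel_measurable lebesgue" "\<And>x. 0 \<le> w x"
    and wi: "\<And>r. set_integrable lebesgue (hball 0 r) w" and p: "1 \<le> p"
    and pos: "\<And>r. 0 < r \<Longrightarrow> 0 < wmeasure w (hball 0 r)"
  obtains K where "0 < K"
    "\<And>r. 0 < r \<Longrightarrow> (\<integral>\<^sup>+x. ennreal (norm (f x - ball_mean f r) powr p * w x) * indicator (hball 0 r) x \<partial>lborel)
      \<le> ennreal (K powr p * wmeasure w (hball 0 r))"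
proof -
  obtain K0 where K0: "\<And>r. 0 < r \<Longrightarrow> cmo_term p w f r \<le> K0"
    using f by (fastforce simp: cmo_space_def bdd_above_def)
  define K where "K = max K0 1"
  show ?thesis
  proof (rule that)
    show "0 < K" by (simp add: K_def)
    fix r :: real assume r: "0 < r"
    let ?g = "\<lambda>x. norm (f x - ball_mean f r) powr p * w x"
    define I where "I = (LINT x:hball 0 r|lebesgue. ?g x)"
    have I: "0 \<le> I" unfolding I_def set_lebesgue_integral_def using w by (intro integral_nonneg_AE) simp
    have "(\<lambda>x. f x - ball_mean f r) \<in> Lp_loc p w"
      using f w wi p by (intro Lp_loc_diff_const) (auto simp: cmo_space_def)
    then have i: "set_integrable lebesgue (hball 0 r) ?g"
      by (rule Lp_loc_set_integrable_hball)
    have "cmo_term p w f r \<le> K" using K0[OF r] by (simp add: K_def)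
    then have "I \<le> K powr p * wmeasure w (hball 0 r)"
      using I p r pos[OF r] \<open>0 < K\<close> unfolding cmo_term_def I_def[symmetric]
      by (subst average_powr_le_iff[symmetric]) auto
    then show "(\<integral>\<^sup>+x. ennreal (?g x) * indicator (hball 0 r) x \<partial>lborel) \<le> ennreal (K powr p * wmeasure w (hball 0 r))"
      using w unfolding I_def
      by (subst ennreal_set_lebesgue_integral[symmetric, OF i]) (auto intro!: ennreal_leI)
  qed
qed

lemma cmo_spaceI:
  fixes f :: "'n::finite heis \<Rightarrow> 'k::{banach, second_countable_topology}"
  assumes L: "f \<in> Lp_loc p w" "locally_integrable f" and w: "w \<in> borel_measurable lebesgue" "\<And>x. 0 \<le> w x"
    and wi: "\<And>r. set_integrable lebesgue (hball 0 r) w" and p: "1 \<le> p" and K: "0 \<le> K"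
    and pos: "\<And>r. 0 < r \<Longrightarrow> 0 < wmeasure w (hball 0 r)"
    and bound: "\<And>r. 0 < r \<Longrightarrow> (\<integral>\<^sup>+x. ennreal (norm (f x - ball_mean f r) powr p * w x) * indicator (hball 0 r) x \<partial>lborel)
      \<le> ennreal (K powr p * wmeasure w (hball 0 r))"
  shows "f \<in> cmo_space p w"
proof -
  have "cmo_term p w f r \<le> K" if r: "0 < r" for r
  proof -
    let ?g = "\<lambda>x. norm (f x - ball_mean f r) powr p * w x"
    define I where "I = (LINT x:hball 0 r|lebesgue. ?g x)"
    have I: "0 \<le> I" unfolding I_def set_lebesgue_integral_def using w by (intro integral_nonneg_AE) simp
    have "(\<lambda>x. f x - ball_mean f r) \<in> Lp_loc p w"
      using L w wi p by (intro Lp_loc_diff_const) auto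
    then have i: "set_integrable lebesgue (hball 0 r) ?g"
      by (rule Lp_loc_set_integrable_hball)
    have "ennreal I \<le> ennreal (K powr p * wmeasure w (hball 0 r))"
      using bound[OF r] w unfolding I_def by (subst ennreal_set_lebesgue_integral[OF i]) auto
    then have "I \<le> K powr p * wmeasure w (hball 0 r)"
      using pos[OF r] by (subst (asm) ennreal_le_iff) auto
    then show ?thesis
      using I p K pos[OF r] unfolding cmo_term_def I_def[symmetric]
      by (subst average_powr_le_iff) auto
  qed
  then show ?thesis using L by (auto simp: cmo_space_def intro!: bdd_aboveI2)
qed

section \<open>Weighted mean oscillation\<close>

text \<open>
  For \<open>\<alpha> \<ge> 0\<close> the lower bound on \<open>|M x|\<close> is used and costs a power of \<open>C\<close>; for \<open>\<alpha> < 0\<close> the upper bound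
  is used.
\<close>

lemma quasi_dilation_weight_le:
  fixes M :: "'n::finite heis_matrix"
  assumes M: "quasi_dilation C a M"
  shows "hnorm x powr \<alpha> \<le> C powr \<bar>\<alpha>\<bar> * a powr (- \<alpha>) * hnorm (M *v x) powr \<alpha>"
proof (cases "x = 0")
  case False
  have a: "0 < a" "1 \<le> C" and le: "hnorm (M *v x) \<le> a * hnorm x" "a * hnorm x \<le> C * hnorm (M *v x)"
    using M by (auto simp: quasi_dilation_def)
  have h: "0 < hnorm x" using False by (simp add: hnorm_pos_iff)
  then have "0 < C * hnorm (M *v x)" using le a by (smt (verit) mult_pos_pos)
  then have k: "0 < hnorm (M *v x)" using a by (simp add: zero_less_mult_iff)
  show ?thesis
  proof (cases "0 \<le> \<alpha>")
    case True
    have "hnorm x powr \<alpha> \<le> (C * hnorm (M *v x) / a) powr \<alpha>"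
      using h le a True by (intro powr_mono2) (auto simp: field_simps)
    also have "\<dots> = C powr \<alpha> * a powr (- \<alpha>) * hnorm (M *v x) powr \<alpha>"
      using a k by (simp add: powr_mult powr_divide powr_minus field_simps)
    finally show ?thesis using True by simp
  next
    case False
    have "hnorm x powr \<alpha> \<le> (hnorm (M *v x) / a) powr \<alpha>"
      using h k le a False by (intro powr_mono2') (auto simp: field_simps)
    also have "\<dots> = 1 * (a powr (- \<alpha>) * hnorm (M *v x) powr \<alpha>)"
      using a k by (simp add: powr_divide powr_minus field_simps)
    also have "\<dots> \<le> C powr \<bar>\<alpha>\<bar> * (a powr (- \<alpha>) * hnorm (M *v x) powr \<alpha>)"
      using a by (intro mult_right_mono ge_one_powr_ge_zero) auto
    finally show ?thesis by (simp add: mult.assoc)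
  qed
qed simp

text \<open>
  The Jacobian contributes \<open>(C / a) powr Q\<close> and the weight \<open>C powr |\<alpha>| * a powr (- \<alpha>)\<close>.
\<close>

lemma nn_integral_quasi_dilation_weighted:
  fixes M :: "'n::finite heis_matrix" and g :: "'n heis \<Rightarrow> real"
  assumes M: "quasi_dilation C a M" and g[measurable]: "g \<in> borel_measurable borel" and g0: "\<And>x. 0 \<le> g x"
  shows "(\<integral>\<^sup>+x. ennreal (g (M *v x) * hnorm x powr \<alpha>) * indicator (hball 0 r) x \<partial>lborel)
    \<le> ennreal (C powr (homdim TYPE('n) + \<bar>\<alpha>\<bar>) * a powr (- (homdim TYPE('n) + \<alpha>)))
      * (\<integral>\<^sup>+x. ennreal (g x * hnorm x powr \<alpha>) * indicator (hball 0 (a * r)) x \<partial>lborel)"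
proof -
  have a: "0 < a" "1 \<le> C" using M by (auto simp: quasi_dilation_def)
  define c where "c = C powr \<bar>\<alpha>\<bar> * a powr (- \<alpha>)"
  define G where "G = (\<lambda>x :: 'n heis. ennreal (g x * hnorm x powr \<alpha>) * indicator (hball 0 (a * r)) x)"
  have [measurable]: "G \<in> borel_measurable borel" unfolding G_def by measurable
  have "(\<integral>\<^sup>+x. ennreal (g (M *v x) * hnorm x powr \<alpha>) * indicator (hball 0 r) x \<partial>lborel)
      \<le> (\<integral>\<^sup>+x. ennreal c * G (M *v x) \<partial>lborel)"
  proof (intro nn_integral_mono)
    fix x :: "'n heis"
    have "hnorm (M *v x) < a * r" if "hnorm x < r"
    proof -
      have "hnorm (M *v x) \<le> a * hnorm x" using M by (simp add: quasi_dilation_def)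
      also have "\<dots> < a * r" using that a by simp
      finally show ?thesis .
    qed
    then have ind: "indicator (hball 0 r) x \<le> (indicator (hball (0 :: 'n heis) (a * r)) (M *v x) :: ennreal)"
      by (auto simp: hball_zero indicator_def)
    have "g (M *v x) * hnorm x powr \<alpha> \<le> g (M *v x) * (c * hnorm (M *v x) powr \<alpha>)"
      unfolding c_def by (intro mult_left_mono quasi_dilation_weight_le[OF M] g0)
    then have "ennreal (g (M *v x) * hnorm x powr \<alpha>) \<le> ennreal (c * (g (M *v x) * hnorm (M *v x) powr \<alpha>))"
      by (intro ennreal_leI) (simp add: ac_simps)
    also have "\<dots> = ennreal c * ennreal (g (M *v x) * hnorm (M *v x) powr \<alpha>)"
      using g0 by (intro ennreal_mult) (auto simp: c_def)
    finally have "ennreal (g (M *v x) * hnorm x powr \<alpha>) * indicator (hball 0 r) x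
        \<le> ennreal c * ennreal (g (M *v x) * hnorm (M *v x) powr \<alpha>) * indicator (hball 0 (a * r)) (M *v x)"
      by (intro mult_mono ind) auto
    then show "ennreal (g (M *v x) * hnorm x powr \<alpha>) * indicator (hball 0 r) x \<le> ennreal c * G (M *v x)"
      by (simp add: G_def mult.assoc)
  qed
  also have "\<dots> = ennreal c * (\<integral>\<^sup>+x. G (M *v x) \<partial>lborel)"
    by (rule nn_integral_cmult) measurable
  also have "\<dots> \<le> ennreal c * (ennreal ((C / a) ^ hom_dim TYPE('n)) * (\<integral>\<^sup>+x. G x \<partial>lborel))"
    by (intro mult_left_mono nn_integral_quasi_dilation[OF M]) auto
  also have "\<dots> = ennreal (c * (C / a) ^ hom_dim TYPE('n)) * (\<integral>\<^sup>+x. G x \<partial>lborel)"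
    using a by (simp add: c_def ennreal_mult mult.assoc)
  also have "c * (C / a) ^ hom_dim TYPE('n) = C powr (homdim TYPE('n) + \<bar>\<alpha>\<bar>) * a powr (- (homdim TYPE('n) + \<alpha>))"
    using a by (simp add: c_def powr_realpow[symmetric] powr_divide powr_add powr_minus powr_diff field_simps)
  finally show ?thesis by (simp add: G_def)
qed

text \<open>
  The weight \<open>|x| powr \<alpha>\<close> satisfies a Muckenhoupt condition on balls about the origin. For \<open>\<alpha> > 0\<close> take
  the reference density \<open>v = |x| powr (- \<gamma>)\<close> with \<open>\<gamma> = \<alpha> / (p - 1)\<close>, so that \<open>v powr (1 - p)\<close> is the
  weight, and \<open>v\<close> is integrable at the origin because \<open>\<gamma> < Q\<close>, which is the condition on \<open>p\<close>. For
  \<open>\<alpha> \<le> 0\<close> take \<open>v = 1\<close>, since the weight is then at least \<open>r powr \<alpha>\<close> on the ball. Both cases are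
  treated together by means of \<open>\<delta> = min \<alpha> 0\<close>, with \<open>\<gamma> (p - 1) = \<alpha> - \<delta>\<close>.
\<close>

lemma nn_integral_hball_mean_bound:
  fixes \<alpha> p :: real
  assumes \<alpha>: "- homdim TYPE('n::finite) < \<alpha>" "0 < \<alpha> \<longrightarrow> (homdim TYPE('n) + \<alpha>) / homdim TYPE('n) < p" and p: "1 \<le> p"
  obtains C where "0 < C"
    "\<And>(g :: 'n heis \<Rightarrow> real) X r. g \<in> borel_measurable lebesgue \<Longrightarrow> (\<And>x. 0 \<le> g x) \<Longrightarrow> 0 < X \<Longrightarrow> 0 < r \<Longrightarrow>
      (\<integral>\<^sup>+x. ennreal (g x powr p * hnorm x powr \<alpha>) * indicator (hball 0 r) x \<partial>lborel)
        \<le> ennreal (X powr p * wmeasure (\<lambda>x. hnorm x powr \<alpha>) (hball (0 :: 'n heis) r)) \<Longrightarrow>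
      (\<integral>\<^sup>+x. ennreal (g x) * indicator (hball 0 r) x \<partial>lborel) \<le> ennreal (C * X * r powr homdim TYPE('n))"
proof -
  define Q where "Q = homdim TYPE('n)"
  have Q: "0 < Q" by (simp add: Q_def hom_dim_def)
  define \<delta> where "\<delta> = min \<alpha> 0"
  define \<gamma> where "\<gamma> = (if 0 < \<alpha> then \<alpha> / (p - 1) else 0)"
  have p1: "1 < p" if "0 < \<alpha>"
  proof -
    have "1 \<le> (Q + \<alpha>) / Q" using that Q by simp
    then show ?thesis using that \<alpha> by (auto simp: Q_def)
  qed
  have \<gamma>p: "\<gamma> * (p - 1) = \<alpha> - \<delta>" using p1 by (auto simp: \<gamma>_def \<delta>_def)
  have \<gamma>Q: "- Q < - \<gamma>"
  proof (cases "0 < \<alpha>")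
    case True
    then have "\<alpha> < Q * (p - 1)" using \<alpha> Q by (simp add: Q_def field_simps)
    then show ?thesis using True p1 by (simp add: \<gamma>_def field_simps)
  qed (use Q in \<open>simp add: \<gamma>_def\<close>)
  define c where "c \<beta> = wmeasure (\<lambda>x. hnorm x powr \<beta>) (hball (0 :: 'n heis) 1)" for \<beta>
  have c: "0 < c \<alpha>" "0 < c (- \<gamma>)"
    using \<alpha>(1) \<gamma>Q by (auto simp: c_def Q_def intro!: wmeasure_hball_pos)
  define d where "d = (c \<alpha> / c (- \<gamma>)) powr (1 / p)"
  have d: "0 < d" "d powr p = c \<alpha> / c (- \<gamma>)"
    using c p by (auto simp: d_def powr_powr)
  show ?thesis
  proof (rule that)
    show "0 < 2 * d * c (- \<gamma>)" using c d by simp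
    fix g :: "'n heis \<Rightarrow> real" and X r :: real
    assume g[measurable]: "g \<in> borel_measurable lebesgue" and g0: "\<And>x. 0 \<le> g x" and X: "0 < X" and r: "0 < r"
      and b: "(\<integral>\<^sup>+x. ennreal (g x powr p * hnorm x powr \<alpha>) * indicator (hball 0 r) x \<partial>lborel)
        \<le> ennreal (X powr p * wmeasure (\<lambda>x. hnorm x powr \<alpha>) (hball (0 :: 'n heis) r))"
    let ?B = "hball (0 :: 'n heis) r"
    define v where "v x = hnorm x powr (- \<gamma>) * indicator ?B x" for x :: "'n heis"
    \<comment> \<open>The origin is removed because \<open>0 powr e = 0\<close> makes \<open>v\<close> vanish there.\<close>
    define h where "h x = g x * indicator (?B - {0}) x" for x :: "'n heis"
    have vm: "v \<in> borel_measurable lebesgue" unfolding v_def by measurable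
    have "?B - {0} \<in> sets lebesgue" by (intro sets_completionI_sets) simp
    then have hm: "h \<in> borel_measurable lebesgue"
      unfolding h_def by (intro borel_measurable_times borel_measurable_indicator g)
    define V where "V = r powr (Q - \<gamma>) * c (- \<gamma>)"
    have v_int: "(\<integral>\<^sup>+x. ennreal (v x) \<partial>lebesgue) = ennreal V"
    proof -
      have "(\<integral>\<^sup>+x. ennreal (v x) \<partial>lborel) = (\<integral>\<^sup>+x. ennreal (hnorm x powr (- \<gamma>)) * indicator ?B x \<partial>lborel)"
        by (intro nn_integral_cong) (simp add: v_def indicator_def)
      also have "\<dots> = ennreal V"
        using wmeasure_hball_scale[OF \<gamma>Q[unfolded Q_def] r]
        unfolding ennreal_wmeasure_hball[OF \<gamma>Q[unfolded Q_def], symmetric] by (simp add: V_def Q_def c_def)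
      finally show ?thesis by (simp add: nn_integral_completion)
    qed
    have "(\<integral>\<^sup>+x. ennreal (h x powr p * v x powr (1 - p)) \<partial>lebesgue)
        \<le> (\<integral>\<^sup>+x. ennreal (r powr (- \<delta>)) * (ennreal (g x powr p * hnorm x powr \<alpha>) * indicator ?B x) \<partial>lebesgue)"
    proof (intro nn_integral_mono)
      fix x :: "'n heis"
      show "ennreal (h x powr p * v x powr (1 - p)) \<le> ennreal (r powr (- \<delta>)) * (ennreal (g x powr p * hnorm x powr \<alpha>) * indicator ?B x)"
      proof (cases "x \<in> ?B \<and> x \<noteq> 0")
        case True
        then have x: "0 < hnorm x" "hnorm x < r" by (auto simp: hball_zero hnorm_pos_iff)
        have "v x powr (1 - p) = hnorm x powr (\<gamma> * (p - 1))"
          using True by (simp add: v_def powr_powr algebra_simps)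
        also have "\<dots> = hnorm x powr (- \<delta>) * hnorm x powr \<alpha>"
          unfolding \<gamma>p by (simp add: powr_add[symmetric])
        also have "\<dots> \<le> r powr (- \<delta>) * hnorm x powr \<alpha>"
          using x by (intro mult_right_mono powr_mono2) (auto simp: \<delta>_def)
        finally have "h x powr p * v x powr (1 - p) \<le> g x powr p * (r powr (- \<delta>) * hnorm x powr \<alpha>)"
          using True by (intro mult_mono) (auto simp: h_def)
        then have "ennreal (h x powr p * v x powr (1 - p)) \<le> ennreal (r powr (- \<delta>) * (g x powr p * hnorm x powr \<alpha>))"
          by (intro ennreal_leI) (simp add: ac_simps)
        also have "\<dots> = ennreal (r powr (- \<delta>)) * ennreal (g x powr p * hnorm x powr \<alpha>)"
          by (rule ennreal_mult) auto
        finally show ?thesis using True by simp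
      qed (auto simp: h_def)
    qed
    also have "\<dots> = ennreal (r powr (- \<delta>)) * (\<integral>\<^sup>+x. ennreal (g x powr p * hnorm x powr \<alpha>) * indicator ?B x \<partial>lebesgue)"
      by (rule nn_integral_cmult) measurable
    also have "\<dots> \<le> ennreal (r powr (- \<delta>)) * ennreal (X powr p * wmeasure (\<lambda>x. hnorm x powr \<alpha>) ?B)"
      unfolding nn_integral_completion by (intro mult_left_mono b) auto
    also have "\<dots> = ennreal (r powr (- \<delta>) * (X powr p * (r powr (Q + \<alpha>) * c \<alpha>)))"
      using wmeasure_hball_scale[OF \<alpha>(1) r] c by (subst ennreal_mult[symmetric]) (auto simp: Q_def c_def)
    also have "r powr (- \<delta>) * (X powr p * (r powr (Q + \<alpha>) * c \<alpha>)) = (X * r powr \<gamma> * d) powr p * V"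
    proof -
      have "(X * r powr \<gamma> * d) powr p * V = X powr p * (r powr (\<gamma> * p) * r powr (Q - \<gamma>)) * (d powr p * c (- \<gamma>))"
        using X d r by (simp add: powr_mult powr_powr V_def)
      also have "r powr (\<gamma> * p) * r powr (Q - \<gamma>) = r powr (- \<delta>) * r powr (Q + \<alpha>)"
        proof -
        have "\<gamma> * p + (Q - \<gamma>) = - \<delta> + (Q + \<alpha>)" using \<gamma>p by (simp add: algebra_simps)
        then show ?thesis by (simp only: powr_add[symmetric])
      qed
      also have "d powr p * c (- \<gamma>) = c \<alpha>" using d c by simp
      finally show ?thesis by simp
    qed
    finally have hv: "(\<integral>\<^sup>+x. ennreal (h x powr p * v x powr (1 - p)) \<partial>lebesgue) \<le> ennreal ((X * r powr \<gamma> * d) powr p * V)" .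
    have "(\<integral>\<^sup>+x. ennreal (h x) \<partial>lebesgue) \<le> ennreal (2 * (X * r powr \<gamma> * d) * V)"
    proof (rule nn_integral_mean_bound[OF hm vm _ _ _ _ p _ _ hv])
      show "0 \<le> h x" "0 \<le> v x" for x by (auto simp: h_def v_def g0)
      show "v x = 0 \<Longrightarrow> h x = 0" for x by (auto simp: h_def v_def indicator_def split: if_splits)
      show "0 < X * r powr \<gamma> * d" using X r d by simp
      show "0 \<le> V" using c by (simp add: V_def)
    qed (simp add: v_int)
    also have "2 * (X * r powr \<gamma> * d) * V = 2 * d * c (- \<gamma>) * X * r powr Q"
      using r by (simp add: V_def powr_diff field_simps)
    also have "(\<integral>\<^sup>+x. ennreal (h x) \<partial>lebesgue) = (\<integral>\<^sup>+x. ennreal (g x) * indicator ?B x \<partial>lborel)"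
      unfolding nn_integral_completion 
      by (intro nn_integral_cong_AE eventually_mono[OF AE_lborel_nonzero]) (auto simp: h_def indicator_def)
    finally show "(\<integral>\<^sup>+x. ennreal (g x) * indicator ?B x \<partial>lborel) \<le> ennreal (2 * d * c (- \<gamma>) * X * r powr homdim TYPE('n))"
      by (simp add: Q_def)
  qed
qed

lemma measure_hball:
  assumes "0 < r"
  shows "measure lebesgue (hball (0 :: 'n::finite heis) r)
    = r powr homdim TYPE('n) * measure lborel (hball (0 :: 'n heis) 1)"
proof -
  have "emeasure lborel (hball (0 :: 'n heis) r) = ennreal (r powr homdim TYPE('n)) * emeasure lborel (hball (0 :: 'n heis) 1)"
    using emeasure_hball[OF assms, where 'n='n] assms by (simp add: powr_realpow)
  then have "measure lborel (hball (0 :: 'n heis) r) = r powr homdim TYPE('n) * measure lborel (hball (0 :: 'n heis) 1)"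
    unfolding measure_def by (simp add: enn2real_mult)
  then show ?thesis by (subst measure_completion) auto
qed

lemma measure_hball_unit_pos: "0 < measure lborel (hball (0 :: 'n::finite heis) 1)"
  using emeasure_hball_pos[of 1, where 'n='n] emeasure_hball_finite[of 1, where 'n='n]
  by (simp add: measure_def enn2real_positive_iff)

lemma locally_integrable_hball:
  fixes b :: "'n::finite heis \<Rightarrow> 'k::{banach, second_countable_topology}"
  assumes "locally_integrable b"
  shows "set_integrable lebesgue (hball 0 r) b"
proof -
  have "compact (closure (hball (0 :: 'n heis) r))" using bounded_hball compact_closure by blast
  then have "set_integrable lebesgue (closure (hball 0 r)) b"
    using assms unfolding locally_integrable_def by blast
  then show ?thesis
    by (rule set_integrable_subset) (simp_all add: closure_subset)
qed

lemma ball_mean_diff_const: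
  fixes b :: "'n::finite heis \<Rightarrow> 'k::{banach, second_countable_topology}"
  assumes b: "locally_integrable b" and r: "0 < r"
  shows "ball_mean b r - c = ball_mean (\<lambda>x. b x - c) r"
proof -
  let ?m = "measure lebesgue (hball (0 :: 'n heis) r)"
  have m: "0 < ?m" using r measure_hball[OF r, where 'n='n] measure_hball_unit_pos[where 'n='n] by simp
  have i: "set_integrable lebesgue (hball (0 :: 'n heis) r) (\<lambda>_. c)"
    using emeasure_hball_finite[of r, where 'n='n]
    by (subst set_integrable_iff_nn_integral_finite) (auto simp: nn_integral_cmult ennreal_mult_less_top)
  have "(LINT x:hball (0 :: 'n heis) r|lebesgue. b x - c) = (LINT x:hball 0 r|lebesgue. b x) - (LINT x:hball (0 :: 'n heis) r|lebesgue. c)"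
    by (rule set_integral_diff[OF locally_integrable_hball[OF b] i])
  also have "(LINT x:hball (0 :: 'n heis) r|lebesgue. c) = ?m *\<^sub>R c"
    using emeasure_hball_finite[of r, where 'n='n]
    unfolding set_lebesgue_integral_def by (subst integral_scaleR_left) (auto simp: less_top)
  finally show ?thesis using m by (simp add: ball_mean_def scaleR_diff_right)
qed

lemma norm_ball_mean_le:
  fixes b :: "'n::finite heis \<Rightarrow> 'k::{banach, second_countable_topology}"
  assumes b: "b \<in> borel_measurable lebesgue" and r: "0 < r" and I: "0 \<le> I"
    and le: "(\<integral>\<^sup>+x. ennreal (norm (b x)) * indicator (hball 0 r) x \<partial>lborel) \<le> ennreal I"
  shows "norm (ball_mean b r) \<le> I / (r powr homdim TYPE('n) * measure lborel (hball (0 :: 'n heis) 1))"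
proof -
  have i: "set_integrable lebesgue (hball 0 r) b"
    using le by (subst set_integrable_iff_nn_integral_finite[OF b hball_lebesgue]) (auto intro: le_less_trans)
  have "ennreal (norm (LINT x:hball 0 r|lebesgue. b x)) \<le> (\<integral>\<^sup>+x. ennreal (norm (indicator (hball 0 r) x *\<^sub>R b x)) \<partial>lebesgue)"
    using i unfolding set_lebesgue_integral_def set_integrable_def by (rule integral_norm_bound_ennreal)
  also have "\<dots> = (\<integral>\<^sup>+x. ennreal (norm (b x)) * indicator (hball 0 r) x \<partial>lborel)"
    unfolding nn_integral_completion by (intro nn_integral_cong) (simp add: indicator_def)
  also note le
  finally have "norm (LINT x:hball 0 r|lebesgue. b x) \<le> I" using I by (subst (asm) ennreal_le_iff) auto
  then show ?thesis
    using r measure_hball[OF r, where 'n='n] measure_hball_unit_pos[where 'n='n]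
    by (simp add: ball_mean_def divide_right_mono)
qed

text \<open>
  The difference of the means is the mean over the smaller ball of \<open>b - ball_mean b r\<close>, and doubling the
  radius multiplies the volume only by a constant.
\<close>

lemma cmo_ball_mean_dyadic:
  fixes b :: "'n::finite heis \<Rightarrow> 'k::{banach, second_countable_topology}"
  assumes \<alpha>: "- homdim TYPE('n) < \<alpha>" "0 < \<alpha> \<longrightarrow> (homdim TYPE('n) + \<alpha>) / homdim TYPE('n) < p" and p: "1 \<le> p"
    and b: "locally_integrable b" "b \<in> borel_measurable lebesgue" and K: "0 < K"
    and osc: "\<And>r. 0 < r \<Longrightarrow> (\<integral>\<^sup>+x. ennreal (norm (b x - ball_mean b r) powr p * hnorm x powr \<alpha>) * indicator (hball 0 r) x \<partial>lborel)
        \<le> ennreal (K powr p * wmeasure (\<lambda>x. hnorm x powr \<alpha>) (hball (0 :: 'n heis) r))"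
  obtains D where "0 < D" "\<And>s r. 0 < s \<Longrightarrow> s \<le> r \<Longrightarrow> r \<le> 2 * s \<Longrightarrow> norm (ball_mean b s - ball_mean b r) \<le> D"
proof -
  define c where "c = measure lborel (hball (0 :: 'n heis) 1)"
  have c: "0 < c" using measure_hball_unit_pos by (simp add: c_def)
  obtain C where C: "0 < C"
    "\<And>(g :: 'n heis \<Rightarrow> real) X r. g \<in> borel_measurable lebesgue \<Longrightarrow> (\<And>x. 0 \<le> g x) \<Longrightarrow> 0 < X \<Longrightarrow> 0 < r \<Longrightarrow>
      (\<integral>\<^sup>+x. ennreal (g x powr p * hnorm x powr \<alpha>) * indicator (hball 0 r) x \<partial>lborel)
        \<le> ennreal (X powr p * wmeasure (\<lambda>x. hnorm x powr \<alpha>) (hball (0 :: 'n heis) r)) \<Longrightarrow>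
      (\<integral>\<^sup>+x. ennreal (g x) * indicator (hball 0 r) x \<partial>lborel) \<le> ennreal (C * X * r powr homdim TYPE('n))"
    using nn_integral_hball_mean_bound[OF \<alpha> p] by blast
  show ?thesis
  proof (rule that)
    show "0 < C * K * 2 powr homdim TYPE('n) / c" using C K c by simp
    fix s r :: real assume sr: "0 < s" "s \<le> r" "r \<le> 2 * s"
    let ?m = "ball_mean b r"
    have bm: "(\<lambda>x. b x - ?m) \<in> borel_measurable lebesgue" using b(2) by measurable
    have "(\<integral>\<^sup>+x. ennreal (norm (b x - ?m)) * indicator (hball 0 s) x \<partial>lborel)
        \<le> (\<integral>\<^sup>+x. ennreal (norm (b x - ?m)) * indicator (hball 0 r) x \<partial>lborel)"
      using sr by (intro nn_integral_mono mult_left_mono) (auto simp: hball_zero indicator_def)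
    also have "\<dots> \<le> ennreal (C * K * r powr homdim TYPE('n))"
      using sr bm by (intro C(2) K osc) auto
    finally have "norm (ball_mean (\<lambda>x. b x - ?m) s) \<le> C * K * r powr homdim TYPE('n) / (s powr homdim TYPE('n) * c)"
      unfolding c_def using sr C K by (intro norm_ball_mean_le bm) auto
    also have "\<dots> \<le> C * K * (2 * s) powr homdim TYPE('n) / (s powr homdim TYPE('n) * c)"
      using sr C K c by (intro divide_right_mono mult_left_mono powr_mono2) auto
    also have "\<dots> = C * K * 2 powr homdim TYPE('n) / c"
      using sr by (simp add: powr_mult)
    finally show "norm (ball_mean b s - ?m) \<le> C * K * 2 powr homdim TYPE('n) / c"
      using sr b by (simp add: ball_mean_diff_const)
  qed
qed

text \<open>
  Between \<open>s\<close> and \<open>r\<close> there are about \<open>|log 2 (s / r)|\<close> doublings, each contributing at most \<open>D\<close>.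
\<close>

lemma dyadic_telescoping:
  fixes m :: "real \<Rightarrow> 'k::real_normed_vector"
  assumes D: "\<And>s r. 0 < s \<Longrightarrow> s \<le> r \<Longrightarrow> r \<le> 2 * s \<Longrightarrow> norm (m s - m r) \<le> D" and r: "0 < r" "0 < s"
  shows "norm (m s - m r) \<le> D * (1 + \<bar>log 2 (s / r)\<bar>)"
proof -
  have D0: "0 \<le> D" using D[of 1 1] by simp
  have tel: "norm (m s - m r) \<le> real n * D" if "0 < s" "s \<le> r" "r \<le> 2 ^ n * s" for n s r
    using that
  proof (induction n arbitrary: s)
    case (Suc n)
    define t where "t = min (2 * s) r"
    have "norm (m s - m t) \<le> D" using Suc.prems by (intro D) (auto simp: t_def)
    moreover have "norm (m t - m r) \<le> real n * D"
      using Suc.prems by (intro Suc.IH) (auto simp: t_def min_def)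
    moreover have "norm (m s - m r) \<le> norm (m s - m t) + norm (m t - m r)"
      by (metis norm_triangle_ineq diff_add_cancel add_diff_eq)
    ultimately show ?case by (simp add: algebra_simps)
  qed auto
  have main: "norm (m s - m r) \<le> D * (1 + log 2 (r / s))" if sr: "0 < s" "s \<le> r" for s r
  proof -
    define n where "n = nat \<lceil>log 2 (r / s)\<rceil>"
    have l: "0 \<le> log 2 (r / s)" using sr by simp
    then have n: "log 2 (r / s) \<le> real n" "real n \<le> 1 + log 2 (r / s)"
      unfolding n_def by linarith+
    have "r / s = 2 powr log 2 (r / s)" using sr by simp
    also have "\<dots> \<le> 2 powr real n" using n by (intro powr_mono) auto
    finally have "r \<le> 2 ^ n * s" using sr by (simp add: powr_realpow field_simps)
    then have "norm (m s - m r) \<le> real n * D" using sr by (intro tel)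
    also have "\<dots> \<le> (1 + log 2 (r / s)) * D" using n D0 by (intro mult_right_mono)
    finally show ?thesis by (simp add: mult.commute)
  qed
  show ?thesis
  proof (cases "s \<le> r")
    case True
    moreover have "log 2 (s / r) = - log 2 (r / s)" using r by (simp add: log_divide)
    ultimately show ?thesis using main[of s r] r by simp
  next
    case False
    then show ?thesis using main[of r s] r by (simp add: norm_minus_commute)
  qed
qed

text \<open>
  Insert \<open>m r\<close> and \<open>m (a r)\<close>, the means of \<open>b\<close> over \<open>B\<^sub>r\<close> and over the ball \<open>B\<^sub>a\<^sub>r\<close> that contains the image
  of \<open>B\<^sub>r\<close>. The first term is an oscillation, the last one becomes an oscillation on \<open>B\<^sub>a\<^sub>r\<close> after a change
  of variables, and the middle one is the logarithmic difference of the means. The means enter through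
  a function \<open>m\<close> because \<open>b\<close> will be a Borel version of a function whose means are already at hand.
\<close>

lemma nn_integral_quasi_dilation_oscillation:
  fixes b :: "'n::finite heis \<Rightarrow> 'k::{banach, second_countable_topology}" and m :: "real \<Rightarrow> 'k"
  assumes \<alpha>: "- homdim TYPE('n) < \<alpha>" and p: "1 \<le> p" and K: "0 < K"
    and b[measurable]: "b \<in> borel_measurable borel"
    and osc: "\<And>r. 0 < r \<Longrightarrow> (\<integral>\<^sup>+x. ennreal (norm (b x - m r) powr p * hnorm x powr \<alpha>) * indicator (hball 0 r) x \<partial>lborel)
        \<le> ennreal (K powr p * wmeasure (\<lambda>x. hnorm x powr \<alpha>) (hball (0 :: 'n heis) r))"
    and D: "\<And>s r. 0 < s \<Longrightarrow> s \<le> r \<Longrightarrow> r \<le> 2 * s \<Longrightarrow> norm (m s - m r) \<le> D"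
  obtains E where "0 < E"
    "\<And>a M r. quasi_dilation C a M \<Longrightarrow> 0 < r \<Longrightarrow>
      (\<integral>\<^sup>+x. ennreal (norm (b x - b (M *v x)) powr p * hnorm x powr \<alpha>) * indicator (hball 0 r) x \<partial>lborel)
      \<le> ennreal ((E * (1 + \<bar>log 2 a\<bar>)) powr p * wmeasure (\<lambda>x. hnorm x powr \<alpha>) (hball (0 :: 'n heis) r))"
proof -
  define Q where "Q = homdim TYPE('n)"
  define W where "W r = wmeasure (\<lambda>x. hnorm x powr \<alpha>) (hball (0 :: 'n heis) r)" for r
  have W: "0 < W r" if "0 < r" for r using wmeasure_hball_pos[OF \<alpha> that] by (simp add: W_def)
  have D0: "0 \<le> D" using D[of 1 1] norm_ge_zero by simp
  define c where "c = C powr (Q + \<bar>\<alpha>\<bar>)"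
  have c: "0 \<le> c" by (simp add: c_def)
  define e where "e = K powr p + D powr p + c * K powr p"
  have e: "0 < e" using K c by (simp add: e_def add_pos_nonneg)
  \<comment> \<open>\<open>e\<close> collects the three contributions in the order oscillation, difference of means, oscillation after
    the change of variables; the factor \<open>3\<close> stems from \<open>powr_sum3_le\<close>.\<close>
  define E where "E = 3 * e powr (1 / p)"
  show ?thesis
  proof (rule that)
    show "0 < E" using e by (simp add: E_def)
    fix a r :: real and M :: "'n heis_matrix" assume M: "quasi_dilation C a M" and r: "0 < r"
    have a: "0 < a" using M by (simp add: quasi_dilation_def)
    define L where "L = 1 + \<bar>log 2 a\<bar>"
    have L: "1 \<le> L" by (simp add: L_def)
    let ?I = "\<lambda>f. (\<integral>\<^sup>+x. ennreal (f x * hnorm x powr \<alpha>) * indicator (hball (0 :: 'n heis) r) x \<partial>lborel)"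
    define f1 where "f1 x = norm (b x - m r) powr p" for x
    define f2 where "f2 = (\<lambda>x :: 'n heis. norm (m r - m (a * r)) powr p)"
    define f3 where "f3 x = norm (b x - m (a * r)) powr p" for x
    have [measurable]: "f1 \<in> borel_measurable borel" "f2 \<in> borel_measurable borel" "f3 \<in> borel_measurable borel"
      unfolding f1_def f2_def f3_def by measurable
    have I1: "?I f1 \<le> ennreal (K powr p * W r)" unfolding f1_def W_def by (rule osc[OF r])
    have m: "norm (m r - m (a * r)) \<le> D * L"
      using dyadic_telescoping[of m D r "a * r", OF D] r a
      by (simp add: L_def norm_minus_commute)
    have "?I f2 = ennreal (norm (m r - m (a * r)) powr p) * (\<integral>\<^sup>+x. ennreal (hnorm x powr \<alpha>) * indicator (hball (0 :: 'n heis) r) x \<partial>lborel)"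
      unfolding f2_def by (subst nn_integral_cmult[symmetric]) (auto simp: ennreal_mult mult.assoc)
    also have "\<dots> = ennreal (norm (m r - m (a * r)) powr p) * ennreal (W r)"
      unfolding W_def ennreal_wmeasure_hball[OF \<alpha>] ..
    also have "\<dots> \<le> ennreal ((D * L) powr p) * ennreal (W r)"
      using m p by (intro mult_right_mono ennreal_leI powr_mono2) auto
    finally have I2: "?I f2 \<le> ennreal ((D * L) powr p * W r)"
      using W[OF r] by (simp add: ennreal_mult)
    have "?I (\<lambda>x. f3 (M *v x)) \<le> ennreal (c * a powr (- (Q + \<alpha>)))
      * (\<integral>\<^sup>+x. ennreal (f3 x * hnorm x powr \<alpha>) * indicator (hball 0 (a * r)) x \<partial>lborel)"
      unfolding c_def Q_def by (rule nn_integral_quasi_dilation_weighted[OF M]) (auto simp: f3_def)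
    also have "\<dots> \<le> ennreal (c * a powr (- (Q + \<alpha>))) * ennreal (K powr p * W (a * r))"
      unfolding f3_def W_def using a r by (intro mult_left_mono osc) auto
    also have "\<dots> = ennreal (c * K powr p * W r)"
    proof -
      have "W (a * r) = a powr (Q + \<alpha>) * W r"
        unfolding W_def Q_def using a r
        by (subst (1 2) wmeasure_hball_scale[OF \<alpha>]) (auto simp: powr_mult)
      then have "c * a powr (- (Q + \<alpha>)) * (K powr p * W (a * r))
          = c * K powr p * W r * (a powr (- (Q + \<alpha>)) * a powr (Q + \<alpha>))"
        by (simp add: ac_simps)
      also have "a powr (- (Q + \<alpha>)) * a powr (Q + \<alpha>) = 1"
        using a by (simp only: powr_add[symmetric]) simp
      finally have eq: "c * a powr (- (Q + \<alpha>)) * (K powr p * W (a * r)) = c * K powr p * W r" by simp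
      have "0 \<le> W (a * r)" using W[of "a * r"] a r by simp
      then show ?thesis
        unfolding eq[symmetric] using c by (intro ennreal_mult[symmetric]) auto
    qed
    finally have I3: "?I (\<lambda>x. f3 (M *v x)) \<le> ennreal (c * K powr p * W r)" .
    have "?I (\<lambda>x. norm (b x - b (M *v x)) powr p) \<le> ?I (\<lambda>x. 3 powr p * (f1 x + f2 x + f3 (M *v x)))"
    proof (intro nn_integral_mono mult_right_mono ennreal_leI)
      fix x
      have "norm (b x - b (M *v x)) \<le> norm (b x - m r) + norm (m r - m (a * r)) + norm (b (M *v x) - m (a * r))"
        by norm
      then have "norm (b x - b (M *v x)) powr p \<le> (norm (b x - m r) + norm (m r - m (a * r)) + norm (b (M *v x) - m (a * r))) powr p"
        using p by (intro powr_mono2) auto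
      also have "\<dots> \<le> 3 powr p * (f1 x + f2 x + f3 (M *v x))"
        unfolding f1_def f2_def f3_def using p by (intro powr_sum3_le) auto
      finally show "norm (b x - b (M *v x)) powr p \<le> 3 powr p * (f1 x + f2 x + f3 (M *v x))" .
    qed auto
    also have "\<dots> = ennreal (3 powr p) * (?I f1 + ?I f2 + ?I (\<lambda>x. f3 (M *v x)))"
    proof -
      have "?I (\<lambda>x. 3 powr p * (f1 x + f2 x + f3 (M *v x))) =
        (\<integral>\<^sup>+x. ennreal (3 powr p) * (ennreal (f1 x * hnorm x powr \<alpha>) * indicator (hball (0 :: 'n heis) r) x
          + ennreal (f2 x * hnorm x powr \<alpha>) * indicator (hball (0 :: 'n heis) r) x
          + ennreal (f3 (M *v x) * hnorm x powr \<alpha>) * indicator (hball (0 :: 'n heis) r) x) \<partial>lborel)"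
        by (intro nn_integral_cong)
          (simp add: f1_def f2_def f3_def indicator_def ennreal_mult[symmetric] ennreal_plus[symmetric] algebra_simps del: ennreal_plus)
      then show ?thesis by (simp add: nn_integral_cmult nn_integral_add)
    qed
    also have "\<dots> \<le> ennreal (3 powr p) * (ennreal (K powr p * W r) + ennreal ((D * L) powr p * W r) + ennreal (c * K powr p * W r))"
      by (intro mult_left_mono add_mono I1 I2 I3) auto
    also have "\<dots> = ennreal (3 powr p * ((K powr p + (D * L) powr p + c * K powr p) * W r))"
      using W[OF r] c by (simp add: ennreal_mult[symmetric] ennreal_plus[symmetric] algebra_simps del: ennreal_plus)
    also have "\<dots> \<le> ennreal ((E * L) powr p * W r)"
    proof (intro ennreal_leI)
      have "1 \<le> L powr p" using L p by (intro ge_one_powr_ge_zero) auto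
      then have "K powr p * 1 \<le> K powr p * L powr p" "c * K powr p * 1 \<le> c * K powr p * L powr p"
        using c by (intro mult_left_mono; simp)+
      then have "K powr p + (D * L) powr p + c * K powr p \<le> e * L powr p"
        using D0 L by (simp add: e_def powr_mult algebra_simps)
      then have "3 powr p * ((K powr p + (D * L) powr p + c * K powr p) * W r) \<le> 3 powr p * (e * L powr p * W r)"
        using W[OF r] by (intro mult_left_mono mult_right_mono) auto
      also have "\<dots> = (E * L) powr p * W r"
        using e L p by (simp add: E_def powr_mult powr_powr)
      finally show "3 powr p * ((K powr p + (D * L) powr p + c * K powr p) * W r) \<le> (E * L) powr p * W r" .
    qed
    finally show "?I (\<lambda>x. norm (b x - b (M *v x)) powr p)
        \<le> ennreal ((E * (1 + \<bar>log 2 a\<bar>)) powr p * wmeasure (\<lambda>x. hnorm x powr \<alpha>) (hball (0 :: 'n heis) r))"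
      by (simp add: L_def W_def)
  qed
qed

section \<open>Matrices satisfying the inverse bound\<close>

lemma hmat_norm_le_iff:
  assumes "0 \<le> c"
  shows "hmat_norm M \<le> ennreal c \<longleftrightarrow> (\<forall>x. hnorm (M *v x) \<le> c * hnorm x)"
proof -
  have "hmat_norm M \<le> ennreal c \<longleftrightarrow> (\<forall>x\<in>-{0}. hnorm (M *v x) / hnorm x \<le> c)"
    using assms by (simp add: hmat_norm_def SUP_le_iff ennreal_le_iff)
  also have "\<dots> \<longleftrightarrow> (\<forall>x\<in>-{0}. hnorm (M *v x) \<le> c * hnorm x)"
    by (intro ball_cong) (auto simp: hnorm_pos_iff field_simps)
  also have "\<dots> \<longleftrightarrow> (\<forall>x. hnorm (M *v x) \<le> c * hnorm x)"
    by (metis Compl_iff hnorm_zero matrix_vector_mult_0_right mult_zero_right order_refl singletonD)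
  finally show ?thesis .
qed

text \<open>
  The norm is a supremum of continuous functions of the matrix, hence lower semicontinuous.
\<close>

lemma hmat_norm_borel [measurable]:
  "hmat_norm \<in> borel_measurable (borel :: 'n::finite heis_matrix measure)"
proof (rule borel_measurableI_le)
  fix c :: ennreal
  show "{M \<in> space borel. hmat_norm (M :: 'n heis_matrix) \<le> c} \<in> sets borel"
  proof (cases c rule: ennreal_cases)
    case (real r)
    have cont: "continuous_on UNIV (\<lambda>M :: 'n heis_matrix. M *v x)" for x
      unfolding matrix_vector_mult_def by (intro continuous_intros)
    have "closed {M :: 'n heis_matrix. \<forall>x. hnorm (M *v x) \<le> r * hnorm x}"
      by (intro closed_Collect_all closed_Collect_le continuous_on_compose2[OF continuous_on_hnorm cont] continuous_intros) auto
    then show ?thesis using real by (simp add: hmat_norm_le_iff borel_closed)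
  qed simp
qed

text \<open>
  The lower bound on \<open>|M x|\<close> is the norm bound for the inverse matrix applied to \<open>M x\<close>. The norm of \<open>M\<close> is
  finite, since otherwise the hypothesis would make the inverse matrix zero.
\<close>

lemma quasi_dilation_of_inverse_bound:
  fixes M :: "'n::finite heis_matrix"
  assumes det: "det M \<noteq> 0" and inv: "hmat_norm (matrix_inv M) \<le> ennreal C0 * inverse (hmat_norm M)"
  shows "quasi_dilation (max C0 1) (enn2real (hmat_norm M)) M" "hmat_norm M < \<infinity>"
proof -
  let ?N = "matrix_inv M"
  have "invertible M" using det by (simp add: invertible_det_nz)
  then have "?N ** M = mat 1"
    unfolding invertible_def matrix_inv_def by (rule someI2_ex) simp
  then have NM: "?N *v (M *v x) = x" for x
    by (simp add: matrix_vector_mul_assoc)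
  obtain e :: "'n heis" where e: "e \<noteq> 0" by (metis axis_eq_0_iff zero_neq_one)
  show fin: "hmat_norm M < \<infinity>"
  proof (rule ccontr)
    assume "\<not> hmat_norm M < \<infinity>"
    then have "hmat_norm M = \<infinity>" by (simp add: not_less top_unique)
    then have "hmat_norm ?N \<le> ennreal 0" using inv by simp
    then have "hnorm (?N *v (M *v e)) \<le> 0" by (subst (asm) hmat_norm_le_iff) auto
    then show False using e hnorm_pos_iff[of e] by (simp add: NM)
  qed
  define a where "a = enn2real (hmat_norm M)"
  have a: "hmat_norm M = ennreal a" "0 \<le> a" using fin by (auto simp: a_def)
  have le: "hnorm (M *v x) \<le> a * hnorm x" for x using a hmat_norm_le_iff[of a M] by auto
  have "a \<noteq> 0"
  proof
    assume "a = 0"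
    then have "hnorm (M *v e) \<le> 0" using le[of e] by simp
    then have "M *v e = 0" using hnorm_nonneg[of "M *v e"] by simp
    then show False using NM[of e] e by simp
  qed
  then have a0: "0 < a" using a by simp
  have "ennreal C0 * inverse (ennreal a) \<le> ennreal (max C0 1) * ennreal (1 / a)"
    using a0 by (intro mult_mono ennreal_leI) (auto simp: inverse_ennreal inverse_eq_divide)
  also have "\<dots> = ennreal (max C0 1 / a)" using a0 by (subst ennreal_mult[symmetric]) auto
  finally have "hmat_norm ?N \<le> ennreal (max C0 1 / a)" using inv a by simp
  then have "hnorm (?N *v y) \<le> max C0 1 / a * hnorm y" for y
    using a0 by (subst (asm) hmat_norm_le_iff) auto
  from this[of "M *v x" for x] have "a * hnorm x \<le> max C0 1 * hnorm (M *v x)" for x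
    using a0 by (simp add: NM field_simps)
  then show "quasi_dilation (max C0 1) (enn2real (hmat_norm M)) M"
    using le a0 by (auto simp: quasi_dilation_def a_def[symmetric])
qed

section \<open>Lebesgue measurability of compositions\<close>

text \<open>
  For each set of a countable base the preimage differs from a measurable set by part of a null set;
  \<open>g\<close> is constant on the union of these countably many null sets.
\<close>

lemma completion_borel_version:
  fixes f :: "'a \<Rightarrow> 'b::{second_countable_topology, t2_space}"
  assumes f: "f \<in> borel_measurable (completion M)"
  obtains g where "g \<in> borel_measurable M" "AE x in M. f x = g x"
proof -
  obtain B :: "'b set set" where B: "countable B" "topological_basis B"
    using ex_countable_basis by auto
  have A: "f -` U \<inter> space M \<in> sets (completion M)" if "U \<in> B" for U
    using measurable_sets[OF f, of U] topological_basis_open[OF B(2) that] by simp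
  have "\<exists>N. N \<in> null_sets M \<and> null_part M (f -` U \<inter> space M) \<subseteq> N" if "U \<in> B" for U
    using null_part[OF A[OF that]] by auto
  then obtain N where N: "\<And>U. U \<in> B \<Longrightarrow> N U \<in> null_sets M"
    "\<And>U. U \<in> B \<Longrightarrow> null_part M (f -` U \<inter> space M) \<subseteq> N U" by metis
  define N' where "N' = (\<Union>U\<in>B. N U)"
  have N': "N' \<in> null_sets M" unfolding N'_def using B(1) N(1) by (intro null_sets_UN') auto
  then have N'm: "N' \<in> sets M" by auto
  define g where "g x = (if x \<in> N' then undefined else f x)" for x
  show ?thesis
  proof (rule that)
    have "g \<in> M \<rightarrow>\<^sub>M sigma UNIV B"
    proof (rule measurable_measure_of)
      fix U assume U: "U \<in> B"
      let ?A = "f -` U \<inter> space M"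
      have "?A = main_part M ?A \<union> null_part M ?A" using main_part_null_part_Un[OF A[OF U]] by simp
      then have "?A - N' = main_part M ?A - N'" using N(2)[OF U] U by (auto simp: N'_def)
      moreover have "main_part M ?A \<in> sets M" by (intro main_part_sets A U)
      ultimately have "?A - N' \<in> sets M" using N'm by simp
      then have "(?A - N') \<union> (if undefined \<in> U then N' else {}) \<in> sets M"
        by (rule sets.Un) (simp add: N'm)
      moreover have "g -` U \<inter> space M = (?A - N') \<union> (if undefined \<in> U then N' else {})"
        using sets.sets_into_space[OF N'm] by (auto simp: g_def split: if_splits)
      ultimately show "g -` U \<inter> space M \<in> sets M" by simp
    qed auto
    then show "g \<in> borel_measurable M" by (simp add: borel_eq_countable_basis[OF B])
    show "AE x in M. f x = g x"
      using AE_not_in[OF N'] by eventually_elim (simp add: g_def)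
  qed
qed

lemma measurable_completion_cong_AE:
  assumes f: "f \<in> completion M \<rightarrow>\<^sub>M N" and ae: "AE x in M. f x = g x" and g: "\<And>x. x \<in> space M \<Longrightarrow> g x \<in> space N"
  shows "g \<in> completion M \<rightarrow>\<^sub>M N"
proof (rule measurableI)
  fix U assume U: "U \<in> sets N"
  have "AE x in completion M. x \<in> f -` U \<inter> space M \<longleftrightarrow> x \<in> g -` U \<inter> space M"
    using AE_completion[OF ae] by eventually_elim auto
  from completion.in_sets_AE[OF this] measurable_sets[OF f U]
  show "g -` U \<inter> space (completion M) \<in> sets (completion M)" by simp
qed (use g in auto)

lemma sigma_finite_lebesgue: "sigma_finite_measure (lebesgue :: 'a::euclidean_space measure)"
proof
  show "\<exists>A :: 'a set set. countable A \<and> A \<subseteq> sets lebesgue \<and> \<Union> A = space lebesgue \<and> (\<forall>a\<in>A. emeasure lebesgue a \<noteq> \<infinity>)"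
  proof (intro exI conjI ballI)
    show "countable (range (\<lambda>n. cball (0 :: 'a) (real n)))" by simp
    have "x \<in> (\<Union>n. cball (0 :: 'a) (real n))" for x
      using real_arch_simple[of "norm x"] by auto
    then show "\<Union> (range (\<lambda>n. cball (0 :: 'a) (real n))) = space lebesgue" by auto
    fix a assume "a \<in> range (\<lambda>n. cball (0 :: 'a) (real n))"
    then show "emeasure lebesgue a \<noteq> \<infinity>"
      using emeasure_bounded_finite[of a] by (auto simp: less_top)
  qed auto
qed

lemma pair_sigma_finite_lborel_lebesgue:
  "pair_sigma_finite (lborel :: 'a::euclidean_space measure) (lebesgue :: 'b::euclidean_space measure)"
  using sigma_finite_lebesgue by (simp add: pair_sigma_finite_def lborel.sigma_finite_measure_axioms)

lemma measurable_matrix_vector_mult [measurable (raw)]: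
  fixes M :: "'a \<Rightarrow> real^'m^'k" and x :: "'a \<Rightarrow> real^'m"
  assumes M: "M \<in> borel_measurable N" and x: "x \<in> borel_measurable N"
  shows "(\<lambda>z. M z *v x z) \<in> borel_measurable N"
proof -
  have "continuous_on UNIV (\<lambda>z :: (real^'m^'k) \<times> (real^'m). fst z *v snd z)"
    unfolding matrix_vector_mult_def by (intro continuous_intros)
  then have "(\<lambda>z :: (real^'m^'k) \<times> (real^'m). fst z *v snd z) \<in> borel_measurable (borel \<Otimes>\<^sub>M borel)"
    unfolding borel_prod by (rule borel_measurable_continuous_onI)
  from measurable_compose[OF measurable_Pair[OF M x] this] show ?thesis by simp
qed

lemma locally_integrable_borel_measurable:
  fixes f :: "'n::finite heis \<Rightarrow> 'k::{banach, second_countable_topology}"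
  assumes "locally_integrable f"
  shows "f \<in> borel_measurable lebesgue"
proof (rule borel_measurable_LIMSEQ_metric)
  show "(\<lambda>x. indicator (cball 0 (real i)) x *\<^sub>R f x) \<in> borel_measurable lebesgue" for i
    using assms unfolding locally_integrable_def set_integrable_def
    by (intro borel_measurable_integrable) simp
  fix x :: "'n heis"
  obtain n where n: "norm x \<le> real n" using real_arch_simple by blast
  have "eventually (\<lambda>i. indicator (cball 0 (real i)) x *\<^sub>R f x = f x) sequentially"
    using eventually_ge_at_top[of n] by eventually_elim (use n in auto)
  then show "(\<lambda>i. indicator (cball 0 (real i)) x *\<^sub>R f x) \<longlonglongrightarrow> f x"
    by (rule tendsto_eventually)
qed

section \<open>Sufficiency of the logarithmic condition\<close>

text \<open>
  The estimate for a single matrix \<open>M = A(y)\<close>. The change of variables bounds the factor with \<open>f\<close> by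
  the Morrey norm on the ball of radius \<open>a r\<close>; since \<open>w(B\<^sub>a\<^sub>r) = a powr (Q + \<alpha>) * w(B\<^sub>r)\<close>, the powers of
  \<open>a\<close> combine to \<open>a powr ((Q + \<alpha>) * lam)\<close>.
\<close>

lemma morrey_commutator_fibre_bound:
  fixes f b :: "'n::finite heis \<Rightarrow> 'k::{real_normed_field, banach, second_countable_topology}"
  assumes \<alpha>: "- homdim TYPE('n) < \<alpha>" and p: "1 \<le> p" "1 \<le> p1" "1 \<le> p2" "1 / p = 1 / p1 + 1 / p2"
    and M: "quasi_dilation C a M" and r: "0 < r"
    and [measurable]: "f \<in> borel_measurable borel" "b \<in> borel_measurable borel"
    and N: "0 < N" and f: "\<And>r. 0 < r \<Longrightarrow> (\<integral>\<^sup>+x. ennreal (norm (f x) powr p1 * hnorm x powr \<alpha>) * indicator (hball 0 r) x \<partial>lborel)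
        \<le> ennreal (N powr p1 * wmeasure (\<lambda>x. hnorm x powr \<alpha>) (hball (0 :: 'n heis) r) powr (1 + p1 * lam))"
    and Y: "0 < Y" and b: "(\<integral>\<^sup>+x. ennreal (norm (b x - b (M *v x)) powr p2 * hnorm x powr \<alpha>) * indicator (hball 0 r) x \<partial>lborel)
        \<le> ennreal (Y powr p2 * wmeasure (\<lambda>x. hnorm x powr \<alpha>) (hball (0 :: 'n heis) r))"
  shows "(\<integral>\<^sup>+x. ennreal (norm (f (M *v x) * (b x - b (M *v x))) powr p * hnorm x powr \<alpha>) * indicator (hball 0 r) x \<partial>lborel)
    \<le> ennreal (2 * (C powr ((homdim TYPE('n) + \<bar>\<alpha>\<bar>) / p1) * N * (a powr ((homdim TYPE('n) + \<alpha>) * lam) * Y)) powr p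
        * wmeasure (\<lambda>x. hnorm x powr \<alpha>) (hball (0 :: 'n heis) r) powr (1 + p * lam))"
proof -
  define Q where "Q = homdim TYPE('n)"
  define W where "W r = wmeasure (\<lambda>x. hnorm x powr \<alpha>) (hball (0 :: 'n heis) r)" for r
  have W: "0 < W r" if "0 < r" for r using wmeasure_hball_pos[OF \<alpha> that] by (simp add: W_def)
  have a: "0 < a" "1 \<le> C" using M by (auto simp: quasi_dilation_def)
  have Wa: "W (a * r) = a powr (Q + \<alpha>) * W r"
    unfolding W_def Q_def using a r
    by (subst (1 2) wmeasure_hball_scale[OF \<alpha>]) (auto simp: powr_mult)
  define c where "c = C powr (Q + \<bar>\<alpha>\<bar>)"
  have c: "0 < c" using a by (simp add: c_def)
  define X where "X = c powr (1 / p1) * N * a powr ((Q + \<alpha>) * lam) * W r powr lam"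
  have X: "0 < X" using c N a W[OF r] by (simp add: X_def)
  define \<omega> where "\<omega> x = hnorm x powr \<alpha> * indicator (hball 0 r) x" for x :: "'n heis"
  have [measurable]: "\<omega> \<in> borel_measurable borel" unfolding \<omega>_def by measurable
  have \<omega>: "ennreal (t * \<omega> x) = ennreal (t * hnorm x powr \<alpha>) * indicator (hball 0 r) x" for t x
    by (simp add: \<omega>_def indicator_def)
  have "(\<integral>\<^sup>+x. ennreal (norm (f (M *v x)) powr p1 * \<omega> x) \<partial>lborel)
      \<le> ennreal (c * a powr (- (Q + \<alpha>)))
        * (\<integral>\<^sup>+x. ennreal (norm (f x) powr p1 * hnorm x powr \<alpha>) * indicator (hball 0 (a * r)) x \<partial>lborel)"
    unfolding \<omega> c_def Q_def by (rule nn_integral_quasi_dilation_weighted[OF M]) auto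
  also have "\<dots> \<le> ennreal (c * a powr (- (Q + \<alpha>))) * ennreal (N powr p1 * W (a * r) powr (1 + p1 * lam))"
    unfolding W_def using a r by (intro mult_left_mono f) auto
  also have "\<dots> = ennreal (c * a powr (- (Q + \<alpha>)) * (N powr p1 * W (a * r) powr (1 + p1 * lam)))"
    using c by (intro ennreal_mult[symmetric]) auto
  also have "c * a powr (- (Q + \<alpha>)) * (N powr p1 * W (a * r) powr (1 + p1 * lam)) = X powr p1 * W r"
  proof -
    have "W (a * r) powr (1 + p1 * lam) = a powr ((Q + \<alpha>) * (1 + p1 * lam)) * (W r * W r powr (p1 * lam))"
      using a W[OF r] by (simp add: Wa powr_mult powr_powr powr_add[of "W r"])
    moreover have "a powr (- (Q + \<alpha>)) * a powr ((Q + \<alpha>) * (1 + p1 * lam)) = a powr ((Q + \<alpha>) * lam * p1)"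
      unfolding powr_add[symmetric] by (rule arg_cong[where f="\<lambda>e. a powr e"]) (simp add: algebra_simps)
    moreover have "X powr p1 = c * N powr p1 * a powr ((Q + \<alpha>) * lam * p1) * W r powr (p1 * lam)"
      using c N a W[OF r] p(2) by (simp add: X_def powr_mult powr_powr mult.commute[of lam])
    ultimately show ?thesis by (simp add: ac_simps)
  qed
  finally have fX: "(\<integral>\<^sup>+x. ennreal (norm (f (M *v x)) powr p1 * \<omega> x) \<partial>lborel) \<le> ennreal (X powr p1 * W r)" .
  have bY: "(\<integral>\<^sup>+x. ennreal (norm (b x - b (M *v x)) powr p2 * \<omega> x) \<partial>lborel) \<le> ennreal (Y powr p2 * W r)"
    unfolding \<omega> W_def by (rule b)
  have "(\<integral>\<^sup>+x. ennreal ((norm (f (M *v x)) * norm (b x - b (M *v x))) powr p * \<omega> x) \<partial>lborel)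
      \<le> ennreal (2 * (X * Y) powr p * W r)"
    using W[OF r] X Y p by (intro nn_integral_Hoelder[OF _ _ _ _ _ _ p _ _ _ fX bY]) (auto simp: \<omega>_def)
  also have "(X * Y) powr p = (c powr (1 / p1) * N * (a powr ((Q + \<alpha>) * lam) * Y)) powr p * W r powr (p * lam)"
    using c N a Y W[OF r] by (simp add: X_def powr_mult powr_powr mult.commute[of lam])
  also have "c powr (1 / p1) = C powr ((Q + \<bar>\<alpha>\<bar>) / p1)"
    by (simp add: c_def powr_powr)
  also have "2 * ((C powr ((Q + \<bar>\<alpha>\<bar>) / p1) * N * (a powr ((Q + \<alpha>) * lam) * Y)) powr p * W r powr (p * lam)) * W r
     = 2 * (C powr ((Q + \<bar>\<alpha>\<bar>) / p1) * N * (a powr ((Q + \<alpha>) * lam) * Y)) powr p * W r powr (1 + p * lam)"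
    using W[OF r] by (simp add: powr_add)
  finally show ?thesis unfolding \<omega> by (simp add: W_def Q_def norm_mult)
qed

text \<open>
  A composition \<open>f (A y *v x)\<close> with a merely Lebesgue measurable \<open>f\<close> need not be measurable in the pair
  \<open>(x, y)\<close>, so \<open>f\<close> has to be replaced by a Borel version. For fixed \<open>y\<close> the exceptional \<open>x\<close> are the
  preimage of a null set under a quasi-dilation; Tonelli's theorem exchanges the quantifiers, which
  is possible because the null set can be enlarged to a Borel set.
\<close>

lemma AE_composition_quasi_dilation:
  fixes A :: "'n::finite heis \<Rightarrow> 'n heis_matrix" and f f' :: "'n heis \<Rightarrow> 'b"
  assumes A: "A \<in> borel_measurable lebesgue" and T: "T \<in> sets lebesgue"
    and qd: "AE y in lebesgue. y \<in> T \<longrightarrow> quasi_dilation C (a y) (A y)"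
    and eq: "AE x in lborel. f x = f' x"
  shows "AE x in lborel. AE y in lebesgue. y \<in> T \<longrightarrow> f (A y *v x) = f' (A y *v x)"
proof -
  interpret P: pair_sigma_finite "lborel :: 'n heis measure" "lebesgue :: 'n heis measure"
    by (rule pair_sigma_finite_lborel_lebesgue)
  obtain N where N: "N \<in> null_sets lborel" "{x. f x \<noteq> f' x} \<subseteq> N"
    using eq by (auto simp: eventually_ae_filter)
  then have Nb[measurable]: "N \<in> sets borel" by (auto simp: null_sets_def)
  have N_AE: "AE x in lborel. x \<notin> N" using AE_not_in[OF N(1)] .
  have [measurable]: "(\<lambda>z. A (snd z)) \<in> borel_measurable ((lborel :: 'n heis measure) \<Otimes>\<^sub>M lebesgue)"
    by (rule measurable_compose[OF measurable_snd A])
  have [measurable]: "(\<lambda>z. A (snd z) *v fst z) \<in> borel_measurable ((lborel :: 'n heis measure) \<Otimes>\<^sub>M lebesgue)"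
    by (intro measurable_matrix_vector_mult) measurable
  have [measurable]: "Measurable.pred ((lborel :: 'n heis measure) \<Otimes>\<^sub>M lebesgue) (\<lambda>z. snd z \<in> T)"
    using measurable_sets[OF measurable_snd T, of "lborel :: 'n heis measure"]
    by (auto simp: pred_def vimage_def Int_def conj_commute)
  have "AE y in lebesgue. AE x in lborel. y \<in> T \<longrightarrow> A y *v x \<notin> N"
    using qd
  proof eventually_elim
    case (elim y)
    show ?case
    proof (cases "y \<in> T")
      case True
      then have "AE x in lborel. A y *v x \<notin> N" using AE_quasi_dilation[OF _ N_AE] elim by blast
      then show ?thesis by simp
    qed simp
  qed
  moreover have "{z \<in> space (lborel \<Otimes>\<^sub>M lebesgue). snd z \<in> T \<longrightarrow> A (snd z) *v fst z \<notin> N} \<in> sets (lborel \<Otimes>\<^sub>M lebesgue)"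
    by measurable
  ultimately have "AE x in lborel. AE y in lebesgue. y \<in> T \<longrightarrow> A y *v x \<notin> N"
    by (subst P.AE_commute)
  then show ?thesis
  proof eventually_elim
    case (elim x)
    then show ?case by eventually_elim (use N(2) in auto)
  qed
qed

text \<open>
  Jensen's inequality is used in \<open>y\<close> with the density \<open>v\<close>, which is the fibre bound at \<open>y\<close> up to constants.
  After Tonelli's theorem the fibre integral of the \<open>p\<close>-th power is at most a multiple of
  \<open>v y powr p\<close>, and \<open>v y powr p * v y powr (1 - p) = v y\<close> is integrable by hypothesis. All constants
  are independent of \<open>r\<close> and of \<open>f\<close>.
\<close>

lemma hausdorff_comm_bounded_of_finite_integral:
  fixes \<Phi> :: "'n::finite heis \<Rightarrow> real" and A :: "'n heis \<Rightarrow> 'n heis_matrix"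
    and b :: "'n heis \<Rightarrow> 'k::{real_normed_field, banach, second_countable_topology}"
  assumes \<alpha>: "- homdim TYPE('n) < \<alpha>" "0 < \<alpha> \<longrightarrow> (homdim TYPE('n) + \<alpha>) / homdim TYPE('n) < p2"
    and p: "1 \<le> p" "1 \<le> p1" "1 \<le> p2" "1 / p = 1 / p1 + 1 / p2"
    and \<Phi>: "\<Phi> \<in> borel_measurable lebesgue" "\<And>y. 0 \<le> \<Phi> y"
    and A: "A \<in> borel_measurable lebesgue" and S: "S \<in> sets lebesgue" and C: "1 \<le> C"
    and qd: "AE y in lebesgue. \<Phi> y \<noteq> 0 \<longrightarrow> quasi_dilation C (enn2real (hmat_norm (A y))) (A y)"
    and b: "b \<in> cmo_space p2 (\<lambda>x. hnorm x powr \<alpha>)"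
    and fin: "(\<integral>\<^sup>+y. ennreal (size_density ((homdim TYPE('n) + \<alpha>) * lam) \<Phi> A y
        * (1 + \<bar>log 2 (enn2real (hmat_norm (A y)))\<bar>)) * indicator S y \<partial>lebesgue) < \<infinity>"
  shows "hausdorff_comm_bounded p1 p lam (\<lambda>x. hnorm x powr \<alpha>) S \<Phi> A b"
proof -
  interpret P: pair_sigma_finite "lborel :: 'n heis measure" "lebesgue :: 'n heis measure"
    by (rule pair_sigma_finite_lborel_lebesgue)
  define Q where "Q = homdim TYPE('n)"
  define s where "s = (Q + \<alpha>) * lam"
  define w where "w = (\<lambda>x :: 'n heis. hnorm x powr \<alpha>)"
  have w0: "0 \<le> w x" for x by (simp add: w_def)
  have wb[measurable]: "w \<in> borel_measurable borel" unfolding w_def by measurable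
  have wl: "w \<in> borel_measurable lebesgue" unfolding w_def by measurable
  have wi: "set_integrable lebesgue (hball 0 r) w" for r
    unfolding w_def by (rule set_integrable_hnorm_powr[OF \<alpha>(1)])
  define W where "W r = wmeasure w (hball (0 :: 'n heis) r)" for r
  have W: "0 < W r" if "0 < r" for r using wmeasure_hball_pos[OF \<alpha>(1) that] by (simp add: W_def w_def)

  define a where "a y = enn2real (hmat_norm (A y))" for y
  define \<psi> where "\<psi> y = \<Phi> y / hnorm y ^ hom_dim TYPE('n)" for y
  \<comment> \<open>On \<open>T\<close> the density \<open>v\<close> is strictly positive; up to a null set, \<open>S - T\<close> carries no mass of \<open>\<Phi>\<close>.\<close>
  define T where "T = {y \<in> S. 0 < a y \<and> \<psi> y \<noteq> 0}"
  define L where "L y = 1 + \<bar>log 2 (a y)\<bar>" for y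
  define v where "v y = indicator T y * (\<psi> y * a y powr s * L y)" for y
  note A[measurable] \<Phi>(1)[measurable] S[measurable]
  have am[measurable]: "a \<in> borel_measurable lebesgue"
    unfolding a_def using measurable_compose[OF A hmat_norm_borel] by measurable
  have hm: "hnorm \<in> borel_measurable (lebesgue :: 'n heis measure)" by (rule measurable_completion) measurable
  have \<psi>m[measurable]: "\<psi> \<in> borel_measurable lebesgue"
    unfolding \<psi>_def using hm by measurable
  have Tm[measurable]: "T \<in> sets lebesgue"
  proof -
    have "T = S \<inter> ({y \<in> space lebesgue. 0 < a y} \<inter> {y \<in> space lebesgue. \<psi> y \<noteq> 0})" by (auto simp: T_def)
    also have "\<dots> \<in> sets lebesgue" by (intro sets.Int S) measurable
    finally show ?thesis .
  qed
  have vm[measurable]: "v \<in> borel_measurable lebesgue"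
    unfolding v_def L_def by measurable
  have \<psi>0: "0 \<le> \<psi> y" for y using \<Phi>(2) by (simp add: \<psi>_def hnorm_nonneg)
  have L1: "1 \<le> L y" for y by (simp add: L_def)
  have v0: "0 \<le> v y" for y using \<psi>0[of y] L1[of y] by (simp add: v_def)
  have vT: "v y = 0 \<Longrightarrow> y \<notin> T" for y using L1[of y] by (auto simp: v_def T_def indicator_def split: if_splits)
  have qdT: "AE y in lebesgue. y \<in> T \<longrightarrow> quasi_dilation C (a y) (A y)"
    using qd by eventually_elim (auto simp: T_def \<psi>_def a_def)
  have ST: "AE y in lebesgue. y \<in> S - T \<longrightarrow> \<psi> y = 0"
    using qd by eventually_elim (auto simp: T_def \<psi>_def a_def quasi_dilation_def)

  \<comment> \<open>The summand \<open>1\<close> keeps \<open>V\<close> positive if \<open>v\<close> vanishes almost everywhere.\<close>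
  define V where "V = enn2real (\<integral>\<^sup>+y. ennreal (v y) \<partial>lebesgue) + 1"
  have V: "0 < V" "(\<integral>\<^sup>+y. ennreal (v y) \<partial>lebesgue) \<le> ennreal V"
  proof -
    have "(\<integral>\<^sup>+y. ennreal (v y) \<partial>lebesgue) \<le>
       (\<integral>\<^sup>+y. ennreal (size_density s \<Phi> A y * L y) * indicator S y \<partial>lebesgue)"
      by (intro nn_integral_mono) (auto simp: v_def size_density_def \<psi>_def a_def T_def indicator_def)
    also have "\<dots> < \<infinity>" using fin by (simp add: s_def Q_def L_def a_def)
    finally have "(\<integral>\<^sup>+y. ennreal (v y) \<partial>lebesgue) < \<infinity>" .
    then show "(\<integral>\<^sup>+y. ennreal (v y) \<partial>lebesgue) \<le> ennreal V"
      by (cases "(\<integral>\<^sup>+y. ennreal (v y) \<partial>lebesgue)" rule: ennreal_cases) (auto simp: V_def intro!: ennreal_leI)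
    show "0 < V" by (simp add: V_def add_nonneg_pos)
  qed

  have bl: "b \<in> borel_measurable lebesgue" "locally_integrable b"
    using b by (auto simp: cmo_space_def Lp_loc_def)
  obtain b' where b'[measurable]: "b' \<in> borel_measurable lborel" and bb': "AE x in lborel. b x = b' x"
    using completion_borel_version[OF bl(1)] .
  obtain K where K: "0 < K" "\<And>r. 0 < r \<Longrightarrow> (\<integral>\<^sup>+x. ennreal (norm (b x - ball_mean b r) powr p2 * w x) * indicator (hball 0 r) x \<partial>lborel)
      \<le> ennreal (K powr p2 * W r)"
    using cmo_space_ball_bound[OF b[folded w_def] wl w0 wi p(3) W[unfolded W_def]]
    unfolding W_def by blast
  obtain D where "0 < D" and D: "\<And>s r. 0 < s \<Longrightarrow> s \<le> r \<Longrightarrow> r \<le> 2 * s \<Longrightarrow> norm (ball_mean b s - ball_mean b r) \<le> D"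
    by (rule cmo_ball_mean_dyadic[OF \<alpha> p(3) bl(2,1) K[unfolded W_def w_def]]) (assumption | blast)+
  have K': "(\<integral>\<^sup>+x. ennreal (norm (b' x - ball_mean b r) powr p2 * w x) * indicator (hball 0 r) x \<partial>lborel)
      \<le> ennreal (K powr p2 * W r)" if "0 < r" for r
  proof -
    have "(\<integral>\<^sup>+x. ennreal (norm (b' x - ball_mean b r) powr p2 * w x) * indicator (hball 0 r) x \<partial>lborel)
      = (\<integral>\<^sup>+x. ennreal (norm (b x - ball_mean b r) powr p2 * w x) * indicator (hball 0 r) x \<partial>lborel)"
      by (intro nn_integral_cong_AE eventually_mono[OF bb']) simp
    then show ?thesis using K(2)[OF that] by simp
  qed
  have b'b: "b' \<in> borel_measurable borel" using b' by simp
  obtain E where E: "0 < E" "\<And>a M r. quasi_dilation C a M \<Longrightarrow> 0 < r \<Longrightarrow>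
      (\<integral>\<^sup>+x. ennreal (norm (b' x - b' (M *v x)) powr p2 * hnorm x powr \<alpha>) * indicator (hball 0 r) x \<partial>lborel)
      \<le> ennreal ((E * (1 + \<bar>log 2 a\<bar>)) powr p2 * wmeasure (\<lambda>x. hnorm x powr \<alpha>) (hball (0 :: 'n heis) r))"
    by (rule nn_integral_quasi_dilation_oscillation[OF \<alpha>(1) p(3) K(1) b'b K'[unfolded W_def w_def] D]) (assumption | blast)+

  define c where "c = C powr ((Q + \<bar>\<alpha>\<bar>) / p1)"
  have c: "0 < c" using C by (simp add: c_def)
  define C1 where "C1 = 2 * V * 2 powr (1 / p) * c * E"
  have C1: "0 < C1" using V c E by (simp add: C1_def)
  let ?H = "hausdorff_comm S \<Phi> A b"
  \<comment> \<open>A strict upper bound \<open>N\<close> for the norm is used since the norm itself may be \<open>0\<close>.\<close>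
  have main: "hausdorff_comm_defined S \<Phi> A b f \<and> ?H f \<in> morrey_space p lam w \<and> morrey_norm p lam w (?H f) \<le> C1 * N"
    if f: "f \<in> morrey_space p1 lam w" and N: "morrey_norm p1 lam w f < N" for f N
  proof -
    have N0: "0 < N" using N morrey_norm_nonneg[OF f] by simp
    have fl: "f \<in> borel_measurable lebesgue" using f by (simp add: morrey_space_def Lp_loc_def)
    obtain f' where f'[measurable]: "f' \<in> borel_measurable lborel" and ff': "AE x in lborel. f x = f' x"
      using completion_borel_version[OF fl] .
    have f'b[measurable]: "f' \<in> borel_measurable borel" using f' by simp
    have fN: "(\<integral>\<^sup>+x. ennreal (norm (f' x) powr p1 * w x) * indicator (hball 0 r) x \<partial>lborel)
        \<le> ennreal (N powr p1 * W r powr (1 + p1 * lam))" if r: "0 < r" for r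
    proof -
      have "(\<integral>\<^sup>+x. ennreal (norm (f' x) powr p1 * w x) * indicator (hball 0 r) x \<partial>lborel)
        = (\<integral>\<^sup>+x. ennreal (norm (f x) powr p1 * w x) * indicator (hball 0 r) x \<partial>lborel)"
        by (intro nn_integral_cong_AE eventually_mono[OF ff']) simp
      also have "\<dots> \<le> ennreal (morrey_norm p1 lam w f powr p1 * W r powr (1 + p1 * lam))"
        unfolding W_def using W[OF r] by (intro morrey_space_ball_bound f p w0 r) (simp add: W_def)
      also have "\<dots> \<le> ennreal (N powr p1 * W r powr (1 + p1 * lam))"
        using N morrey_norm_nonneg[OF f] p by (intro ennreal_leI mult_right_mono powr_mono2) auto
      finally show ?thesis .
    qed
    define g where "g M x = f' (M *v x) * (b' x - b' (M *v x))" for M :: "'n heis_matrix" and x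
    \<comment> \<open>\<open>k\<close> is the commutator integrand for the Borel versions \<open>f'\<close> and \<open>b'\<close>, restricted to \<open>T\<close>.\<close>
    define k where "k x y = (indicator T y * \<psi> y) *\<^sub>R g (A y) x" for x y
    have [measurable]: "(\<lambda>z. A (snd z)) \<in> borel_measurable ((lborel :: 'n heis measure) \<Otimes>\<^sub>M lebesgue)"
      by (rule measurable_compose[OF measurable_snd A])
    have gm: "(\<lambda>z. g (A (snd z)) (fst z)) \<in> borel_measurable ((lborel :: 'n heis measure) \<Otimes>\<^sub>M lebesgue)"
    proof -
      have Av: "(\<lambda>z. A (snd z) *v fst z) \<in> borel_measurable ((lborel :: 'n heis measure) \<Otimes>\<^sub>M lebesgue)"
        by (intro measurable_matrix_vector_mult) measurable
      show ?thesis
        unfolding g_def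
        by (intro borel_measurable_times borel_measurable_diff measurable_compose[OF Av f'b] measurable_compose[OF Av b'b]
            measurable_compose[OF measurable_fst b'])
    qed
    have km: "case_prod k \<in> borel_measurable ((lborel :: 'n heis measure) \<Otimes>\<^sub>M lebesgue)"
    proof -
      have "(\<lambda>z. indicator T (snd z) * \<psi> (snd z)) \<in> borel_measurable ((lborel :: 'n heis measure) \<Otimes>\<^sub>M lebesgue)"
        by (rule measurable_compose[OF measurable_snd]) measurable
      from borel_measurable_scaleR[OF this gm] show ?thesis by (simp add: k_def case_prod_beta')
    qed
    have kx: "k x \<in> borel_measurable lebesgue" for x
      using measurable_compose[OF measurable_Pair1' km, of x] by simp
    have kn: "(\<lambda>y. ennreal (norm (k x y) powr p * v y powr (1 - p))) \<in> borel_measurable lebesgue" for x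
    proof -
      note kx[of x, measurable]
      show ?thesis by measurable
    qed
    have kv: "v y = 0 \<Longrightarrow> k x y = 0" for x y using vT[of y] by (simp add: k_def)
    define I where "I x = (\<integral>\<^sup>+y. ennreal (norm (k x y) powr p * v y powr (1 - p)) \<partial>lebesgue)" for x
    have I_m[measurable]: "I \<in> borel_measurable lborel"
    proof -
      have "(\<lambda>z. norm (k (fst z) (snd z)) powr p * v (snd z) powr (1 - p)) \<in> borel_measurable ((lborel :: 'n heis measure) \<Otimes>\<^sub>M lebesgue)"
        using km measurable_compose[OF measurable_snd vm, of "lborel :: 'n heis measure"] by (simp add: case_prod_beta')
      then have "case_prod (\<lambda>x y. ennreal (norm (k x y) powr p * v y powr (1 - p))) \<in> borel_measurable ((lborel :: 'n heis measure) \<Otimes>\<^sub>M lebesgue)"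
        by (simp add: case_prod_beta')
      then show ?thesis unfolding I_def by (rule P.M2.borel_measurable_nn_integral)
    qed

    have I_bound: "(\<integral>\<^sup>+x. I x * (ennreal (w x) * indicator (hball 0 r) x) \<partial>lborel)
        \<le> ennreal (2 * (c * N * E) powr p * W r powr (1 + p * lam) * V)" if r: "0 < r" for r
    proof -
      define \<omega> where "\<omega> x = ennreal (w x) * indicator (hball 0 r) x" for x
      have [measurable]: "\<omega> \<in> borel_measurable lborel" unfolding \<omega>_def by measurable
      define F where "F x y = ennreal (norm (k x y) powr p * v y powr (1 - p)) * \<omega> x" for x y
      have Fm: "case_prod F \<in> borel_measurable ((lborel :: 'n heis measure) \<Otimes>\<^sub>M lebesgue)"
        unfolding F_def
        using km measurable_compose[OF measurable_snd vm, of "lborel :: 'n heis measure"] by (simp add: case_prod_beta')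
      have "(\<integral>\<^sup>+x. I x * \<omega> x \<partial>lborel) = (\<integral>\<^sup>+x. (\<integral>\<^sup>+y. F x y \<partial>lebesgue) \<partial>lborel)"
        unfolding I_def F_def by (intro nn_integral_cong nn_integral_multc[symmetric] kn)
      also have "\<dots> = (\<integral>\<^sup>+y. (\<integral>\<^sup>+x. F x y \<partial>lborel) \<partial>lebesgue)"
        by (rule P.Fubini'[symmetric, OF Fm])
      also have "\<dots> \<le> (\<integral>\<^sup>+y. ennreal (2 * (c * N * E) powr p * W r powr (1 + p * lam)) * ennreal (v y) \<partial>lebesgue)"
      proof (rule nn_integral_mono_AE, use qdT in eventually_elim)
        case (elim y)
        show ?case
        proof (cases "y \<in> T")
          case True
          then have qdy: "quasi_dilation C (a y) (A y)" using elim by simp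
          have y: "0 < \<psi> y" "0 < a y" using True \<psi>0[of y] by (auto simp: T_def)
          have vy: "v y = \<psi> y * a y powr s * L y" "0 < v y"
            using True y L1[of y] by (auto simp: v_def)
          let ?G = "\<integral>\<^sup>+x. ennreal (norm (g (A y) x) powr p * hnorm x powr \<alpha>) * indicator (hball 0 r) x \<partial>lborel"
          have gb: "?G \<le> ennreal (2 * (c * N * (a y powr s * (E * L y))) powr p * W r powr (1 + p * lam))"
            unfolding g_def c_def Q_def W_def w_def s_def L_def using E(1)
            by (intro morrey_commutator_fibre_bound[OF \<alpha>(1) p qdy r f'b b'b N0 _ _ E(2)[OF qdy r]]
                fN[unfolded W_def w_def]) (auto intro!: mult_pos_pos add_pos_nonneg)
          have [measurable]: "g (A y) \<in> borel_measurable borel"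
            unfolding g_def using b'b by measurable
          have "(\<integral>\<^sup>+x. F x y \<partial>lborel) = (\<integral>\<^sup>+x. ennreal (\<psi> y powr p * v y powr (1 - p)) *
              (ennreal (norm (g (A y) x) powr p * hnorm x powr \<alpha>) * indicator (hball 0 r) x) \<partial>lborel)"
            using True y
            by (intro nn_integral_cong)
              (simp add: F_def k_def \<omega>_def w_def indicator_def powr_mult ennreal_mult[symmetric] ac_simps)
          also have "\<dots> = ennreal (\<psi> y powr p * v y powr (1 - p)) * ?G"
            by (rule nn_integral_cmult) measurable
          also have "\<dots> \<le> ennreal (\<psi> y powr p * v y powr (1 - p))
              * ennreal (2 * (c * N * (a y powr s * (E * L y))) powr p * W r powr (1 + p * lam))"
            by (intro mult_left_mono gb) simp
          also have "\<dots> = ennreal (\<psi> y powr p * v y powr (1 - p)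
              * (2 * (c * N * (a y powr s * (E * L y))) powr p * W r powr (1 + p * lam)))"
            by (intro ennreal_mult[symmetric]) auto
          also have "\<psi> y powr p * v y powr (1 - p) * (2 * (c * N * (a y powr s * (E * L y))) powr p * W r powr (1 + p * lam))
              = 2 * (c * N * E) powr p * W r powr (1 + p * lam) * (v y powr (1 - p) * (\<psi> y * a y powr s * L y) powr p)"
            using y c N0 E(1) L1[of y] by (simp add: powr_mult ac_simps)
          also have "v y powr (1 - p) * (\<psi> y * a y powr s * L y) powr p = v y"
            unfolding vy(1)[symmetric] using vy(2) by (simp add: powr_add[symmetric])
          also have "ennreal (2 * (c * N * E) powr p * W r powr (1 + p * lam) * v y)
              = ennreal (2 * (c * N * E) powr p * W r powr (1 + p * lam)) * ennreal (v y)"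
            using v0 by (intro ennreal_mult) auto
          finally show ?thesis .
        next
          case False
          then show ?thesis by (simp add: F_def k_def)
        qed
      qed
      also have "\<dots> = ennreal (2 * (c * N * E) powr p * W r powr (1 + p * lam)) * (\<integral>\<^sup>+y. ennreal (v y) \<partial>lebesgue)"
        by (rule nn_integral_cmult) measurable
      also have "\<dots> \<le> ennreal (2 * (c * N * E) powr p * W r powr (1 + p * lam)) * ennreal V"
        by (intro mult_left_mono V) simp
      also have "\<dots> = ennreal (2 * (c * N * E) powr p * W r powr (1 + p * lam) * V)"
        using V by (intro ennreal_mult[symmetric]) auto
      finally show ?thesis by (simp add: \<omega>_def)
    qed

    \<comment> \<open>The weighted integral of \<open>I\<close> is finite on each ball of a countable exhaustion, and the weight vanishes
      at most at the origin.\<close>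
    have I_fin: "AE x in lborel. I x < \<infinity>"
    proof -
      have "AE x in lborel. I x * (ennreal (w x) * indicator (hball 0 (real (Suc n))) x) \<noteq> \<infinity>" for n
      proof (rule nn_integral_PInf_AE)
        have "(\<integral>\<^sup>+x. I x * (ennreal (w x) * indicator (hball 0 (real (Suc n))) x) \<partial>lborel)
          \<le> ennreal (2 * (c * N * E) powr p * W (real (Suc n)) powr (1 + p * lam) * V)"
          by (rule I_bound) simp
        also have "\<dots> < \<infinity>" by simp
        finally show "(\<integral>\<^sup>+x. I x * (ennreal (w x) * indicator (hball 0 (real (Suc n))) x) \<partial>lborel) \<noteq> \<infinity>" by simp
      qed measurable
      then have "AE x in lborel. \<forall>n. I x * (ennreal (w x) * indicator (hball 0 (real (Suc n))) x) \<noteq> \<infinity>"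
        by (simp add: AE_all_countable)
      then show ?thesis
        using AE_lborel_nonzero
      proof eventually_elim
        case (elim x)
        obtain n where "hnorm x \<le> real n" using real_arch_simple by blast
        then have "x \<in> hball 0 (real (Suc n))" by (simp add: hball_zero)
        moreover have "ennreal (w x) \<noteq> 0" using elim by (simp add: w_def ennreal_eq_0_iff)
        ultimately show ?case using elim(1)[rule_format, of n]
          by (auto simp: ennreal_mult_eq_top_iff less_top)
      qed
    qed
    have J: "integrable lebesgue (k x)" "ennreal (norm (LINT y|lebesgue. k x y) powr p) \<le> ennreal (2 powr p * V powr (p - 1)) * I x"
      if Ix: "I x < \<infinity>" for x
    proof -
      obtain i where i: "I x = ennreal i" "0 \<le> i" using Ix by (cases "I x" rule: ennreal_cases) auto
      note B = norm_integral_powr_le[OF kx vm v0 kv p(1) V i(1)[unfolded I_def] i(2)]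
      show "integrable lebesgue (k x)" by (rule B(1))
      show "ennreal (norm (LINT y|lebesgue. k x y) powr p) \<le> ennreal (2 powr p * V powr (p - 1)) * I x"
        using ennreal_leI[OF B(2)] i by (simp add: ennreal_mult)
    qed

    have eqk: "AE x in lborel. AE y in lebesgue. k x y = indicator S y *\<^sub>R comm_integrand \<Phi> A b f x y"
      using AE_composition_quasi_dilation[OF A Tm qdT ff'] AE_composition_quasi_dilation[OF A Tm qdT bb'] bb'
    proof eventually_elim
      case (elim x)
      from elim(1,2) ST show ?case
      proof eventually_elim
        case (elim y)
        show ?case
        proof (cases "y \<in> T")
          case True
          then have "y \<in> S" by (simp add: T_def)
          then show ?thesis using True elim \<open>b x = b' x\<close> by (simp add: k_def g_def comm_integrand_def \<psi>_def)
        next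
          case False
          then show ?thesis using elim by (auto simp: k_def comm_integrand_def \<psi>_def[symmetric] indicator_def)
        qed
      qed
    qed
    have transfer: "AE x in lborel. set_integrable lebesgue S (comm_integrand \<Phi> A b f x) \<and> (LINT y|lebesgue. k x y) = ?H f x
        \<and> ennreal (norm (?H f x) powr p) \<le> ennreal (2 powr p * V powr (p - 1)) * I x"
      using eqk I_fin
    proof eventually_elim
      case (elim x)
      have m: "(\<lambda>y. indicator S y *\<^sub>R comm_integrand \<Phi> A b f x y) \<in> borel_measurable lebesgue"
        by (rule measurable_completion_cong_AE[OF kx]) (use elim(1) in \<open>simp_all add: AE_completion_iff\<close>)
      have "set_integrable lebesgue S (comm_integrand \<Phi> A b f x)"
        unfolding set_integrable_def by (rule integrable_cong_AE_imp[OF J(1)[OF elim(2)] m elim(1)])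
      moreover have "(LINT y|lebesgue. k x y) = ?H f x"
        unfolding hausdorff_comm_def set_lebesgue_integral_def by (rule integral_cong_AE[OF kx m elim(1)])
      ultimately show ?case using J(2)[OF elim(2)] by simp
    qed
    have "hausdorff_comm_defined S \<Phi> A b f"
      unfolding hausdorff_comm_defined_def AE_completion_iff using transfer by eventually_elim simp
    moreover have Hm: "?H f \<in> borel_measurable lebesgue"
    proof (rule measurable_completion_cong_AE)
      show "(\<lambda>x. LINT y|lebesgue. k x y) \<in> borel_measurable lebesgue"
        using P.M2.borel_measurable_lebesgue_integral[OF km] by (rule measurable_completion)
      show "AE x in lborel. (LINT y|lebesgue. k x y) = ?H f x" using transfer by eventually_elim simp
    qed simp
    moreover have Hb: "(\<integral>\<^sup>+x. ennreal (norm (?H f x) powr p * w x) * indicator (hball 0 r) x \<partial>lborel)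
        \<le> ennreal ((C1 * N) powr p * W r powr (1 + p * lam))" if r: "0 < r" for r
    proof -
      have "(\<integral>\<^sup>+x. ennreal (norm (?H f x) powr p * w x) * indicator (hball 0 r) x \<partial>lborel)
        \<le> (\<integral>\<^sup>+x. ennreal (2 powr p * V powr (p - 1)) * (I x * (ennreal (w x) * indicator (hball 0 r) x)) \<partial>lborel)"
      proof (rule nn_integral_mono_AE, use transfer in eventually_elim)
        case (elim x)
        have "ennreal (norm (?H f x) powr p * w x) * indicator (hball 0 r) x
            = ennreal (norm (?H f x) powr p) * (ennreal (w x) * indicator (hball 0 r) x)"
          using w0 by (simp add: ennreal_mult mult.assoc)
        also have "\<dots> \<le> (ennreal (2 powr p * V powr (p - 1)) * I x) * (ennreal (w x) * indicator (hball 0 r) x)"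
          using elim by (intro mult_right_mono) auto
        finally show ?case by (simp add: mult.assoc)
      qed
      also have "\<dots> = ennreal (2 powr p * V powr (p - 1)) * (\<integral>\<^sup>+x. I x * (ennreal (w x) * indicator (hball 0 r) x) \<partial>lborel)"
        by (rule nn_integral_cmult) measurable
      also have "\<dots> \<le> ennreal (2 powr p * V powr (p - 1)) * ennreal (2 * (c * N * E) powr p * W r powr (1 + p * lam) * V)"
        by (intro mult_left_mono I_bound r) simp
      also have "\<dots> = ennreal (2 powr p * V powr (p - 1) * (2 * (c * N * E) powr p * W r powr (1 + p * lam) * V))"
        using V by (intro ennreal_mult[symmetric]) auto
      also have "2 powr p * V powr (p - 1) * (2 * (c * N * E) powr p * W r powr (1 + p * lam) * V)
          = (C1 * N) powr p * W r powr (1 + p * lam)"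
      proof -
        have "V powr p = V powr (p - 1) * V" using V(1) by (simp add: powr_diff)
        moreover have "(2 powr (1 / p)) powr p = (2 :: real)" using p(1) by (simp add: powr_powr)
        ultimately have "(C1 * N) powr p = 2 powr p * (V powr (p - 1) * V) * 2 * c powr p * E powr p * N powr p"
          using V(1) c E(1) N0 by (simp add: C1_def powr_mult)
        then show ?thesis using c E(1) N0 by (simp add: powr_mult)
      qed
      finally show ?thesis .
    qed
    moreover note morrey_spaceI[OF Hm wl w0 p(1) _ W[unfolded W_def] Hb[unfolded W_def]]
    ultimately show ?thesis using C1 N0 by simp
  qed
  show ?thesis
    unfolding hausdorff_comm_bounded_def w_def[symmetric]
  proof (intro exI[of _ C1] ballI conjI)
    fix f :: "'n heis \<Rightarrow> 'k" assume f: "f \<in> morrey_space p1 lam w"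
    let ?m = "morrey_norm p1 lam w f"
    show "hausdorff_comm_defined S \<Phi> A b f" "?H f \<in> morrey_space p lam w"
      using main[OF f, of "?m + 1"] by auto
    show "morrey_norm p lam w (?H f) \<le> C1 * ?m"
    proof (rule field_le_epsilon)
      fix e :: real assume "0 < e"
      then have "morrey_norm p lam w (?H f) \<le> C1 * (?m + e / C1)"
        using main[OF f, of "?m + e / C1"] C1 by simp
      then show "morrey_norm p lam w (?H f) \<le> C1 * ?m + e" using C1 by (simp add: distrib_left)
    qed
  qed
qed

section \<open>Necessity of the logarithmic condition\<close>

text \<open>
  The exponent is chosen such that the Morrey quotient does not depend on \<open>r\<close>; the lower bound on \<open>lam\<close>
  makes \<open>f powr p\<close> times the weight integrable at the origin.
\<close>

lemma hnorm_powr_in_morrey_space: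
  fixes \<alpha> lam p :: real
  assumes \<alpha>: "- homdim TYPE('n::finite) < \<alpha>" and p: "1 \<le> p" and lam: "- 1 / p < lam"
  shows "(\<lambda>x :: 'n heis. of_real (hnorm x powr ((homdim TYPE('n) + \<alpha>) * lam)) :: 'k::{real_normed_field, banach, second_countable_topology})
    \<in> morrey_space p lam (\<lambda>x. hnorm x powr \<alpha>)" (is "?f \<in> _")
proof -
  define Q where "Q = homdim TYPE('n)"
  define s where "s = (Q + \<alpha>) * lam"
  define \<beta> where "\<beta> = s * p + \<alpha>"
  have lp: "0 < 1 + p * lam" using lam p by (simp add: field_simps)
  have e: "Q + \<beta> = (Q + \<alpha>) * (1 + p * lam)" by (simp add: \<beta>_def s_def algebra_simps)
  have "0 < Q + \<alpha>" using \<alpha> by (simp add: Q_def)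
  then have "0 < Q + \<beta>" unfolding e using lp by simp
  then have \<beta>: "- homdim TYPE('n) < \<beta>" by (simp add: Q_def)
  define c where "c \<gamma> = wmeasure (\<lambda>x. hnorm x powr \<gamma>) (hball (0 :: 'n heis) 1)" for \<gamma>
  have c: "0 < c \<alpha>" "0 < c \<beta>" using \<alpha> \<beta> by (auto simp: c_def intro!: wmeasure_hball_pos)
  define N where "N = (c \<beta> / c \<alpha> powr (1 + p * lam)) powr (1 / p)"
  show ?thesis
  proof (rule morrey_spaceI(1)[where N = N])
    show "?f \<in> borel_measurable lebesgue"
      by (intro measurable_completion borel_measurable_of_real) measurable
    fix r :: real assume r: "0 < r"
    have "(\<integral>\<^sup>+x. ennreal (norm (?f x) powr p * hnorm x powr \<alpha>) * indicator (hball 0 r) x \<partial>lborel)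
      = (\<integral>\<^sup>+x. ennreal (hnorm x powr \<beta>) * indicator (hball (0 :: 'n heis) r) x \<partial>lborel)"
      by (intro nn_integral_cong) (simp add: powr_powr powr_add \<beta>_def s_def Q_def)
    also have "\<dots> = ennreal (r powr (Q + \<beta>) * c \<beta>)"
      unfolding ennreal_wmeasure_hball[OF \<beta>, symmetric] wmeasure_hball_scale[OF \<beta> r] by (simp add: Q_def c_def)
    also have "r powr (Q + \<beta>) * c \<beta> = N powr p * (r powr (Q + \<alpha>) * c \<alpha>) powr (1 + p * lam)"
      unfolding e using r c p by (simp add: N_def powr_mult powr_powr)
    finally show "(\<integral>\<^sup>+x. ennreal (norm (?f x) powr p * hnorm x powr \<alpha>) * indicator (hball 0 r) x \<partial>lborel)
      \<le> ennreal (N powr p * wmeasure (\<lambda>x. hnorm x powr \<alpha>) (hball (0 :: 'n heis) r) powr (1 + p * lam))"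
      unfolding wmeasure_hball_scale[OF \<alpha> r] by (simp add: Q_def c_def)
  qed (use \<alpha> p in \<open>auto simp: N_def intro!: wmeasure_hball_pos\<close>)
qed

text \<open>
  The logarithm grows more slowly than any power, at infinity and at the origin.
\<close>

lemma abs_ln_powr_le:
  fixes t q e :: real
  assumes t: "0 < t" and q: "0 < q" and e: "0 < e"
  shows "\<bar>ln t\<bar> powr q \<le> (q / e) powr q * (t powr e + t powr (- e))"
proof -
  have *: "(ln u) powr q \<le> (q / e) powr q * u powr e" if "1 \<le> u" for u
  proof -
    have "ln u \<le> u powr (e / q) / (e / q)" using that e q by (intro ln_powr_bound) auto
    then have "(ln u) powr q \<le> (u powr (e / q) * (q / e)) powr q"
      using that q by (intro powr_mono2) auto
    also have "\<dots> = (q / e) powr q * u powr e" using that q e by (subst powr_mult) (auto simp: powr_powr)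
    finally show ?thesis .
  qed
  show ?thesis
  proof (cases "1 \<le> t")
    case True
    then have "\<bar>ln t\<bar> powr q \<le> (q / e) powr q * t powr e" using *[of t] by simp
    also have "\<dots> \<le> (q / e) powr q * (t powr e + t powr (- e))" by (intro mult_left_mono) auto
    finally show ?thesis .
  next
    case False
    then have "\<bar>ln t\<bar> powr q \<le> (q / e) powr q * (1 / t) powr e"
      using *[of "1 / t"] t by (simp add: ln_div)
    also have "(1 / t) powr e = t powr (- e)" using t by (simp add: powr_divide powr_minus_divide)
    also have "(q / e) powr q * t powr (- e) \<le> (q / e) powr q * (t powr e + t powr (- e))"
      by (intro mult_left_mono) auto
    finally show ?thesis .
  qed
qed

text \<open>
  The singularity of the logarithm is absorbed by an arbitrarily small power of the norm, and
  \<open>\<beta> - e\<close> still exceeds \<open>- Q\<close> for \<open>e\<close> half of the gap.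
\<close>

lemma nn_integral_ln_hnorm_finite:
  assumes \<beta>: "- homdim TYPE('n::finite) < \<beta>" and q: "0 < q"
  shows "(\<integral>\<^sup>+x. ennreal (\<bar>ln (hnorm x)\<bar> powr q * hnorm x powr \<beta>) * indicator (hball (0 :: 'n heis) r) x \<partial>lborel) < \<infinity>"
proof -
  define e where "e = (\<beta> + homdim TYPE('n)) / 2"
  have e: "0 < e" "- homdim TYPE('n) < \<beta> + e" "- homdim TYPE('n) < \<beta> - e"
    using \<beta> by (auto simp: e_def field_simps)
  let ?c = "(q / e) powr q"
  let ?I = "\<lambda>\<gamma>. \<integral>\<^sup>+x. ennreal (hnorm x powr \<gamma>) * indicator (hball (0 :: 'n heis) r) x \<partial>lborel"
  have "(\<integral>\<^sup>+x. ennreal (\<bar>ln (hnorm x)\<bar> powr q * hnorm x powr \<beta>) * indicator (hball (0 :: 'n heis) r) x \<partial>lborel)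
    \<le> (\<integral>\<^sup>+x. ennreal ?c * (ennreal (hnorm x powr (\<beta> + e)) * indicator (hball (0 :: 'n heis) r) x
        + ennreal (hnorm x powr (\<beta> - e)) * indicator (hball (0 :: 'n heis) r) x) \<partial>lborel)"
  proof (intro nn_integral_mono)
    fix x :: "'n heis"
    have "\<bar>ln (hnorm x)\<bar> powr q * hnorm x powr \<beta> \<le> ?c * (hnorm x powr (\<beta> + e) + hnorm x powr (\<beta> - e))"
    proof (cases "x = 0")
      case False
      then have "\<bar>ln (hnorm x)\<bar> powr q * hnorm x powr \<beta> \<le> ?c * (hnorm x powr e + hnorm x powr (- e)) * hnorm x powr \<beta>"
        using q e by (intro mult_right_mono abs_ln_powr_le) (auto simp: hnorm_pos_iff)
      then show ?thesis by (simp add: powr_add powr_diff powr_minus field_simps)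
    qed simp
    then have "ennreal (\<bar>ln (hnorm x)\<bar> powr q * hnorm x powr \<beta>) \<le> ennreal ?c * (ennreal (hnorm x powr (\<beta> + e)) + ennreal (hnorm x powr (\<beta> - e)))"
      by (simp add: ennreal_mult[symmetric] ennreal_plus[symmetric] ennreal_leI del: ennreal_plus)
    then show "ennreal (\<bar>ln (hnorm x)\<bar> powr q * hnorm x powr \<beta>) * indicator (hball 0 r) x
        \<le> ennreal ?c * (ennreal (hnorm x powr (\<beta> + e)) * indicator (hball (0 :: 'n heis) r) x
        + ennreal (hnorm x powr (\<beta> - e)) * indicator (hball (0 :: 'n heis) r) x)"
      by (simp add: indicator_def)
  qed
  also have "\<dots> = ennreal ?c * (?I (\<beta> + e) + ?I (\<beta> - e))"
    by (simp add: nn_integral_cmult nn_integral_add)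
  also have "\<dots> < \<infinity>"
    using nn_integral_hnorm_powr_finite[OF e(2), of r] nn_integral_hnorm_powr_finite[OF e(3), of r]
    by (simp add: ennreal_mult_less_top)
  finally show ?thesis .
qed

text \<open>
  Under the dilation by \<open>r\<close> the function \<open>ln |x|\<close> changes only by the constant \<open>ln r\<close>.
\<close>

lemma nn_integral_ln_hnorm_scale:
  assumes r: "0 < r"
  shows "(\<integral>\<^sup>+x. ennreal (\<bar>ln (hnorm x) - ln r\<bar> powr q * hnorm x powr \<beta>) * indicator (hball (0 :: 'n::finite heis) r) x \<partial>lborel)
    = ennreal (r powr (homdim TYPE('n) + \<beta>)) *
      (\<integral>\<^sup>+x. ennreal (\<bar>ln (hnorm x)\<bar> powr q * hnorm x powr \<beta>) * indicator (hball (0 :: 'n heis) 1) x \<partial>lborel)"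
proof -
  let ?g = "\<lambda>x :: 'n heis. ennreal (\<bar>ln (hnorm x) - ln r\<bar> powr q * hnorm x powr \<beta>) * indicator (hball 0 r) x"
  let ?h = "\<lambda>x :: 'n heis. ennreal (\<bar>ln (hnorm x)\<bar> powr q * hnorm x powr \<beta>) * indicator (hball 0 1) x"
  have "?g (dil r x) = ennreal (r powr \<beta>) * ?h x" for x
  proof (cases "x = 0")
    case True
    then show ?thesis using hnorm_dil[of r x] r by simp
  next
    case False
    then show ?thesis
      using r by (auto simp: hnorm_dil hball_zero indicator_def powr_mult hnorm_nonneg ln_mult hnorm_pos_iff
          ennreal_mult[symmetric] ac_simps)
  qed
  then have "(\<integral>\<^sup>+x. ?g x \<partial>lborel) = ennreal (r ^ hom_dim TYPE('n)) * (\<integral>\<^sup>+x. ennreal (r powr \<beta>) * ?h x \<partial>lborel)"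
    by (subst nn_integral_dil[OF r]) simp_all
  also have "(\<integral>\<^sup>+x. ennreal (r powr \<beta>) * ?h x \<partial>lborel) = ennreal (r powr \<beta>) * (\<integral>\<^sup>+x. ?h x \<partial>lborel)"
    by (rule nn_integral_cmult) measurable
  also have "ennreal (r ^ hom_dim TYPE('n)) * (ennreal (r powr \<beta>) * (\<integral>\<^sup>+x. ?h x \<partial>lborel))
      = ennreal (r powr (homdim TYPE('n) + \<beta>)) * (\<integral>\<^sup>+x. ?h x \<partial>lborel)"
    using r by (simp add: powr_add powr_realpow ennreal_mult mult.assoc)
  finally show ?thesis .
qed

text \<open>
  By scaling, the oscillation of \<open>ln |x|\<close> about the constant \<open>ln r\<close> on \<open>B\<^sub>r\<close> is independent of \<open>r\<close>, both in the
  weighted and in the unweighted mean. The unweighted one bounds the distance of the actual mean from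
  \<open>ln r\<close>.
\<close>

lemma ln_hnorm_in_cmo_space:
  fixes \<alpha> p :: real
  assumes \<alpha>: "- homdim TYPE('n::finite) < \<alpha>" and p: "1 \<le> p"
  shows "(\<lambda>x :: 'n heis. of_real (ln (hnorm x)) :: 'k::{real_normed_field, banach, second_countable_topology})
    \<in> cmo_space p (\<lambda>x. hnorm x powr \<alpha>)" (is "?b \<in> cmo_space p ?w")
proof -
  define Q where "Q = homdim TYPE('n)"
  have Q: "- homdim TYPE('n) < 0" by (simp add: hom_dim_def)
  define c where "c = wmeasure ?w (hball (0 :: 'n heis) 1)"
  have c: "0 < c" using \<alpha> by (auto simp: c_def intro!: wmeasure_hball_pos)
  define c0 where "c0 = measure lborel (hball (0 :: 'n heis) 1)"
  have c0: "0 < c0" using measure_hball_unit_pos by (simp add: c0_def)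
  define G where "G q \<beta> = enn2real (\<integral>\<^sup>+x. ennreal (\<bar>ln (hnorm x)\<bar> powr q * hnorm x powr \<beta>) * indicator (hball (0 :: 'n heis) 1) x \<partial>lborel)" for q \<beta>
  have G0: "0 \<le> G q \<beta>" for q \<beta> by (simp add: G_def)
  have G: "(\<integral>\<^sup>+x. ennreal (\<bar>ln (hnorm x) - ln r\<bar> powr q * hnorm x powr \<beta>) * indicator (hball (0 :: 'n heis) r) x \<partial>lborel)
      = ennreal (r powr (Q + \<beta>) * G q \<beta>)" if "0 < r" "0 < q" "- homdim TYPE('n) < \<beta>" for r q \<beta>
    using nn_integral_ln_hnorm_finite[OF that(3,2), of 1]
    unfolding nn_integral_ln_hnorm_scale[OF that(1)] G_def Q_def by (simp add: ennreal_mult)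
  have bm: "?b \<in> borel_measurable lebesgue"
    by (intro measurable_completion borel_measurable_of_real) measurable
  have bL: "?b \<in> Lp_loc p ?w"
  proof (rule Lp_locI[OF bm])
    fix r :: real
    show "(\<integral>\<^sup>+x. ennreal (norm (?b x) powr p * ?w x) * indicator (hball 0 r) x \<partial>lborel) < \<infinity>"
      using nn_integral_ln_hnorm_finite[OF \<alpha>, of p r] p by simp
  qed auto
  have bi: "locally_integrable ?b"
    unfolding locally_integrable_def
  proof (intro allI impI)
    fix K :: "'n heis set" assume K: "compact K"
    then obtain r where r: "0 < r" "K \<subseteq> hball 0 r" by (rule compact_subset_hball)
    have "(\<integral>\<^sup>+x. ennreal (norm (?b x)) * indicator (hball 0 r) x \<partial>lborel)
      = (\<integral>\<^sup>+x. ennreal (\<bar>ln (hnorm x)\<bar> powr 1 * hnorm x powr 0) * indicator (hball (0 :: 'n heis) r) x \<partial>lborel)"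
      by (intro nn_integral_cong) auto
    also have "\<dots> < \<infinity>" by (rule nn_integral_ln_hnorm_finite[OF Q]) simp
    finally have "set_integrable lebesgue (hball 0 r) ?b"
      unfolding set_integrable_iff_nn_integral_finite[OF bm hball_lebesgue] .
    then show "set_integrable lebesgue K ?b"
      using r sets_completionI_sets[of K lborel] borel_compact[OF K] by (elim set_integrable_subset) auto
  qed
  have mean: "norm (ball_mean ?b r - of_real (ln r)) \<le> G 1 0 / c0" if r: "0 < r" for r
  proof -
    have "(\<integral>\<^sup>+x. ennreal (norm (?b x - of_real (ln r))) * indicator (hball 0 r) x \<partial>lborel)
      = (\<integral>\<^sup>+x. ennreal (\<bar>ln (hnorm x) - ln r\<bar> powr 1 * hnorm x powr 0) * indicator (hball (0 :: 'n heis) r) x \<partial>lborel)"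
      by (intro nn_integral_cong_AE eventually_mono[OF AE_lborel_nonzero])
        (simp add: of_real_diff[symmetric] del: of_real_diff)
    also have "\<dots> = ennreal (r powr (Q + 0) * G 1 0)" by (rule G[OF r _ Q]) simp
    finally have "norm (ball_mean (\<lambda>x. ?b x - of_real (ln r)) r) \<le> r powr Q * G 1 0 / (r powr homdim TYPE('n) * measure lborel (hball (0 :: 'n heis) 1))"
      using bm r G0 by (intro norm_ball_mean_le) auto
    then show ?thesis using r by (simp add: ball_mean_diff_const[OF bi r] Q_def c0_def)
  qed
  \<comment> \<open>The first summand is the oscillation about \<open>ln r\<close>, the second the distance of the mean from \<open>ln r\<close>.\<close>
  define K where "K = (3 powr p * (G p \<alpha> / c + (G 1 0 / c0) powr p)) powr (1 / p)"
  show ?thesis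
  proof (rule cmo_spaceI[OF bL bi _ _ _ p, where K=K])
    fix r :: real assume r: "0 < r"
    let ?m = "ball_mean ?b r"
    have W: "wmeasure ?w (hball (0 :: 'n heis) r) = r powr (Q + \<alpha>) * c"
      unfolding wmeasure_hball_scale[OF \<alpha> r] by (simp add: Q_def c_def)
    let ?f1 = "\<lambda>x :: 'n heis. ennreal (\<bar>ln (hnorm x) - ln r\<bar> powr p * hnorm x powr \<alpha>) * indicator (hball 0 r) x"
    let ?f2 = "\<lambda>x :: 'n heis. ennreal (hnorm x powr \<alpha>) * indicator (hball 0 r) x"
    have "(\<integral>\<^sup>+x. ennreal (norm (?b x - ?m) powr p * ?w x) * indicator (hball 0 r) x \<partial>lborel)
      \<le> (\<integral>\<^sup>+x. ennreal (3 powr p) * (?f1 x + ennreal ((G 1 0 / c0) powr p) * ?f2 x) \<partial>lborel)"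
    proof (intro nn_integral_mono)
      fix x :: "'n heis"
      have "norm (?b x - ?m) powr p = norm ((?b x - of_real (ln r)) - (?m - of_real (ln r))) powr p" by simp
      also have "\<dots> \<le> 3 powr p * (norm (?b x - of_real (ln r)) powr p + norm (?m - of_real (ln r)) powr p)"
        using p by (intro powr_norm_diff_le) simp
      also have "\<dots> \<le> 3 powr p * (\<bar>ln (hnorm x) - ln r\<bar> powr p + (G 1 0 / c0) powr p)"
        using p mean[OF r] by (intro mult_left_mono add_mono powr_mono2)
          (auto simp: of_real_diff[symmetric] simp del: of_real_diff)
      finally have "norm (?b x - ?m) powr p * ?w x \<le> 3 powr p * (\<bar>ln (hnorm x) - ln r\<bar> powr p + (G 1 0 / c0) powr p) * ?w x"
        by (rule mult_right_mono) simp
      then have "ennreal (norm (?b x - ?m) powr p * ?w x) \<le> ennreal (3 powr p) * (ennreal (\<bar>ln (hnorm x) - ln r\<bar> powr p * ?w x) + ennreal ((G 1 0 / c0) powr p) * ennreal (?w x))"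
        by (simp add: ennreal_mult[symmetric] ennreal_plus[symmetric] ennreal_leI algebra_simps del: ennreal_plus)
      then show "ennreal (norm (?b x - ?m) powr p * ?w x) * indicator (hball 0 r) x \<le> ennreal (3 powr p) * (?f1 x + ennreal ((G 1 0 / c0) powr p) * ?f2 x)"
        by (simp add: indicator_def)
    qed
    also have "\<dots> = ennreal (3 powr p) * ((\<integral>\<^sup>+x. ?f1 x \<partial>lborel) + ennreal ((G 1 0 / c0) powr p) * (\<integral>\<^sup>+x. ?f2 x \<partial>lborel))"
      by (simp add: nn_integral_cmult nn_integral_add)
    also have "(\<integral>\<^sup>+x. ?f1 x \<partial>lborel) = ennreal (r powr (Q + \<alpha>) * G p \<alpha>)" using p by (intro G r \<alpha>) simp
    also have "(\<integral>\<^sup>+x. ?f2 x \<partial>lborel) = ennreal (r powr (Q + \<alpha>) * c)"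
      unfolding ennreal_wmeasure_hball[OF \<alpha>, symmetric] W ..
    also have "ennreal (3 powr p) * (ennreal (r powr (Q + \<alpha>) * G p \<alpha>) + ennreal ((G 1 0 / c0) powr p) * ennreal (r powr (Q + \<alpha>) * c))
        = ennreal (3 powr p * (r powr (Q + \<alpha>) * G p \<alpha> + (G 1 0 / c0) powr p * (r powr (Q + \<alpha>) * c)))"
      using G0 c by (simp add: ennreal_mult[symmetric] ennreal_plus[symmetric] del: ennreal_plus)
    also have "3 powr p * (r powr (Q + \<alpha>) * G p \<alpha> + (G 1 0 / c0) powr p * (r powr (Q + \<alpha>) * c))
        = K powr p * (r powr (Q + \<alpha>) * c)"
    proof -
      have Kp: "K powr p = 3 powr p * (G p \<alpha> / c + (G 1 0 / c0) powr p)"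
        using p c G0 by (simp add: K_def powr_powr)
      show ?thesis unfolding Kp using c by (simp add: field_simps)
    qed
    finally show "(\<integral>\<^sup>+x. ennreal (norm (?b x - ?m) powr p * ?w x) * indicator (hball 0 r) x \<partial>lborel)
        \<le> ennreal (K powr p * wmeasure ?w (hball 0 r))"
      unfolding W by simp
  qed (use \<alpha> in \<open>auto simp: K_def intro!: wmeasure_hball_pos set_integrable_hnorm_powr\<close>)
qed

text \<open>
  At one point \<open>x \<noteq> 0\<close> the commutator integrand for the two test functions is absolutely integrable.
  It dominates a multiple of \<open>\<bar>log 2 a\<bar> - log 2 C\<close> times the size density, and the size density
  itself is integrable.
\<close>

lemma log_size_integral_finite:
  fixes \<Phi> :: "'n::finite heis \<Rightarrow> real" and A :: "'n heis \<Rightarrow> 'n heis_matrix"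
  assumes s: "s \<le> 0" and C: "1 \<le> C"
    and \<Phi>: "\<Phi> \<in> borel_measurable lebesgue" "\<And>y. 0 \<le> \<Phi> y"
    and A: "A \<in> borel_measurable lebesgue"
    and qd: "AE y in lebesgue. \<Phi> y \<noteq> 0 \<longrightarrow> quasi_dilation C (enn2real (hmat_norm (A y))) (A y)"
    and fin: "(\<integral>\<^sup>+y. ennreal (size_density s \<Phi> A y) \<partial>lebesgue) < \<infinity>"
    and defd: "hausdorff_comm_defined S \<Phi> A
       (\<lambda>x. of_real (ln (hnorm x)) :: 'k::{real_normed_field, banach, second_countable_topology})
       (\<lambda>x. of_real (hnorm x powr s))"
  shows "(\<integral>\<^sup>+y. ennreal (size_density s \<Phi> A y * \<bar>log 2 (enn2real (hmat_norm (A y)))\<bar>) * indicator S y \<partial>lebesgue) < \<infinity>"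
proof -
  define a where "a y = enn2real (hmat_norm (A y))" for y
  define \<psi> where "\<psi> y = \<Phi> y / hnorm y ^ hom_dim TYPE('n)" for y
  have \<psi>0: "0 \<le> \<psi> y" for y using \<Phi>(2) by (simp add: \<psi>_def hnorm_nonneg)
  let ?g = "\<lambda>x. comm_integrand \<Phi> A (\<lambda>x. of_real (ln (hnorm x)) :: 'k) (\<lambda>x. of_real (hnorm x powr s)) x"
  have "AE x in lborel. set_integrable lebesgue S (?g x) \<and> x \<noteq> 0"
    using defd AE_lborel_nonzero unfolding hausdorff_comm_defined_def AE_completion_iff by eventually_elim simp
  note ae = this
  have "\<exists>x. set_integrable lebesgue S (?g x) \<and> x \<noteq> 0"
  proof (rule ccontr)
    assume "\<nexists>x. set_integrable lebesgue S (?g x) \<and> x \<noteq> 0"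
    then have "AE x in (lborel :: 'n heis measure). False" by (intro eventually_mono[OF ae]) blast
    then show False 
      by (simp add: eventually_False ae_filter_eq_bot_iff)
  qed
  then obtain x where x: "set_integrable lebesgue S (?g x)" "x \<noteq> 0" by blast
  define G where "G y = indicator S y *\<^sub>R ?g x y" for y
  have h: "0 < hnorm x" using x(2) by (simp add: hnorm_pos_iff)
  have gm: "G \<in> borel_measurable lebesgue"
    using x(1) unfolding G_def set_integrable_def by (rule borel_measurable_integrable)
  have gfin: "(\<integral>\<^sup>+y. ennreal (norm (G y)) \<partial>lebesgue) < \<infinity>"
    using x(1) unfolding G_def set_integrable_def integrable_iff_bounded by simp
  have am: "a \<in> borel_measurable lebesgue"
    unfolding a_def using measurable_compose[OF A hmat_norm_borel] by measurable
  have hm: "hnorm \<in> borel_measurable (lebesgue :: 'n heis measure)" by (rule measurable_completion) measurable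
  have Dm: "(\<lambda>y. size_density s \<Phi> A y) \<in> borel_measurable lebesgue"
    unfolding size_density_def a_def[symmetric] using \<Phi>(1) hm am by measurable
  have D: "size_density s \<Phi> A y = \<psi> y * a y powr s" for y by (simp add: size_density_def \<psi>_def a_def)
  \<comment> \<open>The base-2 logarithm accounts for \<open>ln 2\<close>; \<open>d\<close> removes the value of the test function at \<open>x\<close>, and
    \<open>e\<close> is the error \<open>log 2 C\<close>.\<close>
  define d e where "d = hnorm x powr (- s) / ln 2" and "e = ln C / ln 2"
  have de: "0 \<le> d" "0 \<le> e" using C by (auto simp: d_def e_def)
  have "(\<integral>\<^sup>+y. ennreal (size_density s \<Phi> A y * \<bar>log 2 (a y)\<bar>) * indicator S y \<partial>lebesgue)
    \<le> (\<integral>\<^sup>+y. ennreal d * ennreal (norm (G y)) + ennreal e * ennreal (size_density s \<Phi> A y) \<partial>lebesgue)"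
  proof (rule nn_integral_mono_AE, use qd in eventually_elim)
    case (elim y)
    have D0: "0 \<le> size_density s \<Phi> A y" using \<psi>0[of y] by (simp add: D)
    show ?case
    proof (cases "y \<in> S \<and> \<Phi> y \<noteq> 0")
      case True
      define k where "k = hnorm (A y *v x)"
      have qd: "0 < a y" "k \<le> a y * hnorm x" "a y * hnorm x \<le> C * k"
        using elim True by (auto simp: quasi_dilation_def a_def k_def)
      have "0 < a y * hnorm x" using qd h by simp
      then have "0 < C * k" using qd by linarith
      then have k: "0 < k" using C by (simp add: zero_less_mult_iff)
      have "ln k \<le> ln (a y * hnorm x)" "ln (a y * hnorm x) \<le> ln (C * k)"
        using qd h k \<open>0 < C * k\<close> \<open>0 < a y * hnorm x\<close> ln_le_cancel_iff by blast+
      moreover have "ln (a y * hnorm x) = ln (a y) + ln (hnorm x)" "ln (C * k) = ln C + ln k"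
        using qd h k C by (auto intro!: ln_mult_pos)
      ultimately have "ln k \<le> ln (a y) + ln (hnorm x)" "ln (a y) + ln (hnorm x) \<le> ln C + ln k"
        by linarith+
      then have l: "\<bar>ln (a y)\<bar> \<le> \<bar>ln (hnorm x) - ln k\<bar> + ln C" using C by (auto simp: abs_if)
      have "(a y * hnorm x) powr s \<le> k powr s" using s qd k by (intro powr_mono2') auto
      then have ps: "a y powr s \<le> k powr s * hnorm x powr (- s)"
      proof -
        have "0 < hnorm x powr s" using x(2) by simp
        then show ?thesis using \<open>(a y * hnorm x) powr s \<le> k powr s\<close> qd h by (simp add: powr_mult powr_minus field_simps)
      qed
      have ng: "norm (?g x y) = \<psi> y * (k powr s * \<bar>ln (hnorm x) - ln k\<bar>)"
        using \<psi>0[of y] unfolding comm_integrand_def \<psi>_def[symmetric] k_def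
        by (simp add: norm_mult of_real_diff[symmetric] del: of_real_diff)
      have "size_density s \<Phi> A y * \<bar>log 2 (a y)\<bar> = \<psi> y * a y powr s * \<bar>ln (a y)\<bar> / ln 2"
        by (simp add: D log_def abs_divide)
      also have "\<dots> \<le> \<psi> y * a y powr s * (\<bar>ln (hnorm x) - ln k\<bar> + ln C) / ln 2"
        using l \<psi>0[of y] by (intro divide_right_mono mult_left_mono) auto
      also have "\<dots> = \<psi> y * (a y powr s * \<bar>ln (hnorm x) - ln k\<bar>) / ln 2 + e * size_density s \<Phi> A y"
        by (simp add: D e_def add_divide_distrib algebra_simps)
      also have "\<dots> \<le> \<psi> y * ((k powr s * hnorm x powr (- s)) * \<bar>ln (hnorm x) - ln k\<bar>) / ln 2 + e * size_density s \<Phi> A y"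
        using ps \<psi>0[of y] by (intro add_right_mono divide_right_mono mult_left_mono mult_right_mono) auto
      also have "\<dots> = d * norm (?g x y) + e * size_density s \<Phi> A y"
        unfolding ng by (simp add: d_def)
      finally have "ennreal (size_density s \<Phi> A y * \<bar>log 2 (a y)\<bar>) \<le> ennreal (d * norm (?g x y) + e * size_density s \<Phi> A y)"
        by (rule ennreal_leI)
      then show ?thesis using True de D0 by (simp add: G_def ennreal_mult)
    qed (auto simp: size_density_def indicator_def)
  qed
  also have "\<dots> = ennreal d * (\<integral>\<^sup>+y. ennreal (norm (G y)) \<partial>lebesgue)
      + ennreal e * (\<integral>\<^sup>+y. ennreal (size_density s \<Phi> A y) \<partial>lebesgue)"
    using gm Dm by (simp add: nn_integral_add nn_integral_cmult)
  also have "\<dots> < \<infinity>" using gfin fin by (simp add: ennreal_mult_less_top)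
  finally show ?thesis by (simp add: a_def)
qed

section \<open>The equivalence\<close>

text \<open>
  The theorem for an arbitrary measurable set of parameters, with the hypothesis on the inverse
  matrices already replaced by its consequence that almost every relevant \<open>A y\<close> is a quasi-dilation.
\<close>

lemma hausdorff_comm_bounded_iff:
  fixes \<Phi> :: "'n::finite heis \<Rightarrow> real" and A :: "'n heis \<Rightarrow> 'n heis_matrix"
  assumes p: "1 \<le> p" "1 \<le> p1" "1 \<le> p2" "1 / p = 1 / p1 + 1 / p2"
    and lam: "- 1 / p1 < lam" "lam < 0"
    and \<alpha>: "- homdim TYPE('n) < \<alpha>" "0 < \<alpha> \<longrightarrow> (homdim TYPE('n) + \<alpha>) / homdim TYPE('n) < p2"
    and \<Phi>: "\<Phi> \<in> borel_measurable lebesgue" "\<And>y. 0 \<le> \<Phi> y"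
    and A: "A \<in> borel_measurable lebesgue" and S: "S \<in> sets lebesgue" and C: "1 \<le> C"
    and qd: "AE y in lebesgue. \<Phi> y \<noteq> 0 \<longrightarrow> quasi_dilation C (enn2real (hmat_norm (A y))) (A y)"
    and fin: "(\<integral>\<^sup>+y. ennreal (size_density ((homdim TYPE('n) + \<alpha>) * lam) \<Phi> A y) \<partial>lebesgue) < \<infinity>"
  shows "(\<forall>b :: 'n heis \<Rightarrow> 'k::{real_normed_field, banach, second_countable_topology}.
         b \<in> cmo_space p2 (\<lambda>x. hnorm x powr \<alpha>) \<longrightarrow>
         hausdorff_comm_bounded p1 p lam (\<lambda>x. hnorm x powr \<alpha>) S \<Phi> A b)
    \<longleftrightarrow> (\<integral>\<^sup>+y. ennreal (size_density ((homdim TYPE('n) + \<alpha>) * lam) \<Phi> A y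
          * \<bar>log 2 (enn2real (hmat_norm (A y)))\<bar>) * indicator S y \<partial>lebesgue) < \<infinity>"
    (is "?B \<longleftrightarrow> ?I < \<infinity>")
proof
  let ?s = "(homdim TYPE('n) + \<alpha>) * lam"
  assume ?B
  then have "hausdorff_comm_bounded p1 p lam (\<lambda>x. hnorm x powr \<alpha>) S \<Phi> A (\<lambda>x. of_real (ln (hnorm x)) :: 'k)"
    using ln_hnorm_in_cmo_space[OF \<alpha>(1) p(3)] by blast
  then have "hausdorff_comm_defined S \<Phi> A (\<lambda>x. of_real (ln (hnorm x)) :: 'k) (\<lambda>x. of_real (hnorm x powr ?s))"
    using hnorm_powr_in_morrey_space[OF \<alpha>(1) p(2) lam(1)] unfolding hausdorff_comm_bounded_def by blast
  moreover have "?s \<le> 0" using \<alpha>(1) lam by (intro mult_nonneg_nonpos) auto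
  ultimately show "?I < \<infinity>" using log_size_integral_finite[OF _ C \<Phi> A qd fin] by blast
next
  let ?s = "(homdim TYPE('n) + \<alpha>) * lam"
  let ?D = "size_density ?s \<Phi> A" and ?l = "\<lambda>y. \<bar>log 2 (enn2real (hmat_norm (A y)))\<bar>"
  assume I: "?I < \<infinity>"
  have am[measurable]: "(\<lambda>y. enn2real (hmat_norm (A y))) \<in> borel_measurable lebesgue"
    using measurable_compose[OF A hmat_norm_borel] by measurable
  have hm: "hnorm \<in> borel_measurable (lebesgue :: 'n heis measure)" by (rule measurable_completion) measurable
  have Dm[measurable]: "?D \<in> borel_measurable lebesgue"
    unfolding size_density_def using \<Phi>(1) hm am by measurable
  note S[measurable]
  have D0: "0 \<le> ?D y" for y using \<Phi>(2) by (simp add: size_density_def hnorm_nonneg)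
  have "(\<integral>\<^sup>+y. ennreal (?D y * (1 + ?l y)) * indicator S y \<partial>lebesgue)
      \<le> (\<integral>\<^sup>+y. ennreal (?D y) + ennreal (?D y * ?l y) * indicator S y \<partial>lebesgue)"
    using D0 by (intro nn_integral_mono) (simp add: indicator_def ennreal_plus[symmetric] ennreal_leI algebra_simps del: ennreal_plus)
  also have "\<dots> = (\<integral>\<^sup>+y. ennreal (?D y) \<partial>lebesgue) + ?I"
    by (rule nn_integral_add) measurable
  also have "\<dots> < \<infinity>" using I fin by simp
  finally have "(\<integral>\<^sup>+y. ennreal (?D y * (1 + ?l y)) * indicator S y \<partial>lebesgue) < \<infinity>" .
  then show ?B
    using hausdorff_comm_bounded_of_finite_integral[OF \<alpha> p \<Phi> A S C qd] by blast
qed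

theorem theorem1p6:
  fixes p p1 p2 lam \<alpha> C0 Q :: real
    and \<Phi> :: "'n::finite heis \<Rightarrow> real"
    and A :: "'n heis \<Rightarrow> 'n heis_matrix"
    and w :: "'n heis \<Rightarrow> real"
  assumes Q: "Q = real (hom_dim TYPE('n))"
    and w: "w = (\<lambda>x. hnorm x powr \<alpha>)"
    and p: "1 \<le> p" "1 \<le> p1" "1 \<le> p2" "1 / p = 1 / p1 + 1 / p2"
    and lam: "- 1 / p1 < lam" "lam < 0"
    and \<alpha>: "- Q < \<alpha>" "0 < \<alpha> \<longrightarrow> p2 > (Q + \<alpha>) / Q"
    and \<Phi>: "locally_integrable \<Phi>" "\<forall>y. 0 \<le> \<Phi> y"
    and A_meas: "A \<in> borel_measurable lebesgue"
    and A_inv: "AE y in lebesgue. y \<in> supp \<Phi> \<longrightarrow> det (A y) \<noteq> 0"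
    and A_norm: "\<forall>y\<in>supp \<Phi>. det (A y) \<noteq> 0 \<longrightarrow>
      hmat_norm (matrix_inv (A y)) \<le> ennreal C0 * inverse (hmat_norm (A y))"
    and fin: "(\<integral>\<^sup>+y. ennreal (size_density ((Q + \<alpha>) * lam) \<Phi> A y) \<partial>lebesgue) < \<infinity>"
  shows
    "((\<forall>b :: 'n heis \<Rightarrow> 'k::{real_normed_field, banach, second_countable_topology}.
         b \<in> cmo_space p2 w \<longrightarrow>
         hausdorff_comm_bounded p1 p lam w (contracting_set A) \<Phi> A b)
      \<longleftrightarrow>
      (\<integral>\<^sup>+y\<in>contracting_set A. ennreal (size_density ((Q + \<alpha>) * lam) \<Phi> A y
          * \<bar>log 2 (enn2real (hmat_norm (A y)))\<bar>) \<partial>lebesgue) < \<infinity>)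
     \<and>
     ((\<forall>b :: 'n heis \<Rightarrow> 'k.
         b \<in> cmo_space p2 w \<longrightarrow>
         hausdorff_comm_bounded p1 p lam w (expanding_set A) \<Phi> A b)
      \<longleftrightarrow>
      (\<integral>\<^sup>+y\<in>expanding_set A. ennreal (size_density ((Q + \<alpha>) * lam) \<Phi> A y
          * log 2 (enn2real (hmat_norm (A y)))) \<partial>lebesgue) < \<infinity>)"
proof -
  have \<Phi>': "\<Phi> \<in> borel_measurable lebesgue" "\<And>y. 0 \<le> \<Phi> y"
    using \<Phi> locally_integrable_borel_measurable by auto
  have supp: "y \<in> supp \<Phi>" if "\<Phi> y \<noteq> 0" for y
    using that closure_subset[of "{x. \<Phi> x \<noteq> 0}"] by (auto simp: supp_def)
  have qd: "AE y in lebesgue. \<Phi> y \<noteq> 0 \<longrightarrow> quasi_dilation (max C0 1) (enn2real (hmat_norm (A y))) (A y)"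
    using A_inv by eventually_elim (use supp A_norm quasi_dilation_of_inverse_bound(1) in blast)
  have hfin: "AE y in lebesgue. \<Phi> y \<noteq> 0 \<longrightarrow> hmat_norm (A y) < \<infinity>"
    using A_inv by eventually_elim (use supp A_norm quasi_dilation_of_inverse_bound(2) in blast)
  have hA: "(\<lambda>y. hmat_norm (A y)) \<in> borel_measurable lebesgue"
    using measurable_compose[OF A_meas hmat_norm_borel] .
  have S: "contracting_set A \<in> sets lebesgue" "expanding_set A \<in> sets lebesgue"
    using measurable_sets[OF hA, of "{..1}"] measurable_sets[OF hA, of "{1<..}"]
    by (simp_all add: contracting_set_def expanding_set_def vimage_def)
  note iff = hausdorff_comm_bounded_iff[OF p lam \<alpha>[unfolded Q] \<Phi>' A_meas _ _ qd fin[unfolded Q],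
      where ?'k = 'k, folded Q w]
  have "(\<integral>\<^sup>+y. ennreal (size_density ((Q + \<alpha>) * lam) \<Phi> A y
          * \<bar>log 2 (enn2real (hmat_norm (A y)))\<bar>) * indicator (expanding_set A) y \<partial>lebesgue)
      = (\<integral>\<^sup>+y. ennreal (size_density ((Q + \<alpha>) * lam) \<Phi> A y
          * log 2 (enn2real (hmat_norm (A y)))) * indicator (expanding_set A) y \<partial>lebesgue)"
  proof (rule nn_integral_cong_AE, use hfin in eventually_elim)
    case (elim y)
    show ?case
    proof (cases "\<Phi> y \<noteq> 0 \<and> y \<in> expanding_set A")
      case True
      then have "1 \<le> enn2real (hmat_norm (A y))"
        using elim by (cases "hmat_norm (A y)" rule: ennreal_cases) (auto simp: expanding_set_def)
      then show ?thesis by simp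
    qed (auto simp: size_density_def)
  qed
  then show ?thesis using iff[OF S(1)] iff[OF S(2)] by simp
qed

end
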